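(* Let $X$ and $Y$ be ball Banach function spaces whose lower generalized Boyd indices are respectively $p_X$ and $p_Y$. Let $k\in\mathbb N$ and $q\in[1,\infty)$. Assume that $p_Y\in(1,\infty]$ and $n(\frac1{p_Y}-\frac1q)<k$. (i) If $p_X\in(1,\infty]$, then there exist $s_0\in(0,1)$ and a positive constant $C$ such that, for any $s\in(s_0,1)$ and $f\in X\cap\dot W^{k,Y}$, $$\left\|\mathfrak D^{s,k}_q(f)\right\|_{X^{1-s}Y^s}\le C[(s-s_0)(1-s)]^{-\frac1q}\|f\|_X^{1-s}\left\|\nabla^kf\right\|_Y^s,$$ where $C$ is independent of $s$ and $f$. Moreover, if $q\in[1,p_X)$, then there exists a positive constant $C$, independent of $s$ and $f$, such that, for any $s\in(0,1)$ and $f\in X\cap\dot W^{k,Y}$, $$\left\|\mathfrak D^{s,k}_q(f)\right\|_{X^{1-s}Y^s}\le C[s(1-s)]^{-\frac1q}\|f\|_X^{1-s}\left\|\nabla^kf\right\|_Y^s.$$ (ii) There exist $s_0\in(0,1)$ and a positive constant $C$ such that, for any $s\in(s_0,1)$ and $f\in\operatorname{BMO}\cap\dot W^{k,Y}$, $$\left\|\mathfrak D^{s,k}_q(f)\right\|_{Y^{\frac1s}}\le C[(s-s_0)(1-s)]^{-\frac1q}\|f\|_{\operatorname{BMO}}^{1-s}\left\|\nabla^kf\right\|_Y^s,$$ where $C$ is independent of $s$ and $f$.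
   Context: All functions are real-valued measurable functions on $\mathbb R^n$; $L^0$ is the set of all of them. $\Delta_h^kf(x):=\sum_{j=0}^k(-1)^{k-j}\binom kj f(x+jh)$ and, for $s\in(0,1)$, $q\in[1,\infty)$, $\mathfrak D^{s,k}_q(f)(x):=[\int_{\mathbb R^n}\frac{|\Delta_h^kf(x)|^q}{|h|^{n+skq}}\,dh]^{1/q}$. A ball Banach function (BBF) space is a Banach space $X\subset L^0$ with norm $\|\cdot\|_X$ defined (with values in $[0,\infty]$) on all of $L^0$ such that: (a) $\|f\|_X=0$ implies $f=0$ a.e.; (b) $|g|\le|f|$ a.e. implies $\|g\|_X\le\|f\|_X$; (c) $0\le f_m\uparrow f$ a.e. implies $\|f_m\|_X\uparrow\|f\|_X$; (d) $\mathbf 1_B\in X$ for every ball $B$; (e) for every ball $B$ there is $C_{(B)}>0$ with $\int_B|f|\le C_{(B)}\|f\|_X$ for all $f\in X$. For $p\in(0,\infty)$, the $p$-convexification is $X^p:=\{f\in L^0:|f|^p\in X\}$ with $\|f\|_{X^p}:=\||f|^p\|_X^{1/p}$. The lower generalized Boyd index is $p_X:=\sup(\{p\in(1,\infty): X^{1/p}\text{ is a BBF space and } M\text{ is bounded on }X^{1/p}\}\cup\{1\})$, where $M$ is the Hardy–Littlewood maximal operator; $\frac1\infty:=0$. For $s\in(0,1)$, the Calderón–Lozanovskiĭ space $X^{1-s}Y^s$ is the set of $h\in L^0$ with $|h|\le|f|^{1-s}|g|^s$ for some $f\in X$, $g\in Y$, with norm $\|h\|_{X^{1-s}Y^s}:=\inf\{\|f\|_X^{1-s}\|g\|_Y^s:|h|\le|f|^{1-s}|g|^s\}$.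 $\dot W^{k,Y}$ is the set of all $f\in L^1_{\rm loc}$ whose weak derivatives $\partial^\alpha f$ exist and belong to $Y$ for all $|\alpha|=k$; $\|\nabla^kf\|_Y:=\||\nabla^kf|\|_Y$. $\operatorname{BMO}$ is the space of $f\in L^1_{\rm loc}$ with $\|f\|_{\operatorname{BMO}}:=\sup_Q\inf_{c\in\mathbb R}\frac1{|Q|}\int_Q|f-c|<\infty$ (supremum over all cubes). *)

theory Defs
  imports "HOL-Analysis.Analysis"
begin

definition L0 :: "(real^'n::finite \<Rightarrow> real) set" where
  "L0 = borel_measurable lebesgue"

text \<open>Only used with positive exponents, so that \<open>0\<close> and \<open>\<infinity>\<close> are fixed.\<close>

definition enn_powr :: "ennreal \<Rightarrow> real \<Rightarrow> ennreal" where
  "enn_powr t a = (if t = top then top else ennreal (enn2real t powr a))"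

text \<open>
  A space is given by its norm functional, with values in \<open>[0,\<infinity>]\<close>, on \<open>L0\<close>; the space
  itself consists of the measurable functions with finite norm. Functions are not identified
  up to null sets; invariance under a.e. equality follows from monotonicity of the norm.
  Values of the functional outside \<open>L0\<close> are irrelevant.
\<close>

definition bf_space :: "((real^'n::finite \<Rightarrow> real) \<Rightarrow> ennreal) \<Rightarrow> (real^'n \<Rightarrow> real) set" where
  "bf_space N = {f \<in> L0. N f < top}"

definition banach_norm :: "((real^'n::finite \<Rightarrow> real) \<Rightarrow> ennreal) \<Rightarrow> bool" where
  "banach_norm N \<longleftrightarrow>
     (\<forall>f\<in>L0. \<forall>c::real. N (\<lambda>x. c * f x) = ennreal \<bar>c\<bar> * N f) \<and>
     (\<forall>f\<in>L0. \<forall>g\<in>L0. N (\<lambda>x. f x + g x) \<le> N f + N g) \<and>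
     (\<forall>F::nat \<Rightarrow> real^'n \<Rightarrow> real.
        (\<forall>m. F m \<in> bf_space N) \<and>
        (\<forall>e>0. \<exists>K. \<forall>i\<ge>K. \<forall>j\<ge>K. N (\<lambda>x. F i x - F j x) < ennreal e) \<longrightarrow>
        (\<exists>f\<in>bf_space N. (\<lambda>m. N (\<lambda>x. F m x - f x)) \<longlonglongrightarrow> 0))"

definition BBF :: "((real^'n::finite \<Rightarrow> real) \<Rightarrow> ennreal) \<Rightarrow> bool" where
  "BBF N \<longleftrightarrow>
     banach_norm N \<and>
     (\<forall>f\<in>L0. N f = 0 \<longrightarrow> (AE x in lebesgue. f x = 0)) \<and>
     (\<forall>f\<in>L0. \<forall>g\<in>L0. (AE x in lebesgue. \<bar>g x\<bar> \<le> \<bar>f x\<bar>) \<longrightarrow> N g \<le> N f) \<and>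
     (\<forall>F f. (\<forall>m::nat. F m \<in> L0) \<and> f \<in> L0 \<and>
        (AE x in lebesgue. (\<forall>m. 0 \<le> F m x) \<and> incseq (\<lambda>m. F m x) \<and> (\<lambda>m. F m x) \<longlonglongrightarrow> f x) \<longrightarrow>
        incseq (\<lambda>m. N (F m)) \<and> (\<lambda>m. N (F m)) \<longlonglongrightarrow> N f) \<and>
     (\<forall>c. \<forall>r>0. indicator (ball c r) \<in> bf_space N) \<and>
     (\<forall>c. \<forall>r>0. \<exists>C>0. \<forall>f\<in>bf_space N.
        (\<integral>\<^sup>+x\<in>ball c r. ennreal \<bar>f x\<bar> \<partial>lebesgue) \<le> ennreal C * N f)"

text \<open>
  Norm of a \<open>[0,\<infinity>]\<close>-valued function: it is infinite unless the function is measurable and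
  a.e. finite, i.e. a.e. equal to an element of \<open>L0\<close>.
\<close>

definition ext_norm ::
  "((real^'n::finite \<Rightarrow> real) \<Rightarrow> ennreal) \<Rightarrow> (real^'n \<Rightarrow> ennreal) \<Rightarrow> ennreal" where
  "ext_norm N G =
     (if G \<in> borel_measurable lebesgue \<and> (AE x in lebesgue. G x < top)
      then N (\<lambda>x. enn2real (G x)) else top)"

definition convexification ::
  "real \<Rightarrow> ((real^'n::finite \<Rightarrow> real) \<Rightarrow> ennreal) \<Rightarrow> (real^'n \<Rightarrow> real) \<Rightarrow> ennreal" where
  "convexification p N f = enn_powr (N (\<lambda>x. \<bar>f x\<bar> powr p)) (1 / p)"

definition HL_maximal :: "(real^'n::finite \<Rightarrow> real) \<Rightarrow> real^'n \<Rightarrow> ennreal" where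
  "HL_maximal f x = (SUP (c, r) \<in> {(c, r). 0 < r \<and> x \<in> ball c r}.
     (\<integral>\<^sup>+y\<in>ball c r. ennreal \<bar>f y\<bar> \<partial>lebesgue) / emeasure lebesgue (ball c r))"

definition HL_maximal_bounded_on :: "((real^'n::finite \<Rightarrow> real) \<Rightarrow> ennreal) \<Rightarrow> bool" where
  "HL_maximal_bounded_on N \<longleftrightarrow>
     (\<exists>C>0. \<forall>f\<in>bf_space N. ext_norm N (HL_maximal f) \<le> ennreal C * N f)"

definition lower_boyd :: "((real^'n::finite \<Rightarrow> real) \<Rightarrow> ennreal) \<Rightarrow> ereal" where
  "lower_boyd N =
     Sup ({ereal p | p. 1 < p \<and> BBF (convexification (1 / p) N) \<and>
                        HL_maximal_bounded_on (convexification (1 / p) N)} \<union> {1})"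

definition calderon_lozanovskii ::
  "real \<Rightarrow> ((real^'n::finite \<Rightarrow> real) \<Rightarrow> ennreal) \<Rightarrow> ((real^'n \<Rightarrow> real) \<Rightarrow> ennreal)
     \<Rightarrow> (real^'n \<Rightarrow> real) \<Rightarrow> ennreal" where
  "calderon_lozanovskii s X Y h =
     Inf {enn_powr (X f) (1 - s) * enn_powr (Y g) s | f g.
            f \<in> bf_space X \<and> g \<in> bf_space Y \<and>
            (AE x in lebesgue. \<bar>h x\<bar> \<le> \<bar>f x\<bar> powr (1 - s) * \<bar>g x\<bar> powr s)}"

definition L1_loc :: "(real^'n::finite \<Rightarrow> real) set" where
  "L1_loc = {f \<in> L0. \<forall>K. compact K \<longrightarrow> f absolutely_integrable_on K}"

definition partial :: "'n::finite \<Rightarrow> (real^'n \<Rightarrow> real) \<Rightarrow> real^'n \<Rightarrow> real" where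
  "partial i \<phi> x = frechet_derivative \<phi> (at x) (axis i 1)"

definition partials :: "'n::finite list \<Rightarrow> (real^'n \<Rightarrow> real) \<Rightarrow> real^'n \<Rightarrow> real" where
  "partials is \<phi> = foldr partial is \<phi>"

text \<open>Total differentiability of all iterated partial derivatives is the same as \<open>C\<^sup>\<infinity>\<close>.\<close>

definition test_function :: "(real^'n::finite \<Rightarrow> real) \<Rightarrow> bool" where
  "test_function \<phi> \<longleftrightarrow>
     (\<forall>is x. partials is \<phi> differentiable (at x)) \<and> compact (closure {x. \<phi> x \<noteq> 0})"

text \<open>
  A multi-index is a function \<open>\<alpha> :: 'n \<Rightarrow> nat\<close>. The classical derivative of order \<open>\<alpha>\<close> of a test
  function is \<open>partials is \<phi>\<close> for any list \<open>is\<close> in which every \<open>i\<close> occurs \<open>\<alpha> i\<close> times; the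
  order of the list does not matter.
\<close>

definition has_weak_deriv ::
  "(real^'n::finite \<Rightarrow> real) \<Rightarrow> ('n \<Rightarrow> nat) \<Rightarrow> (real^'n \<Rightarrow> real) \<Rightarrow> bool" where
  "has_weak_deriv f \<alpha> g \<longleftrightarrow>
     f \<in> L1_loc \<and> g \<in> L1_loc \<and>
     (\<forall>\<phi> is. test_function \<phi> \<and> (\<forall>i. count_list is i = \<alpha> i) \<longrightarrow>
        (LINT x|lebesgue. f x * partials is \<phi> x) =
        (-1) ^ (\<Sum>i\<in>UNIV. \<alpha> i) * (LINT x|lebesgue. g x * \<phi> x))"

text \<open>Unique up to null sets, when it exists.\<close>

definition weak_deriv :: "('n \<Rightarrow> nat) \<Rightarrow> (real^'n::finite \<Rightarrow> real) \<Rightarrow> real^'n \<Rightarrow> real" where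
  "weak_deriv \<alpha> f = (SOME g. has_weak_deriv f \<alpha> g)"

definition multi_indices :: "nat \<Rightarrow> ('n::finite \<Rightarrow> nat) set" where
  "multi_indices k = {\<alpha>. (\<Sum>i\<in>UNIV. \<alpha> i) = k}"

definition hom_sobolev ::
  "nat \<Rightarrow> ((real^'n::finite \<Rightarrow> real) \<Rightarrow> ennreal) \<Rightarrow> (real^'n \<Rightarrow> real) set" where
  "hom_sobolev k Y =
     {f \<in> L1_loc. \<forall>\<alpha>\<in>multi_indices k. \<exists>g\<in>bf_space Y. has_weak_deriv f \<alpha> g}"

definition grad_norm :: "nat \<Rightarrow> (real^'n::finite \<Rightarrow> real) \<Rightarrow> real^'n \<Rightarrow> real" where
  "grad_norm k f x = sqrt (\<Sum>\<alpha>\<in>multi_indices k. (weak_deriv \<alpha> f x)\<^sup>2)"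

text \<open>The cubes are those with edges parallel to the coordinate axes.\<close>

definition cube :: "real^'n::finite \<Rightarrow> real \<Rightarrow> (real^'n) set" where
  "cube a l = cbox a (\<chi> i. a $ i + l)"

definition BMO_norm :: "(real^'n::finite \<Rightarrow> real) \<Rightarrow> ennreal" where
  "BMO_norm f = (SUP (a, l) \<in> {(a, l). 0 < l}. INF c::real.
     (\<integral>\<^sup>+x\<in>cube a l. ennreal \<bar>f x - c\<bar> \<partial>lebesgue) / emeasure lebesgue (cube a l))"

definition BMO :: "(real^'n::finite \<Rightarrow> real) set" where
  "BMO = {f \<in> L1_loc. BMO_norm f < top}"

definition fin_diff :: "nat \<Rightarrow> real^'n::finite \<Rightarrow> (real^'n \<Rightarrow> real) \<Rightarrow> real^'n \<Rightarrow> real" where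
  "fin_diff k h f x = (\<Sum>j\<le>k. (-1) ^ (k - j) * real (k choose j) * f (x + real j *\<^sub>R h))"

definition frac_D ::
  "real \<Rightarrow> real \<Rightarrow> nat \<Rightarrow> (real^'n::finite \<Rightarrow> real) \<Rightarrow> real^'n \<Rightarrow> ennreal" where
  "frac_D q s k f x = enn_powr
     (\<integral>\<^sup>+h. ennreal (\<bar>fin_diff k h f x\<bar> powr q
                      / norm h powr (real CARD('n) + s * real k * q)) \<partial>lebesgue) (1 / q)"

end

theory Submission
  imports Defs
begin

text \<open>
  Let \<open>d h y\<close> be the absolute value of the \<open>k\<close>-th difference of \<open>f\<close> at \<open>y\<close> with step \<open>h\<close>, and \<open>g\<close> the norm of
  the \<open>k\<close>-th gradient. Taylor's formula for smooth bumps gives, after duality, that \<open>d h y\<close> is at most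
  a constant times \<open>|h|^k\<close> times the integral of \<open>t^(k-1) g (y + t h)\<close> over \<open>0 < t \<le> k\<close>, for almost all \<open>y\<close>.

  Fix a point \<open>x\<close> at which all \<open>r\<close>-th power means of \<open>g\<close> over balls are at most \<open>G\<close> and all mean
  oscillations of \<open>f\<close> at most \<open>F\<close>. Differences with steps \<open>h\<close> and \<open>w\<close> commute, so \<open>d w x\<close> is at most \<open>d h x\<close> plus
  differences at the shifted points \<open>x + j h\<close> and \<open>x + j w\<close> with \<open>j \<ge> 1\<close>, whose averages are controlled by
  \<open>min F (\<rho>^k G)\<close>. Summing over dyadic radii, and using a fractional integration estimate for the
  exponent \<open>q\<close>, the mean of \<open>(d h x)^q\<close> over \<open>|h| < \<rho>\<close> is at most a constant times \<open>(\<rho>^k G)^q\<close> and, if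
  \<open>F \<le> \<rho>^k G\<close>, a constant times \<open>(F^(1-\<theta>) (\<rho>^k G)^\<theta>)^q\<close> for some \<open>\<theta> < 1\<close>. Integrating over \<open>\<rho>\<close> and splitting at
  \<open>\<rho>^k = F / G\<close> bounds the fractional derivative at \<open>x\<close> by a constant times
  \<open>((s-\<theta>) (1-s))^(-1/q) F^(1-s) G^s\<close>. If the \<open>q\<close>-th power means of \<open>f\<close> itself are bounded by \<open>F\<close>, then \<open>\<theta> = 0\<close> is allowed.

  The theorem follows by taking for \<open>G\<close> and \<open>F\<close> the maximal functions provided by the Boyd indices
  of \<open>Y\<close> and \<open>X\<close>, or for \<open>F\<close> the \<open>BMO\<close> norm.
\<close>

section \<open>Powers of extended nonnegative reals\<close>

text \<open>The information on \<open>f\<close> and \<open>g\<close> concerns averages only, so a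
  difference at the single point \<open>x\<close> has to be traded for averaged ones. Exchanging two
  steps does this: the terms with \<open>j \<ge> 1\<close> sit at points that sweep a ball once a
  step is averaged, and the one term left at \<open>x\<close> reappears at half the radius, which
  makes the dyadic sum telescope. The loss \<theta> has two sources. The sum over scales is
  geometric with ratio \<open>2 powr (- k * \<theta>)\<close>, hence \<open>\<theta> > 0\<close>;
  and the \<open>q\<close>-th power of the shifted averages is interpolated between the exponents 1
  and some \<open>p > q\<close>, which costs
  \<open>\<theta> \<ge> p * (q - 1) / (q * (p - 1))\<close>. Such a \<open>p\<close> exists because
  the inequality between \<open>n\<close>, \<open>k\<close>, \<open>q\<close> and the Boyd index of
  \<open>Y\<close> is strict, and \<open>p > q\<close> leaves room for \<theta> below 1. This
  \<theta> serves as \<open>s0\<close>. Norms and weak derivatives live on the completed Lebesgue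
  measure, whereas Fubini and composition with affine maps call for Borel functions. The estimates
  are therefore made for Borel representatives over \<open>lborel\<close>.\<close>

lemma enn_powr_ennreal [simp]: "0 \<le> x \<Longrightarrow> enn_powr (ennreal x) a = ennreal (x powr a)"
  by (simp add: enn_powr_def)

lemma enn_powr_0 [simp]: "enn_powr 0 a = 0"
  by (simp add: enn_powr_def)

lemma enn_powr_top [simp]: "enn_powr top a = top"
  by (simp add: enn_powr_def)

lemma enn_powr_eq_top_iff [simp]: "enn_powr t a = top \<longleftrightarrow> t = top"
  by (simp add: enn_powr_def)

lemma enn_powr_less_top_iff [simp]: "enn_powr t a < top \<longleftrightarrow> t < top"
  by (metis enn_powr_eq_top_iff top.not_eq_extremum)

lemma enn_powr_mono:
  assumes "0 \<le> a" "t \<le> u"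
  shows "enn_powr t a \<le> enn_powr u a"
  using assms by (cases t; cases u) (auto simp: top_unique intro!: ennreal_leI powr_mono2)

lemma enn_powr_mult:
  "enn_powr (t * u) a = enn_powr t a * enn_powr u a"
proof (cases "t = top \<or> u = top")
  case True
  then show ?thesis
    by (cases "t = 0"; cases "u = 0")
      (auto simp: ennreal_top_mult ennreal_mult_top enn_powr_def enn2real_eq_0_iff)
next
  case False
  then obtain x y where "t = ennreal x" "0 \<le> x" "u = ennreal y" "0 \<le> y"
    by (metis ennreal_cases)
  then show ?thesis
    by (simp add: ennreal_mult[symmetric] powr_mult)
qed

lemma enn_powr_powr: "enn_powr (enn_powr t a) b = enn_powr t (a * b)"
  by (cases t) (auto simp: powr_powr)

lemma enn_powr_1 [simp]: "enn_powr t 1 = t"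
  by (cases t) auto

lemma enn_powr_add: "enn_powr t (a + b) = enn_powr t a * enn_powr t b"
  by (cases t) (auto simp: powr_add ennreal_mult)

lemma measurable_enn_powr [measurable (raw)]:
  assumes [measurable]: "u \<in> borel_measurable M"
  shows "(\<lambda>x. enn_powr (u x) a) \<in> borel_measurable M"
  unfolding enn_powr_def by measurable

text \<open>Summed with a suitable \<open>l\<close>, this linear inequality replaces Hoelder's inequality for
  interpolation between exponents.\<close>

lemma enn_powr_interpolate:
  assumes "0 < l" "a \<le> q" "q \<le> b"
  shows "enn_powr u q \<le> ennreal (l powr (q - a)) * enn_powr u a + ennreal (l powr (q - b)) * enn_powr u b"
proof (cases u)
  case (real x)
  have "x powr q \<le> l powr (q - a) * x powr a + l powr (q - b) * x powr b"
  proof (cases "x = 0")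
    case False
    then have x: "0 < x" using real by simp
    show ?thesis
    proof (cases "x \<le> l")
      case True
      have "x powr q = x powr (q - a) * x powr a" by (simp add: powr_add[symmetric])
      also have "\<dots> \<le> l powr (q - a) * x powr a"
        using x True assms by (intro mult_right_mono powr_mono2) auto
      finally show ?thesis by (simp add: add_increasing2)
    next
      case False
      have "x powr q = x powr (q - b) * x powr b" by (simp add: powr_add[symmetric])
      also have "\<dots> \<le> l powr (q - b) * x powr b"
        using x False assms by (intro mult_right_mono powr_mono2') auto
      finally show ?thesis by (simp add: add_increasing)
    qed
  qed simp
  then show ?thesis
    using real by (simp add: ennreal_mult[symmetric] ennreal_plus[symmetric] ennreal_leI del: ennreal_plus)
next
  case top
  then show ?thesis using assms by (simp add: ennreal_mult_top)
qed

text \<open>The same dichotomy at level \<open>l\<close> for the exponents 0, 1 and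
  \<open>p\<close>, with the constant 1 in place of the zeroth power, which evaluates to 0 at
  \<open>u = 0\<close>.\<close>

lemma ennreal_le_const_powr:
  assumes "0 < l" "1 \<le> p"
  shows "u \<le> ennreal l + ennreal (l powr (1 - p)) * enn_powr u p"
proof (cases u)
  case (real x)
  have "x \<le> l + l powr (1 - p) * x powr p"
  proof (cases "x \<le> l")
    case True
    then show ?thesis by (simp add: add_increasing2)
  next
    case False
    then have x: "0 < x" using assms by simp
    have "x = x powr (1 - p) * x powr p" using x by (simp add: powr_add[symmetric])
    also have "\<dots> \<le> l powr (1 - p) * x powr p"
      using x False assms by (intro mult_right_mono powr_mono2') auto
    finally show ?thesis using assms by simp
  qed
  then show ?thesis
    using real assms by (simp add: ennreal_mult[symmetric] ennreal_plus[symmetric] ennreal_leI del: ennreal_plus)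
next
  case top
  then show ?thesis using assms by (simp add: ennreal_mult_top)
qed

text \<open>Bounding every term by the largest one avoids convexity, so the estimate covers all
  exponents \<open>q \<ge> 0\<close>.\<close>

lemma enn_powr_sum_le:
  assumes "finite I" "0 \<le> q"
  shows "enn_powr (\<Sum>i\<in>I. u i) q \<le> ennreal (real (card I) powr q) * (\<Sum>i\<in>I. enn_powr (u i) q)"
proof (cases "I = {}")
  case False
  then have "Max (u ` I) \<in> u ` I" using assms by auto
  then obtain i where i: "i \<in> I" "u i = Max (u ` I)" by auto
  have "(\<Sum>j\<in>I. u j) \<le> of_nat (card I) * u i"
    using assms i by (intro sum_bounded_above) auto
  then have "enn_powr (\<Sum>i\<in>I. u i) q \<le> enn_powr (ennreal (card I) * u i) q"
    using assms by (intro enn_powr_mono) (auto simp: ennreal_of_nat_eq_real_of_nat)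
  also have "\<dots> = ennreal (real (card I) powr q) * enn_powr (u i) q"
    by (simp add: enn_powr_mult)
  also have "enn_powr (u i) q \<le> (\<Sum>i\<in>I. enn_powr (u i) q)"
    using assms i by (intro member_le_sum) auto
  finally show ?thesis by (simp add: mult_left_mono)
qed simp

lemma enn_powr_add_le:
  assumes "0 \<le> q"
  shows "enn_powr (t + u) q \<le> ennreal (2 powr q) * (enn_powr t q + enn_powr u q)"
  using enn_powr_sum_le[of "{True, False}" q "\<lambda>b. if b then t else u"] assms by simp

text \<open>Jensen's inequality up to the factor \<open>2 powr p\<close>: the linear inequality at
  level \<open>l\<close> is integrated first and \<open>l\<close> is optimised afterwards.\<close>

lemma enn_powr_nn_integral_le:
  assumes [measurable]: "u \<in> borel_measurable M" and m: "emeasure M (space M) \<le> ennreal m" "0 < m" and p: "1 \<le> p"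
  shows "enn_powr (\<integral>\<^sup>+x. u x \<partial>M) p \<le> ennreal (2 powr p * m powr (p - 1)) * (\<integral>\<^sup>+x. enn_powr (u x) p \<partial>M)"
proof -
  let ?U = "\<integral>\<^sup>+x. u x \<partial>M" and ?I = "\<integral>\<^sup>+x. enn_powr (u x) p \<partial>M"
  have key: "?U \<le> ennreal (l * m) + ennreal (l powr (1 - p)) * ?I" if l: "0 < l" for l
  proof -
    have "?U \<le> (\<integral>\<^sup>+x. ennreal l + ennreal (l powr (1 - p)) * enn_powr (u x) p \<partial>M)"
      by (intro nn_integral_mono ennreal_le_const_powr l p)
    also have "\<dots> = ennreal l * emeasure M (space M) + ennreal (l powr (1 - p)) * ?I"
      by (simp add: nn_integral_add nn_integral_cmult)
    also have "ennreal l * emeasure M (space M) \<le> ennreal l * ennreal m"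
      using m by (intro mult_left_mono) auto
    finally show ?thesis using l m by (simp add: ennreal_mult)
  qed
  show ?thesis
  proof (cases ?I)
    case (real I)
    \<comment> \<open>Level 1 only shows that the integral is finite, which permits the absorption
      below.\<close>
    have fin: "?U < top"
      using key[of 1] real by (auto simp: less_top[symmetric] top_unique ennreal_mult[symmetric])
    then obtain U where U: "?U = ennreal U" "0 \<le> U" by (cases ?U) auto
    have "U powr p \<le> 2 powr p * m powr (p - 1) * I"
    proof (cases "U = 0")
      case False
      then have Up: "0 < U" using U by simp
      \<comment> \<open>Half of the mean value, so that \<open>l * m = U / 2\<close> is absorbed on
        the left.\<close>
      define l where "l = U / (2 * m)"
      have l: "0 < l" using Up m by (simp add: l_def)
      have "U \<le> l * m + l powr (1 - p) * I"
        using key[OF l] U real l m by (simp add: ennreal_mult[symmetric] ennreal_plus[symmetric] del: ennreal_plus)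
      then have "U / 2 \<le> l powr (1 - p) * I" using m by (simp add: l_def)
      then have "l powr (p - 1) * (U / 2) \<le> l powr (p - 1) * (l powr (1 - p) * I)"
        by (intro mult_left_mono) auto
      also have "\<dots> = I" using l by (simp add: mult.assoc[symmetric] powr_add[symmetric])
      finally have *: "l powr (p - 1) * (U / 2) \<le> I" .
      have "U powr p = U powr (p - 1) * U" using Up by (simp add: powr_diff)
      also have "U powr (p - 1) = l powr (p - 1) * ((2 * m) powr (p - 1))"
        using Up m by (simp add: l_def powr_mult[symmetric])
      also have "l powr (p - 1) * (2 * m) powr (p - 1) * U = 2 * (2 * m) powr (p - 1) * (l powr (p - 1) * (U / 2))"
        by simp
      also have "\<dots> \<le> 2 * (2 * m) powr (p - 1) * I" using * by (intro mult_left_mono) auto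
      also have "2 * (2 * m) powr (p - 1) = 2 powr p * m powr (p - 1)"
        using m by (simp add: powr_mult powr_diff)
      finally show ?thesis .
    qed (use real m in simp)
    then show ?thesis using U real m
      by (simp add: ennreal_mult[symmetric] ennreal_leI)
  next
    case top
    then show ?thesis using m by (simp add: ennreal_mult_top)
  qed
qed

section \<open>Averages over balls\<close>

text \<open>Averages over \<open>ball c \<rho>\<close> are written as integrals of \<open>\<lambda>w. \<phi> (c + \<rho> *\<^sub>R w)\<close> over this
  probability measure.\<close>

definition unif_ball :: "'a::euclidean_space measure" where
  "unif_ball = uniform_measure lborel (ball 0 1)"

lemma sets_unif_ball [measurable_cong, simp]: "sets unif_ball = sets borel"
  by (simp add: unif_ball_def)

lemma space_unif_ball [simp]: "space unif_ball = UNIV"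
  by (simp add: unif_ball_def)

lemma emeasure_ball_pos_finite:
  assumes "0 < r"
  shows "emeasure lborel (ball (c::'a::euclidean_space) r) \<noteq> 0" "emeasure lborel (ball c r) \<noteq> \<infinity>"
  using assms unit_ball_vol_pos[of "real DIM('a)"] by (auto simp: emeasure_ball simp del: unit_ball_vol_pos)

lemma emeasure_unif_ball [simp]: "emeasure unif_ball UNIV = 1"
proof -
  have "emeasure unif_ball (UNIV::'a set) = emeasure lborel (UNIV \<inter> ball 0 1 :: 'a set) / emeasure lborel (ball 0 1 :: 'a set)"
    unfolding unif_ball_def by (subst emeasure_uniform_measure) auto
  then show ?thesis
    using emeasure_ball_pos_finite[of 1 "0::'a"] by (simp add: ennreal_divide_self less_top)
qed

interpretation unif_ball: finite_measure "unif_ball :: 'a::euclidean_space measure"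
  by standard simp

lemma nn_integral_unif_ball_const [simp]: "(\<integral>\<^sup>+w. c \<partial>unif_ball) = c"
  by simp

lemma AE_unif_ball_norm: "AE w in unif_ball. norm w < 1"
  unfolding unif_ball_def by (rule AE_uniform_measureI) auto

lemma AE_unif_ballI: "AE w in lborel. P w \<Longrightarrow> AE w in unif_ball. P w"
  unfolding unif_ball_def by (rule AE_uniform_measureI) auto

lemma nn_integral_lborel_affine:
  fixes \<phi> :: "'a::euclidean_space \<Rightarrow> ennreal"
  assumes [measurable]: "\<phi> \<in> borel_measurable borel" and "c \<noteq> 0"
  shows "(\<integral>\<^sup>+y. \<phi> y \<partial>lborel) = ennreal (\<bar>c\<bar> ^ DIM('a)) * (\<integral>\<^sup>+w. \<phi> (t + c *\<^sub>R w) \<partial>lborel)"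
  by (subst lborel_affine[OF \<open>c \<noteq> 0\<close>, of t])
     (simp add: nn_integral_density nn_integral_distr nn_integral_cmult)

text \<open>Affine maps pull null sets back to null sets. A statement about almost every point thus
  becomes one about almost every point of the unit ball, seen from a fixed centre at a fixed
  scale.\<close>

lemma AE_lborel_affine:
  fixes P :: "'a::euclidean_space \<Rightarrow> bool"
  assumes ae: "AE y in lborel. P y" and "c \<noteq> 0"
  shows "AE w in lborel. P (t + c *\<^sub>R w)"
proof -
  obtain N where N: "N \<in> null_sets lborel" "{y. \<not> P y} \<subseteq> N"
    using ae by (auto simp: eventually_ae_filter)
  then have [measurable]: "N \<in> sets borel" by auto
  have "0 = (\<integral>\<^sup>+y. indicator N y \<partial>lborel)" using N null_setsD1[OF N(1)] by simp
  also have "\<dots> = ennreal (\<bar>c\<bar> ^ DIM('a)) * (\<integral>\<^sup>+w. indicator N (t + c *\<^sub>R w) \<partial>lborel)"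
    by (rule nn_integral_lborel_affine) (use assms in auto)
  finally have "(\<integral>\<^sup>+w. indicator N (t + c *\<^sub>R w) \<partial>lborel) = 0"
    using assms by simp
  then have "AE w in lborel. indicator N (t + c *\<^sub>R w) = (0::ennreal)"
    by (subst (asm) nn_integral_0_iff_AE) auto
  then show ?thesis
    by eventually_elim (use N in \<open>auto simp: indicator_def split: if_splits\<close>)
qed

lemma nn_integral_unif_ball:
  fixes \<phi> :: "'a::euclidean_space \<Rightarrow> ennreal"
  assumes [measurable]: "\<phi> \<in> borel_measurable borel" and r: "0 < r"
  shows "(\<integral>\<^sup>+w. \<phi> (c + r *\<^sub>R w) \<partial>unif_ball) =
    (\<integral>\<^sup>+y\<in>ball c r. \<phi> y \<partial>lborel) / emeasure lborel (ball c r)"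
proof -
  have eq: "indicator (ball c r) (c + r *\<^sub>R w) = (indicator (ball 0 1) w :: ennreal)" for w
    using r by (auto simp: indicator_def dist_norm)
  define V where "V = unit_ball_vol (real DIM('a))"
  have V: "0 < V" by (simp add: V_def)
  let ?J = "\<integral>\<^sup>+w. \<phi> (c + r *\<^sub>R w) * indicator (ball 0 1) w \<partial>lborel"
  have "(\<integral>\<^sup>+y\<in>ball c r. \<phi> y \<partial>lborel) = ennreal (r ^ DIM('a)) * ?J"
    using r by (subst nn_integral_lborel_affine[where c=r and t=c]) (measurable, auto simp: eq)
  then have "(\<integral>\<^sup>+y\<in>ball c r. \<phi> y \<partial>lborel) / emeasure lborel (ball c r) = ennreal (r ^ DIM('a)) * ?J / ennreal (V * r ^ DIM('a))"
    using r by (simp add: emeasure_ball V_def)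
  also have "\<dots> = ?J / ennreal V"
  proof -
    have "ennreal (inverse V) = ennreal (r ^ DIM('a)) * ennreal (inverse (V * r ^ DIM('a)))"
      using r V by (subst ennreal_mult[symmetric]) (auto simp: field_simps)
    then show ?thesis
      using r V by (simp add: divide_ennreal_def inverse_ennreal mult_ac del: inverse_mult_distrib)
  qed
  also have "\<dots> = (\<integral>\<^sup>+w. \<phi> (c + r *\<^sub>R w) \<partial>unif_ball)"
    unfolding unif_ball_def by (subst nn_integral_uniform_measure) (auto simp: emeasure_ball V_def)
  finally show ?thesis ..
qed

text \<open>The ball around \<open>c\<close> lies in the ball around \<open>x\<close>, and the
  factor is the ratio of the volumes. Averages around shifted centres are reduced in this way to
  averages around \<open>x\<close>, the only centre at which means are controlled.\<close>

lemma nn_integral_unif_ball_mono_ball: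
  fixes \<phi> :: "'a::euclidean_space \<Rightarrow> ennreal"
  assumes [measurable]: "\<phi> \<in> borel_measurable borel" and r: "0 < r" and sub: "norm (c - x) + r \<le> R"
  shows "(\<integral>\<^sup>+w. \<phi> (c + r *\<^sub>R w) \<partial>unif_ball) \<le> ennreal ((R / r) ^ DIM('a)) * (\<integral>\<^sup>+w. \<phi> (x + R *\<^sub>R w) \<partial>unif_ball)"
proof -
  have R: "0 < R" using r sub norm_ge_zero[of "c - x"] by linarith
  have s: "ball c r \<subseteq> ball x R"
  proof
    fix y assume "y \<in> ball c r"
    then have "dist c y < r" by simp
    moreover have "dist x y \<le> dist x c + dist c y" by (rule dist_triangle)
    moreover have "dist x c = norm (c - x)" by (metis dist_norm norm_minus_commute)
    ultimately show "y \<in> ball x R" using sub by simp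
  qed
  define V where "V = unit_ball_vol (real DIM('a))"
  have V: "0 < V" by (simp add: V_def)
  have "(\<integral>\<^sup>+w. \<phi> (c + r *\<^sub>R w) \<partial>unif_ball) = (\<integral>\<^sup>+y\<in>ball c r. \<phi> y \<partial>lborel) / emeasure lborel (ball c r)"
    by (rule nn_integral_unif_ball) (use r in auto)
  also have "\<dots> \<le> (\<integral>\<^sup>+y\<in>ball x R. \<phi> y \<partial>lborel) / emeasure lborel (ball c r)"
    using s by (intro divide_right_mono_ennreal nn_integral_mono mult_left_mono) (auto simp: indicator_def)
  also have "\<dots> = ennreal ((R / r) ^ DIM('a)) * ((\<integral>\<^sup>+y\<in>ball x R. \<phi> y \<partial>lborel) / emeasure lborel (ball x R))"
  proof -
    have "ennreal (inverse (V * r ^ DIM('a))) = ennreal ((R / r) ^ DIM('a)) * ennreal (inverse (V * R ^ DIM('a)))"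
      using R r V by (subst ennreal_mult[symmetric]) (auto simp: field_simps)
    then show ?thesis
      using R r V by (simp add: emeasure_ball V_def[symmetric] divide_ennreal_def inverse_ennreal mult_ac)
  qed
  also have "(\<integral>\<^sup>+y\<in>ball x R. \<phi> y \<partial>lborel) / emeasure lborel (ball x R) = (\<integral>\<^sup>+w. \<phi> (x + R *\<^sub>R w) \<partial>unif_ball)"
    by (rule nn_integral_unif_ball[symmetric]) (use R in auto)
  finally show ?thesis .
qed

lemma enn2real_eq_iff_finite: "a < top \<Longrightarrow> b < top \<Longrightarrow> enn2real a = enn2real b \<longleftrightarrow> a = b"
  by (cases a; cases b) auto

section \<open>Smooth bumps and the fundamental lemma of the calculus of variations\<close>

text \<open>The counter is off by one: \<open>times_differentiable m\<close> asks for
  \<open>m + 1\<close> derivatives. This disappears in \<open>smooth_real\<close>, where all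
  \<open>m\<close> occur.\<close>

primrec times_differentiable :: "nat \<Rightarrow> (real \<Rightarrow> real) \<Rightarrow> bool" where
  "times_differentiable 0 u \<longleftrightarrow> (\<forall>x. u differentiable (at x))"
| "times_differentiable (Suc m) u \<longleftrightarrow> (\<forall>x. u differentiable (at x)) \<and> times_differentiable m (deriv u)"

definition smooth_real :: "(real \<Rightarrow> real) \<Rightarrow> bool" where
  "smooth_real u \<longleftrightarrow> (\<forall>m. times_differentiable m u)"

lemma times_differentiable_Suc_imp: "times_differentiable (Suc m) u \<Longrightarrow> times_differentiable m u"
  by (induction m arbitrary: u) auto

lemma DERIV_deriv: "u differentiable (at x) \<Longrightarrow> (u has_real_derivative deriv u x) (at x)"
  for u :: "real \<Rightarrow> real"
  by (metis DERIV_imp_deriv real_differentiable_def)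

lemma times_differentiable_add:
  "times_differentiable m u \<Longrightarrow> times_differentiable m v \<Longrightarrow> times_differentiable m (\<lambda>x. u x + v x)"
proof (induction m arbitrary: u v)
  case (Suc m)
  have "deriv (\<lambda>x. u x + v x) = (\<lambda>x. deriv u x + deriv v x)"
    using Suc.prems by (intro ext DERIV_imp_deriv DERIV_add DERIV_deriv) auto
  with Suc show ?case by auto
qed auto

lemma times_differentiable_mult:
  "times_differentiable m u \<Longrightarrow> times_differentiable m v \<Longrightarrow> times_differentiable m (\<lambda>x. u x * v x)"
proof (induction m arbitrary: u v)
  case (Suc m)
  have d: "deriv (\<lambda>x. u x * v x) = (\<lambda>x. deriv u x * v x + deriv v x * u x)"
    using Suc.prems by (intro ext DERIV_imp_deriv DERIV_mult DERIV_deriv) auto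
  have "times_differentiable m (\<lambda>x. deriv u x * v x + deriv v x * u x)"
    using Suc.prems by (intro times_differentiable_add Suc.IH)
      (auto intro: times_differentiable_Suc_imp[of m] simp del: times_differentiable.simps(2) simp: times_differentiable.simps(2)[THEN iffD1])
  with Suc.prems d show ?case by auto
qed auto

lemma smooth_real_mult: "smooth_real u \<Longrightarrow> smooth_real v \<Longrightarrow> smooth_real (\<lambda>x. u x * v x)"
  by (simp add: smooth_real_def times_differentiable_mult)

lemma smooth_real_differentiable: "smooth_real u \<Longrightarrow> u differentiable (at x)"
  unfolding smooth_real_def by (metis times_differentiable.simps(1))

lemma smooth_real_deriv: "smooth_real u \<Longrightarrow> smooth_real (deriv u)"
  unfolding smooth_real_def by (metis times_differentiable.simps(2))

text \<open>Smoothness is the largest class of differentiable functions closed under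
  \<open>deriv\<close>, so for \<open>poly_exp\<close> a single derivative has to be
  computed.\<close>

lemma smooth_real_coinduct:
  assumes "u \<in> S" "\<And>v x. v \<in> S \<Longrightarrow> v differentiable (at x)" "\<And>v. v \<in> S \<Longrightarrow> deriv v \<in> S"
  shows "smooth_real u"
proof -
  have "times_differentiable m v" if "v \<in> S" for m v
    using that by (induction m arbitrary: v) (auto intro: assms)
  then show ?thesis using assms(1) by (simp add: smooth_real_def)
qed

text \<open>This class of functions, which contains the standard function \<open>exp (- 1 / t)\<close> on the positive
  half-line, is closed under differentiation.\<close>

definition poly_exp :: "real poly \<Rightarrow> real \<Rightarrow> real" where
  "poly_exp p t = (if 0 < t then poly p (1 / t) * exp (- (1 / t)) else 0)"

lemma tendsto_poly_exp_minus: "((\<lambda>s. poly p s * exp (- s)) \<longlongrightarrow> (0::real)) at_top"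
proof -
  have "((\<lambda>s. \<Sum>i\<le>degree p. coeff p i * (s ^ i / exp s)) \<longlongrightarrow> (\<Sum>i\<le>degree p. coeff p i * 0)) at_top"
    by (intro tendsto_sum tendsto_mult tendsto_const tendsto_power_div_exp_0)
  moreover have "(\<Sum>i\<le>degree p. coeff p i * (s ^ i / exp s)) = poly p s * exp (- s)" for s :: real
    by (simp add: poly_altdef exp_minus sum_distrib_right divide_inverse mult.assoc)
  ultimately show ?thesis by simp
qed

text \<open>With \<open>s = 1 / t\<close>, differentiation turns \<open>p s * exp (- s)\<close> into
  \<open>s^2 * (p s - p' s) * exp (- s)\<close>, and multiplication by \<open>s^2\<close> is the
  double \<open>pCons 0\<close>. At 0 the right-hand difference quotient is
  \<open>s * p s * exp (- s)\<close>, which tends to 0.\<close>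

lemma DERIV_poly_exp:
  "(poly_exp p has_real_derivative poly_exp (pCons 0 (pCons 0 (p - pderiv p))) t) (at t)"
proof (cases t "0::real" rule: linorder_cases)
  case less
  have "((\<lambda>_. 0) has_real_derivative 0) (at t)" by simp
  then have "(poly_exp p has_real_derivative 0) (at t)"
    by (rule has_field_derivative_transform_within_open[where S="{..<0}"]) (use less in \<open>auto simp: poly_exp_def\<close>)
  then show ?thesis using less by (simp add: poly_exp_def)
next
  case equal
  have "((\<lambda>h. poly_exp p h / h) \<longlongrightarrow> 0) (at 0)"
  proof (rule filterlim_split_at)
    have "eventually (\<lambda>h. 0 = poly_exp p h / h) (at_left (0::real))"
      by (auto simp: eventually_at_filter poly_exp_def)
    then show "((\<lambda>h. poly_exp p h / h) \<longlongrightarrow> 0) (at_left 0)"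
      by (rule Lim_transform_eventually[OF tendsto_const])
    have "((\<lambda>h. poly (pCons 0 p) (inverse h) * exp (- inverse h)) \<longlongrightarrow> 0) (at_right (0::real))"
      by (rule filterlim_compose[OF tendsto_poly_exp_minus filterlim_inverse_at_top_right])
    moreover have "eventually (\<lambda>h. poly (pCons 0 p) (inverse h) * exp (- inverse h) = poly_exp p h / h) (at_right (0::real))"
      by (auto simp: eventually_at_filter poly_exp_def divide_inverse)
    ultimately show "((\<lambda>h. poly_exp p h / h) \<longlongrightarrow> 0) (at_right 0)"
      by (rule Lim_transform_eventually)
  qed
  then show ?thesis using equal by (simp add: has_field_derivative_iff poly_exp_def)
next
  case greater
  have "((\<lambda>t. poly p (1 / t) * exp (- (1 / t))) has_real_derivative
      poly_exp (pCons 0 (pCons 0 (p - pderiv p))) t) (at t)"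
    using greater
    by (auto intro!: derivative_eq_intros simp: poly_exp_def field_simps power2_eq_square)
  then show ?thesis
    by (rule has_field_derivative_transform_within_open[where S="{0<..}"]) (use greater in \<open>auto simp: poly_exp_def\<close>)
qed

lemma smooth_real_poly_exp_affine: "smooth_real (\<lambda>t. poly_exp p (c * t + d))"
proof (rule smooth_real_coinduct[where S="range (\<lambda>p t. poly_exp p (c * t + d))"])
  have D: "((\<lambda>t. poly_exp p (c * t + d)) has_real_derivative
      poly_exp (smult c (pCons 0 (pCons 0 (p - pderiv p)))) (c * t + d)) (at t)" for p t
    by (rule DERIV_cong, rule DERIV_chain2[OF DERIV_poly_exp])
      (auto intro!: derivative_eq_intros simp: poly_exp_def)
  show "v differentiable (at x)" if "v \<in> range (\<lambda>p t. poly_exp p (c * t + d))" for v x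
    using that D by (auto simp: real_differentiable_def)
  show "deriv v \<in> range (\<lambda>p t. poly_exp p (c * t + d))" if v: "v \<in> range (\<lambda>p t. poly_exp p (c * t + d))" for v
  proof -
    obtain p where p: "v = (\<lambda>t. poly_exp p (c * t + d))" using v by auto
    have "deriv v = (\<lambda>t. poly_exp (smult c (pCons 0 (pCons 0 (p - pderiv p)))) (c * t + d))"
      unfolding p by (intro ext DERIV_imp_deriv D)
    then show ?thesis by auto
  qed
qed auto

text \<open>The factor \<open>Suc m\<close> compresses the transition layers at both end points: as
  \<open>m\<close> grows, the functions tend to the indicator of the open interval while staying
  between 0 and 1. Box indicators thus become bounded limits of explicit test functions.\<close>

definition bump_real :: "nat \<Rightarrow> real \<Rightarrow> real \<Rightarrow> real \<Rightarrow> real" where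
  "bump_real m a b t = poly_exp 1 (real (Suc m) * (t - a)) * poly_exp 1 (real (Suc m) * (b - t))"

lemma smooth_real_bump_real: "smooth_real (bump_real m a b)"
proof -
  have "bump_real m a b = (\<lambda>t. poly_exp 1 (real (Suc m) * t + (- (real (Suc m) * a))) * poly_exp 1 (- real (Suc m) * t + real (Suc m) * b))"
    by (auto simp: bump_real_def fun_eq_iff algebra_simps)
  then show ?thesis by (simp only: smooth_real_mult smooth_real_poly_exp_affine)
qed

lemma poly_exp_1_bounds: "0 \<le> poly_exp 1 t" "poly_exp 1 t \<le> 1"
  by (auto simp: poly_exp_def)

lemma bump_real_bounds: "0 \<le> bump_real m a b t" "bump_real m a b t \<le> 1"
  by (auto simp: bump_real_def poly_exp_1_bounds mult_le_one)

lemma bump_real_eq_0: "t \<notin> {a<..<b} \<Longrightarrow> bump_real m a b t = 0"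
  by (auto simp: bump_real_def poly_exp_def zero_less_mult_iff)

lemma bump_real_tendsto: "(\<lambda>m. bump_real m a b t) \<longlonglongrightarrow> indicator {a<..<b} t"
proof (cases "t \<in> {a<..<b}")
  case True
  have *: "(\<lambda>m. poly_exp 1 (real (Suc m) * s)) \<longlonglongrightarrow> 1" if s: "0 < s" for s
  proof -
    have "(\<lambda>m. exp (- (1 / s * inverse (real (Suc m))))) \<longlonglongrightarrow> exp (- (1 / s * 0))"
      by (intro tendsto_intros LIMSEQ_inverse_real_of_nat)
    moreover have "exp (- (1 / s * inverse (real (Suc m)))) = poly_exp 1 (real (Suc m) * s)" for m
      using s by (simp add: poly_exp_def inverse_eq_divide add_pos_nonneg)
    ultimately show ?thesis by simp
  qed
  have "(\<lambda>m. bump_real m a b t) \<longlonglongrightarrow> 1 * 1"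
    unfolding bump_real_def using True by (intro tendsto_mult *) auto
  then show ?thesis using True by simp
qed (simp add: bump_real_eq_0)

section \<open>Products of one-variable functions as test functions\<close>

lemma has_derivative_prod_components:
  fixes u :: "'n::finite \<Rightarrow> real \<Rightarrow> real" and x :: "real^'n"
  assumes "\<And>i x. u i differentiable (at x)"
  shows "((\<lambda>x. \<Prod>i\<in>UNIV. u i (x $ i)) has_derivative
    (\<lambda>y. \<Sum>i\<in>UNIV. deriv (u i) (x $ i) * y $ i * (\<Prod>j\<in>UNIV - {i}. u j (x $ j)))) (at x)"
proof (rule has_derivative_prod)
  fix i
  have "(u i has_derivative (\<lambda>t. deriv (u i) (x $ i) * t)) (at (x $ i))"
    using DERIV_deriv[OF assms] by (simp add: has_field_derivative_def)
  then show "((\<lambda>x. u i (x $ i)) has_derivative (\<lambda>y. deriv (u i) (x $ i) * y $ i)) (at x)"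
    by (rule has_derivative_compose[rotated])
      (simp add: bounded_linear_imp_has_derivative bounded_linear_vec_nth)
qed

lemma partial_prod_components:
  fixes u :: "'n::finite \<Rightarrow> real \<Rightarrow> real"
  assumes "\<And>i x. u i differentiable (at x)"
  shows "partial j (\<lambda>x. \<Prod>i\<in>UNIV. u i (x $ i)) = (\<lambda>x. \<Prod>i\<in>UNIV. (u(j := deriv (u j))) i (x $ i))"
proof
  fix x :: "real^'n"
  have "partial j (\<lambda>x. \<Prod>i\<in>UNIV. u i (x $ i)) x =
      (\<Sum>i\<in>UNIV. deriv (u i) (x $ i) * axis j 1 $ i * (\<Prod>j\<in>UNIV - {i}. u j (x $ j)))"
    unfolding partial_def frechet_derivative_at[OF has_derivative_prod_components[OF assms], symmetric] ..
  also have "\<dots> = (\<Sum>i\<in>UNIV. if i = j then deriv (u j) (x $ j) * (\<Prod>i\<in>UNIV - {j}. u i (x $ i)) else 0)"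
    by (intro sum.cong) (auto simp: axis_def)
  also have "\<dots> = (\<Prod>i\<in>UNIV. (u(j := deriv (u j))) i (x $ i))"
    by (simp add: prod.remove[of UNIV j])
  finally show "partial j (\<lambda>x. \<Prod>i\<in>UNIV. u i (x $ i)) x = (\<Prod>i\<in>UNIV. (u(j := deriv (u j))) i (x $ i))" .
qed

text \<open>Product form survives differentiation, because a partial derivative only replaces one
  factor by its derivative. Hence all iterated partial derivatives are again products of smooth
  functions.\<close>

lemma partials_prod_components:
  fixes u :: "'n::finite \<Rightarrow> real \<Rightarrow> real"
  assumes "\<And>i. smooth_real (u i)"
  shows "\<exists>v. (\<forall>i. smooth_real (v i)) \<and> partials is (\<lambda>x. \<Prod>i\<in>UNIV. u i (x $ i)) = (\<lambda>x. \<Prod>i\<in>UNIV. v i (x $ i))"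
proof (induction "is")
  case Nil
  then show ?case using assms by (auto simp: partials_def)
next
  case (Cons j js)
  then obtain v where v: "\<And>i. smooth_real (v i)"
    and eq: "partials js (\<lambda>x. \<Prod>i\<in>UNIV. u i (x $ i)) = (\<lambda>x. \<Prod>i\<in>UNIV. v i (x $ i))" by auto
  have "partials (j # js) (\<lambda>x. \<Prod>i\<in>UNIV. u i (x $ i)) = partial j (\<lambda>x. \<Prod>i\<in>UNIV. v i (x $ i))"
    using eq by (simp add: partials_def)
  also have "\<dots> = (\<lambda>x. \<Prod>i\<in>UNIV. (v(j := deriv (v j))) i (x $ i))"
    using v by (intro partial_prod_components) (simp add: smooth_real_differentiable)
  finally show ?case
    using v by (intro exI[of _ "v(j := deriv (v j))"]) (auto simp: smooth_real_deriv)
qed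

lemma differentiable_partials_prod_components:
  fixes u :: "'n::finite \<Rightarrow> real \<Rightarrow> real"
  assumes "\<And>i. smooth_real (u i)"
  shows "partials is (\<lambda>x. \<Prod>i\<in>UNIV. u i (x $ i)) differentiable (at x)"
proof -
  obtain v where v: "\<And>i. smooth_real (v i)"
    and eq: "partials is (\<lambda>x. \<Prod>i\<in>UNIV. u i (x $ i)) = (\<lambda>x. \<Prod>i\<in>UNIV. v i (x $ i))"
    using partials_prod_components[of u "is"] assms by auto
  show ?thesis unfolding eq
    using has_derivative_prod_components[of v x] smooth_real_differentiable[OF v]
    by (auto simp: differentiable_def)
qed

definition bump :: "nat \<Rightarrow> real^'n::finite \<Rightarrow> real^'n \<Rightarrow> real^'n \<Rightarrow> real" where
  "bump m a b x = (\<Prod>i\<in>UNIV. bump_real m (a $ i) (b $ i) (x $ i))"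

lemma bump_bounds: "0 \<le> bump m a b x" "bump m a b x \<le> 1"
  by (auto simp: bump_def bump_real_bounds intro!: prod_nonneg prod_le_1)

lemma bump_eq_0: "x \<notin> box a b \<Longrightarrow> bump m a b x = 0"
  unfolding bump_def mem_box_cart by (rule prod_zero) (auto intro!: bump_real_eq_0)

lemma bump_tendsto: "(\<lambda>m. bump m a b x) \<longlonglongrightarrow> indicator (box a b) x"
proof -
  have "(\<lambda>m. bump m a b x) \<longlonglongrightarrow> (\<Prod>i\<in>UNIV. indicator {a $ i<..<b $ i} (x $ i))"
    unfolding bump_def by (intro tendsto_prod bump_real_tendsto)
  moreover have "(\<Prod>i\<in>UNIV. indicator {a $ i<..<b $ i} (x $ i)) = (indicator (box a b) x :: real)"
    by (auto simp: indicator_def mem_box_cart prod_zero_iff)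
  ultimately show ?thesis by simp
qed

lemma test_function_bump: "test_function (bump m a b)"
proof -
  have "closure {x. bump m a b x \<noteq> 0} \<subseteq> cbox a b"
    using bump_eq_0[of _ a b m] box_subset_cbox[of a b] by (intro closure_minimal) (blast, simp add: closed_cbox)
  then have "compact (closure {x. bump m a b x \<noteq> 0})"
    by (auto simp: compact_eq_bounded_closed intro: bounded_subset[OF bounded_cbox])
  moreover have "partials is (bump m a b) differentiable (at x)" for "is" x
    unfolding bump_def[abs_def]
    by (rule differentiable_partials_prod_components) (rule smooth_real_bump_real)
  ultimately show ?thesis by (simp add: test_function_def)
qed

lemma test_function_differentiable: "test_function \<phi> \<Longrightarrow> partials is \<phi> differentiable (at x)"
  by (simp add: test_function_def)

lemma test_function_continuous: "test_function \<phi> \<Longrightarrow> continuous_on A (partials is \<phi>)"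
  by (meson test_function_differentiable continuous_at_imp_continuous_on differentiable_imp_continuous_within)

lemma test_function_measurable: "test_function \<phi> \<Longrightarrow> partials is \<phi> \<in> borel_measurable borel"
  by (intro borel_measurable_continuous_onI test_function_continuous)

lemma measurable_bump [measurable]: "bump m a b \<in> borel_measurable borel"
  using test_function_measurable[OF test_function_bump, of "[]"] by (simp add: partials_def)

text \<open>Letting \<open>m\<close> tend to infinity gives vanishing integrals over all boxes. The
  positive and the negative part of \<open>h\<close> are then densities of two measures that agree
  on boxes, a generator stable under intersection, so the measures coincide.\<close>

lemma AE_eq_0_if_integral_bump_eq_0:
  fixes h :: "real^'n::finite \<Rightarrow> real"
  assumes [measurable]: "h \<in> borel_measurable borel"
    and int: "\<And>a b. integrable lborel (\<lambda>x. h x * indicator (box a b) x)"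
    and zero: "\<And>m a b. (LINT x|lborel. h x * bump m a b x) = 0"
  shows "AE x in lborel. h x = 0"
proof -
  have box0: "(LINT x|lborel. h x * indicator (box a b) x) = 0" for a b
  proof -
    have "(\<lambda>m. LINT x|lborel. h x * bump m a b x) \<longlonglongrightarrow> (LINT x|lborel. h x * indicator (box a b) x)"
    proof (rule integral_dominated_convergence)
      show "integrable lborel (\<lambda>x. norm (h x * indicator (box a b) x))"
        using int by (rule integrable_norm)
      show "AE x in lborel. (\<lambda>m. h x * bump m a b x) \<longlonglongrightarrow> h x * indicator (box a b) x"
        by (intro AE_I2 tendsto_mult tendsto_const bump_tendsto)
      show "AE x in lborel. norm (h x * bump m a b x) \<le> norm (h x * indicator (box a b) x)" for m
        using bump_bounds[of m a b] bump_eq_0[of _ a b m]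
        by (intro AE_I2) (auto simp: abs_mult indicator_def intro: mult_left_le)
    qed measurable
    then show ?thesis by (simp add: zero LIMSEQ_const_iff)
  qed
  \<comment> \<open>\<open>ennreal\<close> sends negative numbers to 0, so these are the measures
    with the positive and the negative part of \<open>h\<close> as density.\<close>
  let ?P = "density lborel (\<lambda>x. ennreal (h x))" and ?Q = "density lborel (\<lambda>x. ennreal (- h x))"
  have fin: "(\<integral>\<^sup>+x. ennreal (h x) * indicator (box a b) x \<partial>lborel) < top" for a b
  proof -
    have "(\<integral>\<^sup>+x. ennreal (h x) * indicator (box a b) x \<partial>lborel) \<le> (\<integral>\<^sup>+x. ennreal (norm (h x * indicator (box a b) x)) \<partial>lborel)"
      by (intro nn_integral_mono) (auto simp: indicator_def intro: ennreal_leI)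
    also have "\<dots> < top" using int[of a b] by (simp add: integrable_iff_bounded)
    finally show ?thesis .
  qed
  have eq: "emeasure ?P (box a b) = emeasure ?Q (box a b)" for a b
  proof -
    have "0 = (LINT x|lborel. h x * indicator (box a b) x)" using box0 by simp
    also have "\<dots> = enn2real (\<integral>\<^sup>+x. ennreal (h x * indicator (box a b) x) \<partial>lborel)
        - enn2real (\<integral>\<^sup>+x. ennreal (- (h x * indicator (box a b) x)) \<partial>lborel)"
      using int by (rule real_lebesgue_integral_def)
    finally have "enn2real (\<integral>\<^sup>+x. ennreal (h x * indicator (box a b) x) \<partial>lborel)
        = enn2real (\<integral>\<^sup>+x. ennreal (- (h x * indicator (box a b) x)) \<partial>lborel)" by simp
    moreover have "(\<integral>\<^sup>+x. ennreal (h x * indicator (box a b) x) \<partial>lborel) \<noteq> top"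
      "(\<integral>\<^sup>+x. ennreal (- (h x * indicator (box a b) x)) \<partial>lborel) \<noteq> top"
      using int[of a b] by (simp_all only: real_integrable_def infinity_ennreal_def simp_thms)
    ultimately have "(\<integral>\<^sup>+x. ennreal (h x * indicator (box a b) x) \<partial>lborel)
        = (\<integral>\<^sup>+x. ennreal (- (h x * indicator (box a b) x)) \<partial>lborel)"
      by (simp add: enn2real_eq_iff_finite less_top)
    moreover have "ennreal (h x * indicator (box a b) x) = ennreal (h x) * indicator (box a b) x"
      "ennreal (- (h x * indicator (box a b) x)) = ennreal (- h x) * indicator (box a b) x" for x
      by (auto simp: indicator_def)
    ultimately show ?thesis by (simp add: emeasure_density)
  qed
  have "?P = ?Q"
  proof (rule measure_eqI_generator_eq)
    let ?E = "range (\<lambda>(a, b). box a b :: (real^'n) set)"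
    show "Int_stable ?E" by (auto simp: Int_stable_def box_Int_box)
    show "?E \<subseteq> Pow UNIV" "sets ?P = sigma_sets UNIV ?E" "sets ?Q = sigma_sets UNIV ?E"
      by (simp_all add: borel_eq_box)
    let ?A = "\<lambda>n::nat. box (- (real n *\<^sub>R One)) (real n *\<^sub>R One) :: (real^'n) set"
    show "range ?A \<subseteq> ?E" "(\<Union>i. ?A i) = UNIV"
      unfolding UN_box_eq_UNIV by auto
    show "emeasure ?P (?A i) \<noteq> \<infinity>" for i
      using fin by (subst emeasure_density) (auto simp: less_top)
    show "emeasure ?P X = emeasure ?Q X" if "X \<in> ?E" for X
      using that eq by auto
  qed
  then have "AE x in lborel. ennreal (h x) = ennreal (- h x)"
    by (intro sigma_finite_measure.density_unique[OF sigma_finite_lborel]) auto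
  \<comment> \<open>One of the two parts vanishes at every point, so their equality forces
    \<open>h x = 0\<close>.\<close>
  then show ?thesis
  proof eventually_elim
    case (elim x)
    then show ?case
      using ennreal_eq_0_iff[of "h x"] ennreal_eq_0_iff[of "- h x"]
      by (cases "h x \<le> 0") auto
  qed
qed

section \<open>Finite differences are controlled by weak derivatives\<close>

definition locally_integrable :: "('a::euclidean_space \<Rightarrow> real) \<Rightarrow> bool" where
  "locally_integrable f \<longleftrightarrow> f \<in> borel_measurable borel \<and>
     (\<forall>R. (\<integral>\<^sup>+y\<in>cball 0 R. ennreal \<bar>f y\<bar> \<partial>lborel) < top)"

lemma locally_integrable_measurable [measurable_dest]: "locally_integrable f \<Longrightarrow> f \<in> borel_measurable borel"
  by (simp add: locally_integrable_def)

lemma sets_borel_cball [measurable]: "cball (c::'a::metric_space) r \<in> sets borel"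
  by (simp add: borel_closed)

lemma nn_integral_cball_translate_le:
  fixes f :: "'a::euclidean_space \<Rightarrow> real"
  assumes [measurable]: "f \<in> borel_measurable borel"
  shows "(\<integral>\<^sup>+y\<in>cball 0 R. ennreal \<bar>f (y + v)\<bar> \<partial>lborel) \<le> (\<integral>\<^sup>+y\<in>cball 0 (R + norm v). ennreal \<bar>f y\<bar> \<partial>lborel)"
proof -
  have "(\<integral>\<^sup>+y\<in>cball 0 (R + norm v). ennreal \<bar>f y\<bar> \<partial>lborel)
      = (\<integral>\<^sup>+y. ennreal \<bar>f (v + y)\<bar> * indicator (cball 0 (R + norm v)) (v + y) \<partial>lborel)"
    by (subst nn_integral_lborel_affine[where c=1 and t=v], measurable)
  moreover have "norm (v + y) \<le> R + norm v" if "norm y \<le> R" for y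
    using norm_triangle_ineq[of v y] that by linarith
  ultimately show ?thesis
    by (auto intro!: nn_integral_mono simp: add.commute split: split_indicator)
qed

lemma locally_integrable_translate:
  assumes "locally_integrable f" shows "locally_integrable (\<lambda>y. f (y + v))"
proof -
  have [measurable]: "f \<in> borel_measurable borel" using assms by (simp add: locally_integrable_def)
  have "(\<integral>\<^sup>+y\<in>cball 0 R. ennreal \<bar>f (y + v)\<bar> \<partial>lborel) < top" for R
    using assms nn_integral_cball_translate_le[where f=f and R=R and v=v] by (auto simp: locally_integrable_def intro: le_less_trans)
  then show ?thesis by (simp add: locally_integrable_def)
qed

lemma locally_integrable_add:
  assumes f: "locally_integrable f" and g: "locally_integrable g"
  shows "locally_integrable (\<lambda>y. f y + g y)"
proof -
  have [measurable]: "f \<in> borel_measurable borel" "g \<in> borel_measurable borel"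
    using f g by (simp_all add: locally_integrable_def)
  have "(\<integral>\<^sup>+y\<in>cball 0 R. ennreal \<bar>f y + g y\<bar> \<partial>lborel) < top" for R
  proof -
    have "(\<integral>\<^sup>+y\<in>cball 0 R. ennreal \<bar>f y + g y\<bar> \<partial>lborel)
        \<le> (\<integral>\<^sup>+y. ennreal \<bar>f y\<bar> * indicator (cball 0 R) y + ennreal \<bar>g y\<bar> * indicator (cball 0 R) y \<partial>lborel)"
      by (intro nn_integral_mono) (auto split: split_indicator simp: ennreal_plus[symmetric] abs_triangle_ineq ennreal_leI simp del: ennreal_plus)
    also have "\<dots> = (\<integral>\<^sup>+y\<in>cball 0 R. ennreal \<bar>f y\<bar> \<partial>lborel) + (\<integral>\<^sup>+y\<in>cball 0 R. ennreal \<bar>g y\<bar> \<partial>lborel)"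
      by (rule nn_integral_add) measurable
    finally show ?thesis
      using f g by (auto simp: locally_integrable_def intro: le_less_trans)
  qed
  then show ?thesis by (simp add: locally_integrable_def)
qed

lemma locally_integrable_cmult:
  assumes f: "locally_integrable f" shows "locally_integrable (\<lambda>y. c * f y)"
proof -
  have [measurable]: "f \<in> borel_measurable borel"
    using f by (simp_all add: locally_integrable_def)
  have "(\<integral>\<^sup>+y\<in>cball 0 R. ennreal \<bar>c * f y\<bar> \<partial>lborel) = ennreal \<bar>c\<bar> * (\<integral>\<^sup>+y\<in>cball 0 R. ennreal \<bar>f y\<bar> \<partial>lborel)" for R
    by (subst nn_integral_cmult[symmetric]) (measurable, auto simp: abs_mult ennreal_mult mult_ac)
  then show ?thesis using f by (simp add: locally_integrable_def ennreal_mult_less_top)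
qed

lemma locally_integrable_sum:
  "(\<And>i. i \<in> I \<Longrightarrow> locally_integrable (f i)) \<Longrightarrow> locally_integrable (\<lambda>y. \<Sum>i\<in>I. f i y)"
proof (induction I rule: infinite_finite_induct)
  case (insert i I)
  then show ?case by (simp add: locally_integrable_add)
qed (simp_all add: locally_integrable_def)

lemma locally_integrable_fin_diff:
  "locally_integrable f \<Longrightarrow> locally_integrable (fin_diff k h f)"
  unfolding fin_diff_def[abs_def]
  by (intro locally_integrable_sum locally_integrable_cmult locally_integrable_translate)

lemma locally_integrable_mult_integrable:
  assumes f: "locally_integrable f" and [measurable]: "u \<in> borel_measurable borel"
    and u: "\<And>y. \<bar>u y\<bar> \<le> C * indicator (cball 0 R) y"
  shows "integrable lborel (\<lambda>y. f y * u y)"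
proof -
  have [measurable]: "f \<in> borel_measurable borel" using f by (simp add: locally_integrable_def)
  have "(\<integral>\<^sup>+y. ennreal (norm (f y * u y)) \<partial>lborel) \<le> (\<integral>\<^sup>+y. ennreal \<bar>C\<bar> * (ennreal \<bar>f y\<bar> * indicator (cball 0 R) y) \<partial>lborel)"
  proof (intro nn_integral_mono)
    fix y
    have "\<bar>f y\<bar> * \<bar>u y\<bar> \<le> \<bar>C\<bar> * (\<bar>f y\<bar> * indicator (cball 0 R) y)"
    proof (cases "y \<in> cball 0 R")
      case True
      then have "\<bar>u y\<bar> \<le> \<bar>C\<bar>" using u[of y] by simp
      then have "\<bar>f y\<bar> * \<bar>u y\<bar> \<le> \<bar>f y\<bar> * \<bar>C\<bar>" by (rule mult_left_mono) simp
      then show ?thesis using True by (simp add: mult.commute)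
    next
      case False
      then show ?thesis using u[of y] by simp
    qed
    then show "ennreal (norm (f y * u y)) \<le> ennreal \<bar>C\<bar> * (ennreal \<bar>f y\<bar> * indicator (cball 0 R) y)"
      by (simp add: abs_mult ennreal_indicator[symmetric] ennreal_mult[symmetric] ennreal_leI)
  qed
  also have "\<dots> = ennreal \<bar>C\<bar> * (\<integral>\<^sup>+y\<in>cball 0 R. ennreal \<bar>f y\<bar> \<partial>lborel)"
    by (rule nn_integral_cmult) measurable
  also have "\<dots> < top"
    using f by (simp add: locally_integrable_def ennreal_mult_less_top)
  finally show ?thesis by (simp add: integrable_iff_bounded)
qed

lemma box_subset_cball_0: "\<exists>R>0. box a b \<subseteq> cball (0::'a::euclidean_space) R"
  using bounded_box[of a b] by (meson bounded_pos mem_cball_0 subsetI)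

lemma locally_integrable_box:
  assumes "locally_integrable f"
  shows "integrable lborel (\<lambda>y. f y * indicator (box a b) y)"
proof -
  obtain R where "box a b \<subseteq> cball 0 R" using box_subset_cball_0[of a b] by auto
  then show ?thesis
    by (intro locally_integrable_mult_integrable[OF assms, where C=1 and R=R]) (auto split: split_indicator)
qed

text \<open>Differences of order \<open>k\<close> annihilate polynomials of degree below
  \<open>k\<close>. By Pascal's rule, order \<open>Suc k\<close> for \<open>p\<close> is order
  \<open>k\<close> for \<open>p i - p (Suc i)\<close>, which has lower degree.\<close>

lemma alternating_binomial_power_sum:
  "m < k \<Longrightarrow> (\<Sum>i\<le>k. (-1) ^ i * real (k choose i) * real i ^ m) = 0"
proof (induction k arbitrary: m)
  case (Suc k)
  have rec: "(\<Sum>i\<le>Suc k. (-1) ^ i * real (Suc k choose i) * p i) = (\<Sum>i\<le>k. (-1) ^ i * real (k choose i) * (p i - p (Suc i)))"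
    for p :: "nat \<Rightarrow> real"
  proof -
    have "(\<Sum>i\<le>Suc k. (-1) ^ i * real (Suc k choose i) * p i)
        = p 0 + (\<Sum>i\<le>k. (-1) ^ Suc i * real (Suc k choose Suc i) * p (Suc i))"
      by (subst sum.atMost_Suc_shift) simp
    also have "\<dots> = p 0 + (\<Sum>i\<le>k. (-1) ^ Suc i * real (k choose Suc i) * p (Suc i)) - (\<Sum>i\<le>k. (-1) ^ i * real (k choose i) * p (Suc i))"
      by (simp add: algebra_simps sum.distrib sum_subtractf sum_negf)
    also have "p 0 + (\<Sum>i\<le>k. (-1) ^ Suc i * real (k choose Suc i) * p (Suc i)) = (\<Sum>i\<le>Suc k. (-1) ^ i * real (k choose i) * p i)"
      by (subst sum.atMost_Suc_shift) simp
    also have "\<dots> = (\<Sum>i\<le>k. (-1) ^ i * real (k choose i) * p i)" by simp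
    finally show ?thesis by (simp add: algebra_simps sum_subtractf)
  qed
  have "(\<Sum>i\<le>Suc k. (-1) ^ i * real (Suc k choose i) * real i ^ m)
      = (\<Sum>i\<le>k. (-1) ^ i * real (k choose i) * (- (\<Sum>l<m. real (m choose l) * real i ^ l)))"
  proof (subst rec, intro sum.cong refl arg_cong[where f="\<lambda>x. _ * x"])
    fix i
    have "real (Suc i) ^ m = (\<Sum>l\<le>m. real (m choose l) * real i ^ l)"
      using binomial_ring[of "real i" 1 m] by (simp add: add.commute)
    also have "\<dots> = (\<Sum>l<m. real (m choose l) * real i ^ l) + real i ^ m"
      by (cases m) (auto simp: lessThan_Suc_atMost)
    finally show "real i ^ m - real (Suc i) ^ m = - (\<Sum>l<m. real (m choose l) * real i ^ l)" by simp
  qed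
  also have "\<dots> = - (\<Sum>l<m. real (m choose l) * (\<Sum>i\<le>k. (-1) ^ i * real (k choose i) * real i ^ l))"
    by (simp add: sum_distrib_left sum_negf mult_ac) (rule sum.swap)
  also have "\<dots> = 0" using Suc by (auto intro!: sum.neutral)
  finally show ?case .
qed simp

text \<open>The alternating sum of the integral remainders of Taylor's formula at \<open>0\<close>. It vanishes to order
  \<open>k - 1\<close> at the right end point \<open>k\<close>, which is the source of the weight \<open>t ^ (k - 1)\<close> below.\<close>

definition diff_kernel :: "nat \<Rightarrow> real \<Rightarrow> real" where
  "diff_kernel k t = (\<Sum>i\<le>k. (-1) ^ i * real (k choose i) * (indicator {0..real i} t * (real i - t) ^ (k - 1) / fact (k - 1)))"

lemma measurable_diff_kernel [measurable]: "diff_kernel k \<in> borel_measurable borel"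
  unfolding diff_kernel_def[abs_def] by measurable

text \<open>Each remainder with \<open>i \<le> k\<close> is dominated by
  \<open>(k - t) ^ (k - 1)\<close> on the interval up to \<open>k\<close>, and the binomial
  coefficients add up to \<open>2 ^ k\<close>.\<close>

lemma diff_kernel_bound:
  assumes "1 \<le> k"
  shows "\<bar>diff_kernel k t\<bar> \<le> 2 ^ k * (indicator {0..real k} t * (real k - t) ^ (k - 1))"
proof -
  have "\<bar>diff_kernel k t\<bar> \<le> (\<Sum>i\<le>k. real (k choose i) * (indicator {0..real k} t * (real k - t) ^ (k - 1)))"
    unfolding diff_kernel_def
  proof (rule order_trans[OF sum_abs], intro sum_mono)
    fix i assume i: "i \<in> {..k}"
    have le: "indicator {0..real i} t * \<bar>(real i - t) ^ (k - 1)\<bar> / fact (k - 1) \<le> indicator {0..real k} t * (real k - t) ^ (k - 1)"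
    proof (cases "t \<in> {0..real i}")
      case True
      then have t: "t \<in> {0..real k}" using i by auto
      have "(real i - t) ^ (k - 1) / fact (k - 1) \<le> (real i - t) ^ (k - 1) / 1"
        using True by (intro divide_left_mono) auto
      also have "\<dots> \<le> (real k - t) ^ (k - 1)" using True i by (auto intro!: power_mono)
      finally show ?thesis using True t by simp
    qed (use i in \<open>auto split: split_indicator\<close>)
    show "\<bar>(-1) ^ i * real (k choose i) * (indicator {0..real i} t * (real i - t) ^ (k - 1) / fact (k - 1))\<bar>
        \<le> real (k choose i) * (indicator {0..real k} t * (real k - t) ^ (k - 1))"
      using mult_left_mono[OF le, of "real (k choose i)"] by (simp add: abs_mult power_abs)
  qed
  also have "\<dots> = 2 ^ k * (indicator {0..real k} t * (real k - t) ^ (k - 1))"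
    using choose_row_sum[of k] by (simp add: sum_distrib_right[symmetric] of_nat_sum[symmetric] del: of_nat_sum)
  finally show ?thesis .
qed

text \<open>Taylor's formula at 0 is applied at every node \<open>i\<close>. The Taylor polynomials
  have degree below \<open>k\<close> and cancel in the alternating sum, which leaves only the
  integral remainders.\<close>

lemma alternating_sum_eq_integral:
  fixes D :: "nat \<Rightarrow> real \<Rightarrow> real"
  assumes k: "1 \<le> k" and D: "\<And>m t. m \<le> k \<Longrightarrow> (D m has_real_derivative D (Suc m) t) (at t)"
  shows "(\<Sum>i\<le>k. (-1) ^ i * real (k choose i) * D 0 (real i)) = (LINT t|lborel. diff_kernel k t * D k t)"
proof -
  let ?g = "\<lambda>i t. indicator {0..real i} t * (real i - t) ^ (k - 1) / fact (k - 1) * D k t"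
  have cont: "continuous_on A (D k)" for A
    using D[of k] by (meson DERIV_continuous_on has_field_derivative_at_within le_refl)
  have set: "set_integrable lborel {0..real i} (\<lambda>t. (real i - t) ^ (k - 1) / fact (k - 1) * D k t)" for i
    by (intro borel_integrable_atLeastAtMost' continuous_intros cont) auto
  have int: "integrable lborel (?g i)" for i
    using set[of i] by (simp add: set_integrable_def mult.assoc)
  have taylor: "D 0 (real i) = (\<Sum>m<k. real i ^ m / fact m * D m 0) + (LINT t|lborel. ?g i t)" for i
  proof -
    have "D 0 (real i) = (\<Sum>m<k. ((real i - 0) ^ m / fact m) *\<^sub>R D m 0) + integral {0..real i} (\<lambda>t. ((real i - t) ^ (k - 1) / fact (k - 1)) *\<^sub>R D k t)"
      using k D by (intro Taylor_integral[where Df=D])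
        (auto simp: has_real_derivative_iff_has_vector_derivative[symmetric] intro: has_field_derivative_at_within)
    also have "integral {0..real i} (\<lambda>t. ((real i - t) ^ (k - 1) / fact (k - 1)) *\<^sub>R D k t) = (LINT t|lborel. ?g i t)"
      using set_borel_integral_eq_integral(2)[OF set[of i]] by (simp add: set_lebesgue_integral_def mult.assoc)
    finally show ?thesis by simp
  qed
  have "(\<Sum>i\<le>k. (-1) ^ i * real (k choose i) * D 0 (real i))
      = (\<Sum>m<k. D m 0 / fact m * (\<Sum>i\<le>k. (-1) ^ i * real (k choose i) * real i ^ m))
       + (\<Sum>i\<le>k. (-1) ^ i * real (k choose i) * (LINT t|lborel. ?g i t))"
    by (subst taylor, simp add: distrib_left sum.distrib sum_distrib_left mult_ac) (rule sum.swap)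
  also have "(\<Sum>m<k. D m 0 / fact m * (\<Sum>i\<le>k. (-1) ^ i * real (k choose i) * real i ^ m)) = 0"
    by (intro sum.neutral) (auto simp: alternating_binomial_power_sum)
  also have "(\<Sum>i\<le>k. (-1) ^ i * real (k choose i) * (LINT t|lborel. ?g i t))
      = (LINT t|lborel. (\<Sum>i\<le>k. (-1) ^ i * real (k choose i) * ?g i t))"
    by (subst Bochner_Integration.integral_sum) (simp_all only: integrable_mult_right int integral_mult_right_zero)
  also have "\<dots> = (LINT t|lborel. diff_kernel k t * D k t)"
    by (simp add: diff_kernel_def sum_distrib_right sum_distrib_left mult_ac)
  finally show ?thesis by simp
qed

section \<open>Derivatives of test functions along a line\<close>

lemma sum_lists_length_Suc:
  fixes F :: "'n::finite list \<Rightarrow> 'b::comm_monoid_add"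
  shows "(\<Sum>is | length is = Suc m. F is) = (\<Sum>is | length is = m. \<Sum>i\<in>UNIV. F (i # is))"
proof -
  have "(\<Sum>is | length is = Suc m. F is) = (\<Sum>p\<in>{is. length is = m} \<times> UNIV. F (snd p # fst p))"
    by (rule sum.reindex_bij_witness[where i="\<lambda>p. snd p # fst p" and j="\<lambda>xs. (tl xs, hd xs)"])
      (auto simp: length_Suc_conv)
  then show ?thesis by (simp add: sum.cartesian_product split_def)
qed

lemma finite_lists_length [simp]: "finite {is :: 'n::finite list. length is = m}"
  using finite_lists_length_eq[of "UNIV :: 'n set" m] by simp

lemma card_lists_length: "card {is :: 'n::finite list. length is = m} = CARD('n) ^ m"
  using card_lists_length_eq[of "UNIV :: 'n set" m] by simp

text \<open>The operator \<open>(h . grad)^m\<close>, expanded over index lists instead of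
  multi-indices. No multinomial coefficients appear, and one more differentiation along
  \<open>h\<close> just puts an index in front of the list.\<close>

definition dir_deriv :: "nat \<Rightarrow> real^'n::finite \<Rightarrow> (real^'n \<Rightarrow> real) \<Rightarrow> real^'n \<Rightarrow> real" where
  "dir_deriv m h \<phi> x = (\<Sum>is | length is = m. (\<Prod>i\<leftarrow>is. h $ i) * partials is \<phi> x)"

lemma vec_eq_sum_axis: "(h::real^'n::finite) = (\<Sum>i\<in>UNIV. h $ i *\<^sub>R axis i 1)"
  by (simp add: vec_eq_iff axis_def if_distrib cong: if_cong)

lemma DERIV_along:
  fixes \<phi> :: "real^'n::finite \<Rightarrow> real"
  assumes "\<phi> differentiable (at (x + t *\<^sub>R h))"
  shows "((\<lambda>t. \<phi> (x + t *\<^sub>R h)) has_real_derivative (\<Sum>i\<in>UNIV. h $ i * partial i \<phi> (x + t *\<^sub>R h))) (at t)"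
proof -
  let ?D = "frechet_derivative \<phi> (at (x + t *\<^sub>R h))"
  have D: "(\<phi> has_derivative ?D) (at (x + t *\<^sub>R h))"
    using assms by (simp add: frechet_derivative_works[symmetric])
  then have lin: "linear ?D" by (rule has_derivative_linear)
  have "((\<lambda>t. x + t *\<^sub>R h) has_derivative (\<lambda>s. s *\<^sub>R h)) (at t)"
    by (auto intro!: derivative_eq_intros)
  from has_derivative_compose[OF this D]
  have "((\<lambda>t. \<phi> (x + t *\<^sub>R h)) has_derivative (\<lambda>s. ?D (s *\<^sub>R h))) (at t)" .
  moreover have "?D (s *\<^sub>R h) = (\<Sum>i\<in>UNIV. h $ i * partial i \<phi> (x + t *\<^sub>R h)) * s" for s
  proof -
    have "?D (s *\<^sub>R h) = s * ?D h" using lin by (simp add: linear_scale)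
    also have "?D h = ?D (\<Sum>i\<in>UNIV. h $ i *\<^sub>R axis i 1)" using vec_eq_sum_axis[of h] by simp
    also have "\<dots> = (\<Sum>i\<in>UNIV. h $ i * partial i \<phi> (x + t *\<^sub>R h))"
      using lin by (simp add: linear_sum linear_scale partial_def)
    finally show ?thesis by simp
  qed
  ultimately show ?thesis by (simp add: has_field_derivative_def)
qed

lemma DERIV_dir_deriv:
  assumes "test_function \<phi>"
  shows "((\<lambda>t. dir_deriv m h \<phi> (x + t *\<^sub>R h)) has_real_derivative dir_deriv (Suc m) h \<phi> (x + t *\<^sub>R h)) (at t)"
proof -
  have "((\<lambda>t. dir_deriv m h \<phi> (x + t *\<^sub>R h)) has_real_derivative
      (\<Sum>is | length is = m. (\<Prod>i\<leftarrow>is. h $ i) * (\<Sum>i\<in>UNIV. h $ i * partial i (partials is \<phi>) (x + t *\<^sub>R h)))) (at t)"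
    unfolding dir_deriv_def
    by (intro DERIV_sum DERIV_cmult DERIV_along test_function_differentiable assms)
  then show ?thesis
    by (simp add: dir_deriv_def sum_lists_length_Suc partials_def sum_distrib_left mult_ac)
qed

lemma partials_translate:
  assumes "test_function \<phi>"
  shows "partials is (\<lambda>y. \<phi> (y - v)) = (\<lambda>y. partials is \<phi> (y - v))"
proof (induction "is")
  case (Cons i "is")
  have "partials (i # is) (\<lambda>y. \<phi> (y - v)) = partial i (\<lambda>y. partials is \<phi> (y - v))"
    using Cons by (simp add: partials_def)
  also have "\<dots> = (\<lambda>y. partial i (partials is \<phi>) (y - v))"
  proof
    fix y
    have "(partials is \<phi> has_derivative frechet_derivative (partials is \<phi>) (at (y - v))) (at (y - v))"
      using test_function_differentiable[OF assms] by (simp add: frechet_derivative_works[symmetric])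
    then have "((\<lambda>y. partials is \<phi> (y - v)) has_derivative frechet_derivative (partials is \<phi>) (at (y - v))) (at y)"
      by (rule has_derivative_compose[rotated]) (auto intro!: derivative_eq_intros)
    then show "partial i (\<lambda>y. partials is \<phi> (y - v)) y = partial i (partials is \<phi>) (y - v)"
      by (simp add: partial_def frechet_derivative_at[symmetric])
  qed
  finally show ?case by (simp add: partials_def)
qed (simp add: partials_def)

lemma bump_translate: "bump m a b (y - v) = bump m (a + v) (b + v) y"
  by (simp add: bump_def bump_real_def algebra_simps)

lemma partials_eq_0_on_open:
  fixes \<phi> :: "real^'n::finite \<Rightarrow> real"
  assumes "open S" "\<And>x. x \<in> S \<Longrightarrow> \<phi> x = 0" "x \<in> S"
  shows "partials is \<phi> x = 0"
  using \<open>x \<in> S\<close>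
proof (induction "is" arbitrary: x)
  case (Cons i "is")
  have "((\<lambda>_. 0::real) has_derivative (\<lambda>_. 0)) (at x)" by simp
  then have "(partials is \<phi> has_derivative (\<lambda>_. 0)) (at x)"
    by (rule has_derivative_transform_within_open[OF _ \<open>open S\<close>]) (use Cons in auto)
  then show ?case by (simp add: partials_def partial_def frechet_derivative_at[symmetric])
qed (simp add: partials_def assms)

lemma partials_bump_bounded:
  assumes "box a b \<subseteq> cball 0 R"
  shows "\<exists>C\<ge>0. \<forall>x. \<bar>partials is (bump m a b) x\<bar> \<le> C * indicator (cball 0 R) x"
proof -
  have "continuous_on (cball 0 R) (partials is (bump m a b))"
    by (rule test_function_continuous[OF test_function_bump])
  then have "bounded (partials is (bump m a b) ` cball 0 R)"
    by (intro compact_imp_bounded compact_continuous_image) auto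
  then obtain C where C: "0 < C" "\<forall>x\<in>cball 0 R. \<bar>partials is (bump m a b) x\<bar> \<le> C"
    by (auto simp: bounded_pos)
  moreover have "partials is (bump m a b) x = 0" if "x \<notin> cball 0 R" for x
    by (rule partials_eq_0_on_open[of "- cball 0 R"]) (use that assms bump_eq_0[of _ a b m] in \<open>auto simp: subset_eq simp del: mem_box\<close>)
  ultimately show ?thesis
    by (intro exI[of _ C]) (auto split: split_indicator)
qed

text \<open>By Tonelli, the slice bound is integrated over a bounded interval. This supplies the
  integrability on the product space that Fubini's theorem for signed functions requires.\<close>

lemma integrable_pair_strip:
  fixes F :: "real \<times> 'a::euclidean_space \<Rightarrow> real"
  assumes [measurable]: "F \<in> borel_measurable (borel \<Otimes>\<^sub>M borel)"
    and bound: "\<And>t. (\<integral>\<^sup>+y. ennreal \<bar>F (t, y)\<bar> \<partial>lborel) \<le> ennreal B * indicator {0..c} t"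
  shows "integrable (lborel \<Otimes>\<^sub>M lborel) F"
proof -
  have m: "F \<in> borel_measurable (lborel \<Otimes>\<^sub>M lborel)" by measurable
  have "(\<integral>\<^sup>+p. ennreal (norm (F p)) \<partial>(lborel \<Otimes>\<^sub>M lborel)) = (\<integral>\<^sup>+t. \<integral>\<^sup>+y. ennreal \<bar>F (t, y)\<bar> \<partial>lborel \<partial>lborel)"
    by (subst lborel.nn_integral_fst[symmetric]) (measurable; simp)+
  also have "\<dots> \<le> (\<integral>\<^sup>+t. ennreal B * indicator {0..c} t \<partial>lborel)"
    by (intro nn_integral_mono bound)
  also have "\<dots> < top" by (simp add: nn_integral_cmult ennreal_mult_less_top emeasure_lborel_Icc_eq)
  finally show ?thesis using m by (simp add: integrable_iff_bounded)
qed

lemma lborel_integral_translate: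
  fixes F :: "'a::euclidean_space \<Rightarrow> real"
  assumes [measurable]: "F \<in> borel_measurable borel"
  shows "(LINT y|lborel. F (y + v)) = (LINT y|lborel. F y)"
proof -
  have "(LINT y|lborel. F y) = (LINT y|distr lborel borel ((+) v). F y)" by (simp add: lborel_distr_plus)
  also have "\<dots> = (LINT y|lborel. F (v + y))" by (rule integral_distr) auto
  finally show ?thesis by (simp add: add.commute)
qed

text \<open>\<open>V h\<close> is the \<open>k\<close>-th weak directional derivative of
  \<open>f\<close>. Both sides are tested against bumps: the difference is moved onto the bump,
  where Taylor's formula is classical, and the derivatives are then moved back onto
  \<open>f\<close>.\<close>

lemma AE_fin_diff_eq_integral:
  fixes f :: "real^'n::finite \<Rightarrow> real" and W :: "('n \<Rightarrow> nat) \<Rightarrow> real^'n \<Rightarrow> real"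
  assumes k: "1 \<le> k" and f: "locally_integrable f"
    and W: "\<And>is. length is = k \<Longrightarrow> locally_integrable (W (count_list is))"
    and weak: "\<And>m a b is. length is = k \<Longrightarrow>
      (LINT x|lborel. f x * partials is (bump m a b) x) = (-1) ^ k * (LINT x|lborel. W (count_list is) x * bump m a b x)"
  defines "V \<equiv> \<lambda>h y. \<Sum>is | length is = k. (\<Prod>i\<leftarrow>is. h $ i) * W (count_list is) y"
  shows "AE y in lborel. fin_diff k h f y = (-1) ^ k * (LINT t|lborel. diff_kernel k t * V h (y + (real k - t) *\<^sub>R h))"
proof -
  have V: "locally_integrable (V h)"
    unfolding V_def by (intro locally_integrable_sum locally_integrable_cmult W) simp
  have [measurable]: "V h \<in> borel_measurable borel" "f \<in> borel_measurable borel"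
    using V f by (simp_all add: locally_integrable_def)
  define C where "C = 2 ^ k * real k ^ (k - 1)"
  have C: "\<bar>diff_kernel k t\<bar> \<le> C * indicator {0..real k} t" for t
  proof -
    have "indicator {0..real k} t * (real k - t) ^ (k - 1) \<le> indicator {0..real k} t * real k ^ (k - 1)"
      by (auto split: split_indicator intro: power_mono)
    then have "2 ^ k * (indicator {0..real k} t * (real k - t) ^ (k - 1)) \<le> 2 ^ k * (indicator {0..real k} t * real k ^ (k - 1))"
      by (rule mult_left_mono) simp
    from order_trans[OF diff_kernel_bound[OF k, of t] this] show ?thesis
      by (simp add: C_def mult_ac)
  qed
  have "0 \<le> C" by (simp add: C_def)
  have strip: "integrable (lborel \<Otimes>\<^sub>M lborel) (\<lambda>p. diff_kernel k (fst p) * (V h (snd p + (real k - fst p) *\<^sub>R h) * u (snd p)))"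
    if [measurable]: "u \<in> borel_measurable borel" and u: "\<And>y. \<bar>u y\<bar> \<le> indicator (cball 0 R) y" for u R
  proof -
    define B where "B = enn2real (\<integral>\<^sup>+y\<in>cball 0 (R + real k * norm h). ennreal \<bar>V h y\<bar> \<partial>lborel)"
    have B: "(\<integral>\<^sup>+y\<in>cball 0 (R + real k * norm h). ennreal \<bar>V h y\<bar> \<partial>lborel) = ennreal B"
      using V by (simp add: B_def locally_integrable_def)
    show ?thesis
    proof (rule integrable_pair_strip[where c="real k" and B="C * B"])
      fix t
      show "(\<integral>\<^sup>+y. ennreal \<bar>diff_kernel k (fst (t, y)) * (V h (snd (t, y) + (real k - fst (t, y)) *\<^sub>R h) * u (snd (t, y)))\<bar> \<partial>lborel)
          \<le> ennreal (C * B) * indicator {0..real k} t"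
      proof (cases "t \<in> {0..real k}")
        case True
        then have n: "R + norm ((real k - t) *\<^sub>R h) \<le> R + real k * norm h"
          by (auto intro!: mult_right_mono)
        have "(\<integral>\<^sup>+y. ennreal \<bar>diff_kernel k t * (V h (y + (real k - t) *\<^sub>R h) * u y)\<bar> \<partial>lborel)
            \<le> (\<integral>\<^sup>+y. ennreal C * (ennreal \<bar>V h (y + (real k - t) *\<^sub>R h)\<bar> * indicator (cball 0 R) y) \<partial>lborel)"
        proof (intro nn_integral_mono)
          fix y
          have "\<bar>diff_kernel k t\<bar> * (\<bar>V h (y + (real k - t) *\<^sub>R h)\<bar> * \<bar>u y\<bar>) \<le> C * (\<bar>V h (y + (real k - t) *\<^sub>R h)\<bar> * indicator (cball 0 R) y)"
            using C[of t] True u[of y] \<open>0 \<le> C\<close> by (intro mult_mono) auto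
          then show "ennreal \<bar>diff_kernel k t * (V h (y + (real k - t) *\<^sub>R h) * u y)\<bar> \<le> ennreal C * (ennreal \<bar>V h (y + (real k - t) *\<^sub>R h)\<bar> * indicator (cball 0 R) y)"
            using \<open>0 \<le> C\<close> by (simp add: abs_mult ennreal_indicator[symmetric] ennreal_mult[symmetric] ennreal_leI)
        qed
        also have "\<dots> = ennreal C * (\<integral>\<^sup>+y\<in>cball 0 R. ennreal \<bar>V h (y + (real k - t) *\<^sub>R h)\<bar> \<partial>lborel)"
          by (rule nn_integral_cmult) measurable
        also have "\<dots> \<le> ennreal C * (\<integral>\<^sup>+y\<in>cball 0 (R + norm ((real k - t) *\<^sub>R h)). ennreal \<bar>V h y\<bar> \<partial>lborel)"
          by (intro mult_left_mono nn_integral_cball_translate_le) auto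
        also have "\<dots> \<le> ennreal C * ennreal B"
          unfolding B[symmetric] using n
          by (intro mult_left_mono nn_integral_mono mult_left_mono) (auto split: split_indicator)
        finally show ?thesis using True \<open>0 \<le> C\<close> by (simp add: ennreal_mult B_def)
      qed (use C[of t] in simp)
    qed measurable
  qed
  \<comment> \<open>The claimed value of the difference, up to the sign
    \<open>(-1) ^ k\<close>.\<close>
  define U where "U y = (LINT t|lborel. diff_kernel k t * V h (y + (real k - t) *\<^sub>R h))" for y
  have [measurable]: "U \<in> borel_measurable borel"
  proof -
    have "(\<lambda>y. LINT t|lborel. diff_kernel k t * V h (y + (real k - t) *\<^sub>R h)) \<in> borel_measurable lborel"
      by (rule lborel.borel_measurable_lebesgue_integral) measurable
    then show ?thesis by (simp add: U_def[abs_def])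
  qed
  have fubini: "integrable lborel (\<lambda>y. U y * u y)"
    "(LINT y|lborel. U y * u y) = (LINT t|lborel. diff_kernel k t * (LINT y|lborel. V h (y + (real k - t) *\<^sub>R h) * u y))"
    if [measurable]: "u \<in> borel_measurable borel" and u: "\<And>y. \<bar>u y\<bar> \<le> indicator (cball 0 R) y" for u R
  proof -
    have int: "integrable (lborel \<Otimes>\<^sub>M lborel) (\<lambda>(t, y). diff_kernel k t * (V h (y + (real k - t) *\<^sub>R h) * u y))"
      using strip[OF that] by (simp add: split_def)
    have eq: "U y * u y = (LINT t|lborel. diff_kernel k t * (V h (y + (real k - t) *\<^sub>R h) * u y))" for y
      by (simp add: U_def mult.assoc[symmetric])
    show "integrable lborel (\<lambda>y. U y * u y)"
      unfolding eq using lborel_pair.integrable_snd[OF int] by simp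
    show "(LINT y|lborel. U y * u y) = (LINT t|lborel. diff_kernel k t * (LINT y|lborel. V h (y + (real k - t) *\<^sub>R h) * u y))"
      unfolding eq using lborel_pair.Fubini_integral[OF int] by simp
  qed
  have bumps: "(LINT y|lborel. fin_diff k h f y * bump m a b y) = (-1) ^ k * (LINT y|lborel. U y * bump m a b y)" for m a b
  proof -
    obtain R where R: "R > 0" "box a b \<subseteq> cball 0 R" using box_subset_cball_0[of a b] by auto
    let ?\<psi> = "bump m a b"
    have \<psi>: "\<bar>?\<psi> y\<bar> \<le> indicator (cball 0 R) y" for y
      using bump_bounds[of m a b y] bump_eq_0[of y a b m] subsetD[OF R(2), of y] by (cases "y \<in> box a b") (auto simp: indicator_def)
    have \<psi>v: "\<bar>?\<psi> (y - v)\<bar> \<le> 1 * indicator (cball 0 (R + norm v)) y" for y v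
    proof -
      have "norm y \<le> norm (y - v) + norm v" using norm_triangle_ineq[of "y - v" v] by simp
      then show ?thesis using \<psi>[of "y - v"] by (auto split: split_indicator split_indicator_asm)
    qed
    define c where "c j = (-1) ^ (k - j) * real (k choose j)" for j
    \<comment> \<open>A directional derivative of a translated bump. A translated bump is a bump
      again, so that \<open>weak\<close> applies to each summand of \<open>L t\<close>.\<close>
    define L where "L t y = dir_deriv k h ?\<psi> (y - (real k - t) *\<^sub>R h)" for t y
    have Lsum: "L t y = (\<Sum>is | length is = k. (\<Prod>i\<leftarrow>is. h $ i) * partials is (bump m (a + (real k - t) *\<^sub>R h) (b + (real k - t) *\<^sub>R h)) y)" for t y
    proof -
      have "partials is ?\<psi> (y - v) = partials is (bump m (a + v) (b + v)) y" for "is" v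
        using fun_cong[OF partials_translate[OF test_function_bump[of m a b], of "is" v], of y]
        by (simp add: bump_translate)
      then show ?thesis by (simp add: L_def dir_deriv_def)
    qed
    have [measurable]: "dir_deriv k h ?\<psi> \<in> borel_measurable borel"
      unfolding dir_deriv_def[abs_def]
      by (intro borel_measurable_sum borel_measurable_times borel_measurable_const test_function_measurable[OF test_function_bump])
    have "\<exists>C\<ge>0. \<forall>x. \<bar>partials is ?\<psi> x\<bar> \<le> C * indicator (cball 0 R) x" for "is"
      by (rule partials_bump_bounded[OF R(2)])
    then obtain P where P: "\<And>is. 0 \<le> P is" "\<And>is x. \<bar>partials is ?\<psi> x\<bar> \<le> P is * indicator (cball 0 R) x"
      by metis
    define Q where "Q = (\<Sum>is | length is = k. \<bar>\<Prod>i\<leftarrow>is. h $ i\<bar> * P is)"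
    have Q: "\<bar>dir_deriv k h ?\<psi> x\<bar> \<le> Q * indicator (cball 0 R) x" for x
    proof -
      have "\<bar>dir_deriv k h ?\<psi> x\<bar> \<le> (\<Sum>is | length is = k. \<bar>\<Prod>i\<leftarrow>is. h $ i\<bar> * (P is * indicator (cball 0 R) x))"
        unfolding dir_deriv_def
        by (rule order_trans[OF sum_abs], intro sum_mono) (use P in \<open>auto simp: abs_mult intro!: mult_left_mono\<close>)
      then show ?thesis by (simp add: Q_def sum_distrib_right mult.assoc)
    qed
    have "0 \<le> Q" unfolding Q_def by (intro sum_nonneg mult_nonneg_nonneg P) auto
    have Qv: "\<bar>L t y\<bar> \<le> Q * indicator (cball 0 (R + real k * norm h)) y" if "t \<in> {0..real k}" for t y
    proof -
      have "norm y \<le> norm (y - (real k - t) *\<^sub>R h) + norm ((real k - t) *\<^sub>R h)"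
        using norm_triangle_ineq[of "y - (real k - t) *\<^sub>R h" "(real k - t) *\<^sub>R h"] by simp
      moreover have "norm ((real k - t) *\<^sub>R h) \<le> real k * norm h"
        using that by (auto intro!: mult_right_mono)
      ultimately show ?thesis
        using Q[of "y - (real k - t) *\<^sub>R h"] \<open>0 \<le> Q\<close> by (auto simp: L_def split: split_indicator split_indicator_asm)
    qed
    have "(LINT y|lborel. fin_diff k h f y * ?\<psi> y) = (LINT y|lborel. (\<Sum>j\<le>k. c j * (f (y + real j *\<^sub>R h) * ?\<psi> y)))"
      by (simp add: fin_diff_def c_def sum_distrib_left sum_distrib_right mult_ac)
    also have "\<dots> = (\<Sum>j\<le>k. c j * (LINT y|lborel. f (y + real j *\<^sub>R h) * ?\<psi> y))"
    proof (subst Bochner_Integration.integral_sum)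
      show "integrable lborel (\<lambda>y. c j * (f (y + real j *\<^sub>R h) * ?\<psi> y))" for j
        using locally_integrable_mult_integrable[OF locally_integrable_translate[OF f], of ?\<psi> 1 R] \<psi> by simp
    qed simp
    also have "\<dots> = (\<Sum>j\<le>k. c j * (LINT y|lborel. f y * ?\<psi> (y - real j *\<^sub>R h)))"
      using lborel_integral_translate[of "\<lambda>y. f y * ?\<psi> (y - real j *\<^sub>R h)" "real j *\<^sub>R h" for j] by simp
    also have "\<dots> = (LINT y|lborel. (\<Sum>j\<le>k. c j * (f y * ?\<psi> (y - real j *\<^sub>R h))))"
    proof (subst Bochner_Integration.integral_sum)
      show "integrable lborel (\<lambda>y. c j * (f y * ?\<psi> (y - real j *\<^sub>R h)))" for j
        by (intro integrable_mult_right locally_integrable_mult_integrable[OF f _ \<psi>v[of _ "real j *\<^sub>R h"]]) measurable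
    qed simp
    also have "\<dots> = (LINT y|lborel. f y * (LINT t|lborel. diff_kernel k t * L t y))"
    proof (rule Bochner_Integration.integral_cong[OF refl])
      fix y
      \<comment> \<open>Reversing the index makes \<open>y - k h\<close> the base point of a forward
        difference of the bump: the nodes become \<open>0, ..., k\<close> and the signs
        \<open>(-1) ^ i\<close>.\<close>
      have "(\<Sum>j\<le>k. c j * ?\<psi> (y - real j *\<^sub>R h)) = (\<Sum>i\<le>k. (-1) ^ i * real (k choose i) * ?\<psi> (y - (real k - real i) *\<^sub>R h))"
        by (rule sum.reindex_bij_witness[where i="\<lambda>i. k - i" and j="\<lambda>i. k - i"])
          (auto simp: c_def of_nat_diff binomial_symmetric[symmetric])
      also have "\<dots> = (\<Sum>i\<le>k. (-1) ^ i * real (k choose i) * dir_deriv 0 h ?\<psi> ((y - real k *\<^sub>R h) + real i *\<^sub>R h))"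
        by (simp add: dir_deriv_def partials_def algebra_simps)
      also have "\<dots> = (LINT t|lborel. diff_kernel k t * dir_deriv k h ?\<psi> ((y - real k *\<^sub>R h) + t *\<^sub>R h))"
        using alternating_sum_eq_integral[OF k, of "\<lambda>m t. dir_deriv m h ?\<psi> ((y - real k *\<^sub>R h) + t *\<^sub>R h)"]
          DERIV_dir_deriv[OF test_function_bump] by blast
      also have "\<dots> = (LINT t|lborel. diff_kernel k t * L t y)"
        by (simp add: L_def algebra_simps)
      finally show "(\<Sum>j\<le>k. c j * (f y * ?\<psi> (y - real j *\<^sub>R h))) = f y * (LINT t|lborel. diff_kernel k t * L t y)"
        by (simp add: mult.left_commute[of "c _"] sum_distrib_left[symmetric])
    qed
    also have "\<dots> = (LINT y|lborel. (LINT t|lborel. diff_kernel k t * (f y * L t y)))"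
      by (simp add: mult.left_commute)
    also have "\<dots> = (LINT t|lborel. (LINT y|lborel. diff_kernel k t * (f y * L t y)))"
    proof (rule lborel_pair.Fubini_integral)
      define B where "B = enn2real (\<integral>\<^sup>+y\<in>cball 0 (R + real k * norm h). ennreal \<bar>f y\<bar> \<partial>lborel)"
      have B: "(\<integral>\<^sup>+y\<in>cball 0 (R + real k * norm h). ennreal \<bar>f y\<bar> \<partial>lborel) = ennreal B"
        using f by (simp add: B_def locally_integrable_def)
      show "integrable (lborel \<Otimes>\<^sub>M lborel) (\<lambda>(t, y). diff_kernel k t * (f y * L t y))"
      proof (rule integrable_pair_strip[where c="real k" and B="C * Q * B"])
        fix t
        show "(\<integral>\<^sup>+y. ennreal \<bar>case (t, y) of (t, y) \<Rightarrow> diff_kernel k t * (f y * L t y)\<bar> \<partial>lborel)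
            \<le> ennreal (C * Q * B) * indicator {0..real k} t"
        proof (cases "t \<in> {0..real k}")
          case True
          have "(\<integral>\<^sup>+y. ennreal \<bar>diff_kernel k t * (f y * L t y)\<bar> \<partial>lborel)
              \<le> (\<integral>\<^sup>+y. ennreal (C * Q) * (ennreal \<bar>f y\<bar> * indicator (cball 0 (R + real k * norm h)) y) \<partial>lborel)"
          proof (intro nn_integral_mono)
            fix y
            have "\<bar>diff_kernel k t\<bar> * (\<bar>f y\<bar> * \<bar>L t y\<bar>) \<le> C * (\<bar>f y\<bar> * (Q * indicator (cball 0 (R + real k * norm h)) y))"
              using C[of t] True Qv[OF True, of y] \<open>0 \<le> C\<close> by (intro mult_mono) auto
            then show "ennreal \<bar>diff_kernel k t * (f y * L t y)\<bar> \<le> ennreal (C * Q) * (ennreal \<bar>f y\<bar> * indicator (cball 0 (R + real k * norm h)) y)"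
              using \<open>0 \<le> C\<close> \<open>0 \<le> Q\<close> by (simp add: abs_mult ennreal_indicator[symmetric] ennreal_mult[symmetric] ennreal_leI mult_ac)
          qed
          also have "\<dots> = ennreal (C * Q) * ennreal B"
            unfolding B[symmetric] by (rule nn_integral_cmult) measurable
          finally show ?thesis using True \<open>0 \<le> C\<close> \<open>0 \<le> Q\<close> by (simp add: ennreal_mult B_def)
        qed (use C[of t] in simp)
      qed (simp add: L_def, measurable)
    qed
    \<comment> \<open>For fixed \<open>t\<close> the weak derivatives take the \<open>k\<close>
      derivatives off the bump, and a translation then returns the bump to its original
      position.\<close>
    also have "\<dots> = (LINT t|lborel. diff_kernel k t * ((-1) ^ k * (LINT y|lborel. V h (y + (real k - t) *\<^sub>R h) * ?\<psi> y)))"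
    proof (rule Bochner_Integration.integral_cong[OF refl])
      fix t
      define v where "v = (real k - t) *\<^sub>R h"
      obtain R' where R': "box (a + v) (b + v) \<subseteq> cball 0 R'" using box_subset_cball_0[of "a + v" "b + v"] by auto
      have "(LINT y|lborel. f y * L t y) = (LINT y|lborel. (\<Sum>is | length is = k. (\<Prod>i\<leftarrow>is. h $ i) * (f y * partials is (bump m (a + v) (b + v)) y)))"
        by (simp add: Lsum v_def sum_distrib_left mult_ac)
      also have "\<dots> = (\<Sum>is | length is = k. (\<Prod>i\<leftarrow>is. h $ i) * (LINT y|lborel. f y * partials is (bump m (a + v) (b + v)) y))"
      proof (subst Bochner_Integration.integral_sum)
        fix "is" :: "'n list"
        obtain C where "\<And>x. \<bar>partials is (bump m (a + v) (b + v)) x\<bar> \<le> C * indicator (cball 0 R') x"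
          using partials_bump_bounded[OF R', of "is" m] by auto
        then show "integrable lborel (\<lambda>y. (\<Prod>i\<leftarrow>is. h $ i) * (f y * partials is (bump m (a + v) (b + v)) y))"
          by (intro integrable_mult_right locally_integrable_mult_integrable[OF f] test_function_measurable[OF test_function_bump])
      qed simp
      also have "\<dots> = (\<Sum>is | length is = k. (\<Prod>i\<leftarrow>is. h $ i) * ((-1) ^ k * (LINT y|lborel. W (count_list is) y * bump m (a + v) (b + v) y)))"
        by (intro sum.cong refl) (simp add: weak)
      also have "\<dots> = (-1) ^ k * (LINT y|lborel. (\<Sum>is | length is = k. (\<Prod>i\<leftarrow>is. h $ i) * (W (count_list is) y * bump m (a + v) (b + v) y)))"
      proof (subst Bochner_Integration.integral_sum)
        fix "is" :: "'n list" assume "is \<in> {is. length is = k}"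
        then show "integrable lborel (\<lambda>y. (\<Prod>i\<leftarrow>is. h $ i) * (W (count_list is) y * bump m (a + v) (b + v) y))"
        proof (intro integrable_mult_right locally_integrable_mult_integrable[OF W, where C=1 and R=R'])
          show "\<bar>bump m (a + v) (b + v) y\<bar> \<le> 1 * indicator (cball 0 R') y" for y
            using bump_bounds[of m "a + v" "b + v" y] bump_eq_0[of y "a + v" "b + v" m] subsetD[OF R', of y]
            by (cases "y \<in> box (a + v) (b + v)") (auto simp: indicator_def)
        qed auto
      qed (simp add: sum_distrib_left mult.left_commute[of "(-1) ^ k"])
      also have "\<dots> = (-1) ^ k * (LINT y|lborel. V h y * ?\<psi> (y - v))"
        by (simp add: V_def sum_distrib_right mult.assoc bump_translate)
      also have "(LINT y|lborel. V h y * ?\<psi> (y - v)) = (LINT y|lborel. V h (y + v) * ?\<psi> y)"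
        using lborel_integral_translate[of "\<lambda>y. V h y * ?\<psi> (y - v)" v] by simp
      finally show "(LINT y|lborel. diff_kernel k t * (f y * L t y)) = diff_kernel k t * ((-1) ^ k * (LINT y|lborel. V h (y + (real k - t) *\<^sub>R h) * ?\<psi> y))"
        by (simp add: v_def)
    qed
    also have "\<dots> = (-1) ^ k * (LINT t|lborel. diff_kernel k t * (LINT y|lborel. V h (y + (real k - t) *\<^sub>R h) * ?\<psi> y))"
      by (subst integral_mult_right_zero[symmetric]) (simp only: mult.left_commute[of "(-1) ^ k"])
    also have "\<dots> = (-1) ^ k * (LINT y|lborel. U y * ?\<psi> y)"
      using fubini(2)[of ?\<psi> R] \<psi> by simp
    finally show ?thesis .
  qed
  have Ubox: "integrable lborel (\<lambda>y. U y * indicator (box a b) y)" for a b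
  proof -
    obtain R where "box a b \<subseteq> cball 0 R" using box_subset_cball_0[of a b] by auto
    then show ?thesis by (intro fubini(1)[where R=R]) (auto split: split_indicator)
  qed
  note Fbox = locally_integrable_box[OF locally_integrable_fin_diff[OF f]]
  have [measurable]: "fin_diff k h f \<in> borel_measurable borel"
    using locally_integrable_fin_diff[OF f] by (simp add: locally_integrable_def)
  have "AE y in lborel. fin_diff k h f y - (-1) ^ k * U y = 0"
  proof (rule AE_eq_0_if_integral_bump_eq_0)
    show "integrable lborel (\<lambda>x. (fin_diff k h f x - (-1) ^ k * U x) * indicator (box a b) x)" for a b
      using Bochner_Integration.integrable_diff[OF Fbox[of k h a b] integrable_mult_right[OF Ubox[of a b], of "(-1) ^ k"]]
      by (simp add: algebra_simps)
    show "(LINT x|lborel. (fin_diff k h f x - (-1) ^ k * U x) * bump m a b x) = 0" for m a b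
    proof -
      obtain R where R: "box a b \<subseteq> cball 0 R" using box_subset_cball_0[of a b] by auto
      have \<psi>: "\<bar>bump m a b y\<bar> \<le> indicator (cball 0 R) y" for y
        using bump_bounds[of m a b y] bump_eq_0[of y a b m] subsetD[OF R, of y] by (cases "y \<in> box a b") (auto simp: indicator_def)
      have i1: "integrable lborel (\<lambda>x. fin_diff k h f x * bump m a b x)"
        using \<psi> by (intro locally_integrable_mult_integrable[OF locally_integrable_fin_diff[OF f], where C=1 and R=R]) auto
      have i2: "integrable lborel (\<lambda>x. (-1) ^ k * (U x * bump m a b x))"
        using \<psi> by (intro integrable_mult_right fubini(1)[where R=R]) auto
      have "(LINT x|lborel. (fin_diff k h f x - (-1) ^ k * U x) * bump m a b x)
          = (LINT x|lborel. fin_diff k h f x * bump m a b x - (-1) ^ k * (U x * bump m a b x))"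
        by (simp add: left_diff_distrib mult.assoc)
      also have "\<dots> = (LINT x|lborel. fin_diff k h f x * bump m a b x) - (LINT x|lborel. (-1) ^ k * (U x * bump m a b x))"
        by (rule Bochner_Integration.integral_diff[OF i1 i2])
      finally show ?thesis using bumps by simp
    qed
  qed measurable
  then show ?thesis by eventually_elim (simp add: U_def)
qed

text \<open>Excluding \<open>t = 0\<close> keeps every radius \<open>t * \<rho>\<close> positive
  when these integrals are averaged over steps, as the bounds on ball means demand.\<close>

definition segment_mean :: "nat \<Rightarrow> (real^'n::finite \<Rightarrow> real) \<Rightarrow> real^'n \<Rightarrow> real^'n \<Rightarrow> ennreal" where
  "segment_mean k g h y = (\<integral>\<^sup>+t. ennreal (indicator {0<..real k} t * t ^ (k - 1)) * ennreal (g (y + t *\<^sub>R h)) \<partial>lborel)"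

lemma abs_prod_list_nth_le: "\<bar>\<Prod>i\<leftarrow>is. (h::real^'n::finite) $ i\<bar> \<le> norm h ^ length is"
  by (induction "is") (auto simp: abs_mult intro!: mult_mono component_le_norm_cart)

lemma sum_count_list_UNIV: "(\<Sum>i\<in>UNIV. count_list is (i::'n::finite)) = length is"
  using sum_count_set[of "is" "UNIV :: 'n set"] by simp

text \<open>The constant combines \<open>2 ^ k\<close> from the kernel with the number
  \<open>CARD('n) ^ k\<close> of index lists, each of which contributes at most
  \<open>norm h ^ k * g\<close>.\<close>

lemma AE_fin_diff_le_segment_mean:
  fixes f g :: "real^'n::finite \<Rightarrow> real" and W :: "('n \<Rightarrow> nat) \<Rightarrow> real^'n \<Rightarrow> real"
  assumes k: "1 \<le> k" and f: "locally_integrable f"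
    and W: "\<And>\<alpha>. \<alpha> \<in> multi_indices k \<Longrightarrow> locally_integrable (W \<alpha>)"
    and weak: "\<And>m a b is. length is = k \<Longrightarrow>
      (LINT x|lborel. f x * partials is (bump m a b) x) = (-1) ^ k * (LINT x|lborel. W (count_list is) x * bump m a b x)"
    and [measurable]: "g \<in> borel_measurable borel"
    and g: "\<And>\<alpha> x. \<alpha> \<in> multi_indices k \<Longrightarrow> \<bar>W \<alpha> x\<bar> \<le> g x"
  shows "AE y in lborel. ennreal \<bar>fin_diff k h f y\<bar> \<le> ennreal ((2 * real CARD('n)) ^ k * norm h ^ k) * segment_mean k g h y"
proof -
  have MI: "count_list is \<in> multi_indices k" if "length is = k" for "is" :: "'n list"
    using that by (simp add: multi_indices_def sum_count_list_UNIV)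
  define V where "V y = (\<Sum>is | length is = k. (\<Prod>i\<leftarrow>is. h $ i) * W (count_list is) y)" for y
  have V: "\<bar>V y\<bar> \<le> real CARD('n) ^ k * norm h ^ k * g y" for y
  proof -
    have "\<bar>V y\<bar> \<le> (\<Sum>is | length (is::'n list) = k. norm h ^ k * g y)"
      unfolding V_def
    proof (rule order_trans[OF sum_abs], intro sum_mono)
      fix "is" :: "'n list" assume "is \<in> {is. length is = k}"
      then show "\<bar>(\<Prod>i\<leftarrow>is. h $ i) * W (count_list is) y\<bar> \<le> norm h ^ k * g y"
        using abs_prod_list_nth_le[of h "is"] g[OF MI, of "is" y] by (auto simp: abs_mult intro!: mult_mono)
    qed
    then show ?thesis by (simp add: card_lists_length mult.assoc)
  qed
  have [measurable]: "V \<in> borel_measurable borel"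
    unfolding V_def[abs_def] using W[OF MI]
    by (intro borel_measurable_sum borel_measurable_times borel_measurable_const) (auto simp: locally_integrable_def)
  let ?c = "(2 * real CARD('n)) ^ k * norm h ^ k"
  have "AE y in lborel. fin_diff k h f y = (-1) ^ k * (LINT t|lborel. diff_kernel k t * V (y + (real k - t) *\<^sub>R h))"
    unfolding V_def by (rule AE_fin_diff_eq_integral[OF k f W[OF MI] weak])
  then show ?thesis
  proof eventually_elim
    case (elim y)
    have "ennreal \<bar>fin_diff k h f y\<bar> = ennreal (norm (LINT t|lborel. diff_kernel k t * V (y + (real k - t) *\<^sub>R h)))"
      using elim by (simp add: abs_mult power_abs)
    also have "\<dots> \<le> (\<integral>\<^sup>+t. ennreal (norm (diff_kernel k t * V (y + (real k - t) *\<^sub>R h))) \<partial>lborel)"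
    \<comment> \<open>The Bochner integral of a non-integrable function is 0 by convention, so the
      bound persists in that case.\<close>
    proof (cases "integrable lborel (\<lambda>t. diff_kernel k t * V (y + (real k - t) *\<^sub>R h))")
      case True
      then show ?thesis by (rule integral_norm_bound_ennreal)
    qed (simp add: not_integrable_integral_eq)
    also have "\<dots> \<le> (\<integral>\<^sup>+t. ennreal ?c * (ennreal (indicator {0..real k} t * (real k - t) ^ (k - 1)) * ennreal (g (y + (real k - t) *\<^sub>R h))) \<partial>lborel)"
    proof (intro nn_integral_mono)
      fix t
      let ?i = "indicator {0..real k} t * (real k - t) ^ (k - 1)"
      have i: "0 \<le> ?i" by (auto split: split_indicator)
      have "\<bar>diff_kernel k t\<bar> * \<bar>V (y + (real k - t) *\<^sub>R h)\<bar>
          \<le> (2 ^ k * ?i) * (real CARD('n) ^ k * norm h ^ k * g (y + (real k - t) *\<^sub>R h))"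
        using i by (intro mult_mono V diff_kernel_bound[OF k]) auto
      also have "\<dots> = ?c * (?i * g (y + (real k - t) *\<^sub>R h))"
        by (simp add: power_mult_distrib)
      finally show "ennreal (norm (diff_kernel k t * V (y + (real k - t) *\<^sub>R h)))
          \<le> ennreal ?c * (ennreal ?i * ennreal (g (y + (real k - t) *\<^sub>R h)))"
        unfolding ennreal_mult'[OF i, symmetric]
        by (subst ennreal_mult'[symmetric], simp, subst real_norm_def, subst abs_mult, intro ennreal_leI, assumption)
    qed
    also have "\<dots> = ennreal ?c * (\<integral>\<^sup>+t. ennreal (indicator {0..real k} t * (real k - t) ^ (k - 1)) * ennreal (g (y + (real k - t) *\<^sub>R h)) \<partial>lborel)"
      by (rule nn_integral_cmult) measurable
    \<comment> \<open>Reflecting \<open>t\<close> to \<open>k - t\<close> moves the zero of the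
      kernel bound to the end of the segment at \<open>y\<close> itself.\<close>
    also have "(\<integral>\<^sup>+t. ennreal (indicator {0..real k} t * (real k - t) ^ (k - 1)) * ennreal (g (y + (real k - t) *\<^sub>R h)) \<partial>lborel)
        = (\<integral>\<^sup>+t. ennreal (indicator {0..real k} t * t ^ (k - 1)) * ennreal (g (y + t *\<^sub>R h)) \<partial>lborel)"
    proof -
      have i: "indicator {0..real k} (real k - t) = (indicator {0..real k} t :: real)" for t
        by (auto split: split_indicator)
      have "(\<lambda>t. ennreal (indicator {0..real k} t * (real k - t) ^ (k - 1)) * ennreal (g (y + (real k - t) *\<^sub>R h))) \<in> borel_measurable borel"
        by measurable
      from nn_integral_real_affine[OF this, of "- 1" "real k"] show ?thesis by (simp add: i)
    qed
    also have "\<dots> = segment_mean k g h y"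
      unfolding segment_mean_def
    proof (rule nn_integral_cong_AE)
      show "AE t in lborel. ennreal (indicator {0..real k} t * t ^ (k - 1)) * ennreal (g (y + t *\<^sub>R h))
          = ennreal (indicator {0<..real k} t * t ^ (k - 1)) * ennreal (g (y + t *\<^sub>R h))"
        using AE_lborel_singleton[of "0::real"] by eventually_elim (auto simp: indicator_def)
    qed
    finally show ?case .
  qed
qed

section \<open>Weak derivatives\<close>

lemma AE_lebesgue_iff: "(AE x in lebesgue. P x) \<longleftrightarrow> (AE x in lborel. P x)"
  by (rule AE_completion_iff)

lemma borel_representative:
  assumes "f \<in> L0"
  obtains f0 where "f0 \<in> borel_measurable borel" "AE x in lborel. f x = f0 x"
  using completion_ex_borel_measurable_real[of f lborel] assms by (auto simp: L0_def)

lemma locally_integrable_representative: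
  assumes f: "f \<in> L1_loc" and f0: "f0 \<in> borel_measurable borel" "AE x in lborel. f x = f0 x"
  shows "locally_integrable f0"
proof -
  have "(\<integral>\<^sup>+y\<in>cball 0 R. ennreal \<bar>f0 y\<bar> \<partial>lborel) < top" for R
  proof -
    have "set_integrable lebesgue (cball 0 R) f" using f by (simp add: L1_loc_def)
    then have "(\<integral>\<^sup>+y. ennreal (norm (indicator (cball 0 R) y *\<^sub>R f y)) \<partial>lebesgue) < top"
      by (simp add: set_integrable_def integrable_iff_bounded)
    also have "(\<integral>\<^sup>+y. ennreal (norm (indicator (cball 0 R) y *\<^sub>R f y)) \<partial>lebesgue) = (\<integral>\<^sup>+y\<in>cball 0 R. ennreal \<bar>f0 y\<bar> \<partial>lebesgue)"
    proof (rule nn_integral_cong_AE)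
      show "AE y in lebesgue. ennreal (norm (indicator (cball 0 R) y *\<^sub>R f y)) = ennreal \<bar>f0 y\<bar> * indicator (cball 0 R) y"
        unfolding AE_lebesgue_iff using f0(2) by eventually_elim (auto split: split_indicator)
    qed
    finally show ?thesis by (simp add: nn_integral_completion)
  qed
  then show ?thesis using f0 by (simp add: locally_integrable_def)
qed

lemma integral_lebesgue_representative:
  fixes f f0 u :: "'a::euclidean_space \<Rightarrow> real"
  assumes f: "f \<in> borel_measurable lebesgue" and [measurable]: "f0 \<in> borel_measurable borel" and ae: "AE x in lborel. f x = f0 x"
    and [measurable]: "u \<in> borel_measurable borel"
  shows "(LINT x|lebesgue. f x * u x) = (LINT x|lborel. f0 x * u x)"
proof -
  have u: "u \<in> borel_measurable lebesgue" and f0: "f0 \<in> borel_measurable lebesgue"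
    by (simp_all add: measurable_completion)
  have "(LINT x|lebesgue. f x * u x) = (LINT x|lebesgue. f0 x * u x)"
  proof (rule integral_cong_AE)
    show "AE x in lebesgue. f x * u x = f0 x * u x"
      unfolding AE_lebesgue_iff using ae by eventually_elim simp
  qed (intro borel_measurable_times f f0 u)+
  also have "\<dots> = (LINT x|lborel. f0 x * u x)"
    by (rule integral_completion) measurable
  finally show ?thesis .
qed

text \<open>Writing out each index \<open>i\<close> exactly \<open>\<alpha> i\<close> times realises
  any multi-index. This connects weak derivatives, indexed by functions, with directional
  derivatives, indexed by lists.\<close>

lemma multi_indices_eq: "multi_indices k = count_list ` {is :: 'n::finite list. length is = k}"
proof
  show "count_list ` {is :: 'n list. length is = k} \<subseteq> multi_indices k"
    by (auto simp: multi_indices_def sum_count_list_UNIV)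
  show "multi_indices k \<subseteq> count_list ` {is :: 'n list. length is = k}"
  proof
    fix \<alpha> :: "'n \<Rightarrow> nat" assume \<alpha>: "\<alpha> \<in> multi_indices k"
    obtain xs where xs: "mset xs = (\<Sum>i\<in>UNIV. replicate_mset (\<alpha> i) i)"
      using ex_mset by blast
    have "count_list xs i = \<alpha> i" for i
      by (simp add: count_mset[symmetric] xs count_sum if_distrib cong: if_cong)
    then have eq: "count_list xs = \<alpha>" by auto
    then have "length xs = k" using \<alpha> sum_count_list_UNIV[of xs] by (simp add: multi_indices_def)
    then show "\<alpha> \<in> count_list ` {is. length is = k}" using eq by auto
  qed
qed

lemma finite_multi_indices [simp]: "finite (multi_indices k :: ('n::finite \<Rightarrow> nat) set)"
  by (simp add: multi_indices_eq)

lemma weak_deriv_bump: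
  assumes w: "has_weak_deriv f \<alpha> g" and js: "count_list is = \<alpha>"
    and f0: "f0 \<in> borel_measurable borel" "AE x in lborel. f x = f0 x"
    and g0: "g0 \<in> borel_measurable borel" "AE x in lborel. g x = g0 x"
  shows "(LINT x|lborel. f0 x * partials is (bump m a b) x) = (-1) ^ length is * (LINT x|lborel. g0 x * bump m a b x)"
proof -
  have "(LINT x|lebesgue. f x * partials is (bump m a b) x) = (-1) ^ (\<Sum>i\<in>UNIV. \<alpha> i) * (LINT x|lebesgue. g x * bump m a b x)"
  proof -
    have "\<forall>i. count_list is i = \<alpha> i" using js by auto
    then show ?thesis using w test_function_bump[of m a b] unfolding has_weak_deriv_def by blast
  qed
  moreover have "(LINT x|lebesgue. f x * partials is (bump m a b) x) = (LINT x|lborel. f0 x * partials is (bump m a b) x)"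
    using w f0 test_function_measurable[OF test_function_bump]
    by (intro integral_lebesgue_representative) (auto simp: has_weak_deriv_def L1_loc_def L0_def)
  moreover have "(LINT x|lebesgue. g x * bump m a b x) = (LINT x|lborel. g0 x * bump m a b x)"
    using w g0 by (intro integral_lebesgue_representative) (auto simp: has_weak_deriv_def L1_loc_def L0_def)
  ultimately show ?thesis using js sum_count_list_UNIV[of "is"] by simp
qed

text \<open>The difference of two weak derivatives integrates to 0 against every bump, so the
  fundamental lemma applies. Uniqueness makes the arbitrary choice in \<open>weak_deriv\<close>
  harmless.\<close>

lemma has_weak_deriv_unique:
  assumes g: "has_weak_deriv f \<alpha> g" and g': "has_weak_deriv f \<alpha> g'"
  shows "AE x in lebesgue. g x = g' x"
proof -
  have L0: "f \<in> L0" "g \<in> L0" "g' \<in> L0" and L1: "g \<in> L1_loc" "g' \<in> L1_loc"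
    using g g' by (auto simp: has_weak_deriv_def L1_loc_def)
  obtain f0 where f0: "f0 \<in> borel_measurable borel" "AE x in lborel. f x = f0 x" using borel_representative[OF L0(1)] .
  obtain g0 where g0: "g0 \<in> borel_measurable borel" "AE x in lborel. g x = g0 x" using borel_representative[OF L0(2)] .
  obtain g1 where g1: "g1 \<in> borel_measurable borel" "AE x in lborel. g' x = g1 x" using borel_representative[OF L0(3)] .
  note [measurable] = g0(1) g1(1)
  have li: "locally_integrable g0" "locally_integrable g1"
    using locally_integrable_representative L1 g0 g1 by blast+
  obtain "is" where "is": "count_list is = \<alpha>"
  proof -
    have "\<alpha> \<in> multi_indices (\<Sum>i\<in>UNIV. \<alpha> i)" by (simp add: multi_indices_def)
    then show thesis using that by (auto simp: multi_indices_eq)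
  qed
  have "AE x in lborel. g0 x - g1 x = 0"
  proof (rule AE_eq_0_if_integral_bump_eq_0)
    show "integrable lborel (\<lambda>x. (g0 x - g1 x) * indicator (box a b) x)" for a b
      using Bochner_Integration.integrable_diff[OF locally_integrable_box[OF li(1), of a b] locally_integrable_box[OF li(2), of a b]]
      by (simp add: left_diff_distrib)
    show "(LINT x|lborel. (g0 x - g1 x) * bump m a b x) = 0" for m a b
    proof -
      obtain R where R: "box a b \<subseteq> cball 0 R" using box_subset_cball_0[of a b] by auto
      have \<psi>: "\<bar>bump m a b y\<bar> \<le> 1 * indicator (cball 0 R) y" for y
        using bump_bounds[of m a b y] bump_eq_0[of y a b m] subsetD[OF R, of y]
        by (cases "y \<in> box a b") (auto simp: indicator_def)
      have "(LINT x|lborel. (g0 x - g1 x) * bump m a b x) = (LINT x|lborel. g0 x * bump m a b x) - (LINT x|lborel. g1 x * bump m a b x)"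
        unfolding left_diff_distrib
        by (intro Bochner_Integration.integral_diff locally_integrable_mult_integrable[OF _ _ \<psi>] li measurable_bump)
      then show ?thesis
        using weak_deriv_bump[OF g "is" f0 g0, of m a b] weak_deriv_bump[OF g' "is" f0 g1, of m a b] by simp
    qed
  qed measurable
  with g0(2) g1(2) have "AE x in lborel. g x = g' x" by eventually_elim simp
  then show ?thesis by (simp add: AE_lebesgue_iff)
qed

lemma weak_deriv_works: "has_weak_deriv f \<alpha> g \<Longrightarrow> has_weak_deriv f \<alpha> (weak_deriv \<alpha> f)"
  unfolding weak_deriv_def by (rule someI[where P="has_weak_deriv f \<alpha>"])

section \<open>Consequences of the axioms of ball Banach function spaces\<close>

lemma BBF_mono:
  assumes "BBF N" "f \<in> L0" "g \<in> L0" "AE x in lebesgue. \<bar>g x\<bar> \<le> \<bar>f x\<bar>"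
  shows "N g \<le> N f"
proof -
  have "\<forall>f\<in>L0. \<forall>g\<in>L0. (AE x in lebesgue. \<bar>g x\<bar> \<le> \<bar>f x\<bar>) \<longrightarrow> N g \<le> N f"
    using assms(1) unfolding BBF_def by blast
  then show ?thesis using assms by blast
qed

lemma BBF_scale:
  assumes "BBF N" "f \<in> L0" shows "N (\<lambda>x. c * f x) = ennreal \<bar>c\<bar> * N f"
proof -
  have "\<forall>f\<in>L0. \<forall>c::real. N (\<lambda>x. c * f x) = ennreal \<bar>c\<bar> * N f"
    using assms(1) unfolding BBF_def banach_norm_def by blast
  then show ?thesis using assms by blast
qed

lemma BBF_triangle:
  assumes "BBF N" "f \<in> L0" "g \<in> L0" shows "N (\<lambda>x. f x + g x) \<le> N f + N g"
proof -
  have "\<forall>f\<in>L0. \<forall>g\<in>L0. N (\<lambda>x. f x + g x) \<le> N f + N g"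
    using assms(1) unfolding BBF_def banach_norm_def by blast
  then show ?thesis using assms by blast
qed

lemma bf_space_AE_cong:
  assumes "BBF N" "f \<in> bf_space N" "g \<in> L0" "AE x in lebesgue. f x = g x"
  shows "g \<in> bf_space N"
proof -
  have "AE x in lebesgue. \<bar>g x\<bar> \<le> \<bar>f x\<bar>" using assms(4) by eventually_elim simp
  then show ?thesis
    using BBF_mono[OF assms(1), of f g] assms(2,3) by (auto simp: bf_space_def intro: le_less_trans)
qed

lemma bf_space_sum:
  fixes N :: "(real^'n::finite \<Rightarrow> real) \<Rightarrow> ennreal"
  assumes N: "BBF N"
  shows "finite I \<Longrightarrow> (\<And>i. i \<in> I \<Longrightarrow> f i \<in> bf_space N) \<Longrightarrow> (\<lambda>x. \<Sum>i\<in>I. f i x) \<in> bf_space N"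
proof (induction I rule: finite_induct)
  case empty
  have "(\<lambda>x::real^'n. 0::real) \<in> L0" by (simp add: L0_def)
  then show ?case using BBF_scale[OF N, of "\<lambda>x. 0" 0] by (simp add: bf_space_def)
next
  case (insert i I)
  then have L: "f i \<in> bf_space N" "(\<lambda>x. \<Sum>i\<in>I. f i x) \<in> bf_space N" by auto
  then have "(\<lambda>x. f i x + (\<Sum>i\<in>I. f i x)) \<in> L0" by (auto simp: bf_space_def L0_def)
  moreover have "N (\<lambda>x. f i x + (\<Sum>i\<in>I. f i x)) \<le> N (f i) + N (\<lambda>x. \<Sum>i\<in>I. f i x)"
    using L by (intro BBF_triangle[OF N]) (auto simp: bf_space_def)
  moreover have "N (f i) + N (\<lambda>x. \<Sum>i\<in>I. f i x) < top" using L by (auto simp: bf_space_def)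
  ultimately show ?case using insert by (simp add: bf_space_def le_less_trans)
qed

lemma bf_space_abs:
  assumes N: "BBF N" "f \<in> bf_space N" shows "(\<lambda>x. \<bar>f x\<bar>) \<in> bf_space N"
proof -
  have "f \<in> L0" "(\<lambda>x. \<bar>f x\<bar>) \<in> L0" using N(2) by (auto simp: bf_space_def L0_def)
  with N BBF_mono[OF N(1), of f "\<lambda>x. \<bar>f x\<bar>"] show ?thesis by (auto simp: bf_space_def intro: le_less_trans)
qed

text \<open>Membership in \<open>hom_sobolev\<close> provides some weak derivative in
  \<open>Y\<close>. The chosen one agrees with it almost everywhere and so inherits the finite
  norm.\<close>

lemma hom_sobolev_weak_deriv:
  assumes "BBF Y" "f \<in> hom_sobolev k Y" "\<alpha> \<in> multi_indices k"
  shows "has_weak_deriv f \<alpha> (weak_deriv \<alpha> f)" "weak_deriv \<alpha> f \<in> bf_space Y"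
proof -
  obtain g where g: "g \<in> bf_space Y" "has_weak_deriv f \<alpha> g"
    using assms by (auto simp: hom_sobolev_def)
  then show w: "has_weak_deriv f \<alpha> (weak_deriv \<alpha> f)" by (auto intro: weak_deriv_works)
  show "weak_deriv \<alpha> f \<in> bf_space Y"
    using bf_space_AE_cong[OF assms(1) g(1) _ has_weak_deriv_unique[OF g(2) w]] w
    by (auto simp: has_weak_deriv_def L1_loc_def)
qed

text \<open>The Euclidean norm is dominated by the sum of absolute values, to which the triangle
  inequality in \<open>Y\<close> applies.\<close>

lemma grad_norm_bf_space:
  assumes Y: "BBF Y" and f: "f \<in> hom_sobolev k Y"
  shows "grad_norm k f \<in> bf_space Y"
proof -
  let ?S = "\<lambda>x. \<Sum>\<alpha>\<in>multi_indices k. \<bar>weak_deriv \<alpha> f x\<bar>"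
  have S: "?S \<in> bf_space Y"
    by (intro bf_space_sum[OF Y] bf_space_abs[OF Y] hom_sobolev_weak_deriv(2)[OF Y f]) auto
  have m: "weak_deriv \<alpha> f \<in> borel_measurable lebesgue" if "\<alpha> \<in> multi_indices k" for \<alpha>
    using hom_sobolev_weak_deriv(2)[OF Y f that] by (simp add: bf_space_def L0_def)
  then have "grad_norm k f \<in> L0"
    unfolding L0_def grad_norm_def[abs_def] by measurable
  moreover have "\<bar>grad_norm k f x\<bar> \<le> \<bar>?S x\<bar>" for x
    using L2_set_le_sum_abs[of "\<lambda>\<alpha>. weak_deriv \<alpha> f x" "multi_indices k"]
    by (simp add: grad_norm_def L2_set_def sum_nonneg)
  ultimately show ?thesis
    using BBF_mono[OF Y, of ?S "grad_norm k f"] S by (auto simp: bf_space_def intro: le_less_trans)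
qed

text \<open>What the later estimates use of the Sobolev hypothesis: one Borel function
  \<open>g\<close> serves all steps \<open>h\<close>, although the exceptional null set of points
  may depend on \<open>h\<close>.\<close>

lemma hom_sobolev_fin_diff_le:
  fixes f f0 :: "real^'n::finite \<Rightarrow> real"
  assumes Y: "BBF Y" and k: "1 \<le> k" and f: "f \<in> hom_sobolev k Y"
    and f0: "f0 \<in> borel_measurable borel" "AE x in lborel. f x = f0 x"
  obtains g where "g \<in> borel_measurable borel" "\<And>x. 0 \<le> g x" "AE x in lborel. grad_norm k f x = g x"
    "\<And>h. AE y in lborel. ennreal \<bar>fin_diff k h f0 y\<bar> \<le> ennreal ((2 * real CARD('n)) ^ k * norm h ^ k) * segment_mean k g h y"
proof -
  have wd: "has_weak_deriv f \<alpha> (weak_deriv \<alpha> f)" if "\<alpha> \<in> multi_indices k" for \<alpha>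
    by (rule hom_sobolev_weak_deriv[OF Y f that])
  have "\<exists>w. w \<in> borel_measurable borel \<and> (AE x in lborel. weak_deriv \<alpha> f x = w x)" if "\<alpha> \<in> multi_indices k" for \<alpha>
  proof -
    have "weak_deriv \<alpha> f \<in> L0" using wd[OF that] by (simp add: has_weak_deriv_def L1_loc_def)
    from borel_representative[OF this] show ?thesis by metis
  qed
  then obtain W where W: "\<And>\<alpha>. \<alpha> \<in> multi_indices k \<Longrightarrow> W \<alpha> \<in> borel_measurable borel"
    "\<And>\<alpha>. \<alpha> \<in> multi_indices k \<Longrightarrow> AE x in lborel. weak_deriv \<alpha> f x = W \<alpha> x"
    by metis
  define g where "g x = sqrt (\<Sum>\<alpha>\<in>multi_indices k. (W \<alpha> x)\<^sup>2)" for x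
  have gm: "g \<in> borel_measurable borel" unfolding g_def[abs_def] using W(1) by measurable
  show ?thesis
  proof (rule that[OF gm])
    show "0 \<le> g x" for x by (simp add: g_def sum_nonneg)
    have "AE x in lborel. \<forall>\<alpha>\<in>multi_indices k. weak_deriv \<alpha> f x = W \<alpha> x"
      using W(2) by (intro AE_finite_allI) auto
    then show "AE x in lborel. grad_norm k f x = g x"
      by eventually_elim (simp add: grad_norm_def g_def)
    fix h :: "real^'n"
    show "AE y in lborel. ennreal \<bar>fin_diff k h f0 y\<bar> \<le> ennreal ((2 * real CARD('n)) ^ k * norm h ^ k) * segment_mean k g h y"
    proof (rule AE_fin_diff_le_segment_mean[where W=W])
      show "locally_integrable f0"
        using f f0 by (intro locally_integrable_representative[of f]) (auto simp: hom_sobolev_def)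
      show "locally_integrable (W \<alpha>)" if "\<alpha> \<in> multi_indices k" for \<alpha>
        using wd[OF that] W that by (intro locally_integrable_representative[of "weak_deriv \<alpha> f"]) (auto simp: has_weak_deriv_def)
      show "\<bar>W \<alpha> x\<bar> \<le> g x" if "\<alpha> \<in> multi_indices k" for \<alpha> x
      proof -
        have "(W \<alpha> x)\<^sup>2 \<le> (\<Sum>\<alpha>\<in>multi_indices k. (W \<alpha> x)\<^sup>2)" using that by (intro member_le_sum) auto
        then have "sqrt ((W \<alpha> x)\<^sup>2) \<le> g x" unfolding g_def by (rule real_sqrt_le_mono)
        then show ?thesis by simp
      qed
      fix m a b and "is" :: "'n list" assume len: "length is = k"
      then have "count_list is \<in> multi_indices k" by (auto simp: multi_indices_eq)
      from weak_deriv_bump[OF wd[OF this] refl f0 W(1)[OF this] W(2)[OF this]] len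
      show "(LINT x|lborel. f0 x * partials is (bump m a b) x) = (-1) ^ k * (LINT x|lborel. W (count_list is) x * bump m a b x)"
        by simp
    qed (use k gm in auto)
  qed
qed

section \<open>Pointwise estimates at a fixed point\<close>

interpretation unif_ball_pair: pair_sigma_finite "unif_ball :: 'a::euclidean_space measure" "unif_ball :: 'b::euclidean_space measure"
  by (intro pair_sigma_finite.intro unif_ball.sigma_finite_measure_axioms)
interpretation lborel_unif_ball: pair_sigma_finite "lborel :: 'a::euclidean_space measure" "unif_ball :: 'b::euclidean_space measure"
  by (intro pair_sigma_finite.intro unif_ball.sigma_finite_measure_axioms sigma_finite_lborel)

lemma measurable_fin_diff_compose [measurable (raw)]:
  assumes [measurable]: "f \<in> borel_measurable borel" "u \<in> borel_measurable M" "v \<in> borel_measurable M"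
  shows "(\<lambda>z. fin_diff k (u z) f (v z)) \<in> borel_measurable M"
  unfolding fin_diff_def by measurable

text \<open>The difference with step \<open>h\<close> of the difference with step \<open>w\<close>,
  expanded in either order. In both expansions the term with index 0 has coefficient plus or minus 1
  and stays at \<open>x\<close>; all others sit at shifted points.\<close>

lemma abs_fin_diff_exchange:
  fixes f :: "real^'n::finite \<Rightarrow> real"
  shows "\<bar>fin_diff k w f x\<bar> \<le> \<bar>fin_diff k h f x\<bar>
    + (\<Sum>j\<in>{1..k}. real (k choose j) * (\<bar>fin_diff k w f (x + real j *\<^sub>R h)\<bar> + \<bar>fin_diff k h f (x + real j *\<^sub>R w)\<bar>))"
proof -
  define c where "c j = (-1) ^ (k - j) * real (k choose j)" for j
  have split: "(\<Sum>j\<le>k. c j * p j) = c 0 * p 0 + (\<Sum>j\<in>{1..k}. c j * p j)" for p :: "nat \<Rightarrow> real"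
  proof -
    have "{..k} = insert 0 {1..k}" by auto
    then show ?thesis by simp
  qed
  have "(\<Sum>j\<le>k. c j * fin_diff k w f (x + real j *\<^sub>R h)) = (\<Sum>j\<le>k. \<Sum>i\<le>k. c j * (c i * f (x + real j *\<^sub>R h + real i *\<^sub>R w)))"
    by (simp add: fin_diff_def c_def sum_distrib_left)
  also have "\<dots> = (\<Sum>i\<le>k. \<Sum>j\<le>k. c j * (c i * f (x + real j *\<^sub>R h + real i *\<^sub>R w)))" by (rule sum.swap)
  also have "\<dots> = (\<Sum>i\<le>k. c i * fin_diff k h f (x + real i *\<^sub>R w))"
    unfolding fin_diff_def c_def[symmetric] sum_distrib_left
    by (intro sum.cong refl) (simp add: mult.left_commute add_ac)
  finally have "c 0 * fin_diff k w f x + (\<Sum>j\<in>{1..k}. c j * fin_diff k w f (x + real j *\<^sub>R h))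
      = c 0 * fin_diff k h f x + (\<Sum>j\<in>{1..k}. c j * fin_diff k h f (x + real j *\<^sub>R w))"
    unfolding split by simp
  then have eq: "c 0 * fin_diff k w f x = c 0 * fin_diff k h f x + (\<Sum>j\<in>{1..k}. c j * fin_diff k h f (x + real j *\<^sub>R w))
      - (\<Sum>j\<in>{1..k}. c j * fin_diff k w f (x + real j *\<^sub>R h))" by simp
  have c0: "\<bar>c 0 * p\<bar> = \<bar>p\<bar>" for p by (simp add: c_def abs_mult power_abs)
  have cs: "\<bar>\<Sum>j\<in>{1..k}. c j * p j\<bar> \<le> (\<Sum>j\<in>{1..k}. real (k choose j) * \<bar>p j\<bar>)" for p :: "nat \<Rightarrow> real"
    by (rule order_trans[OF sum_abs]) (auto simp: c_def abs_mult power_abs)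
  have "\<bar>fin_diff k w f x\<bar> \<le> \<bar>fin_diff k h f x\<bar> + (\<Sum>j\<in>{1..k}. real (k choose j) * \<bar>fin_diff k h f (x + real j *\<^sub>R w)\<bar>)
      + (\<Sum>j\<in>{1..k}. real (k choose j) * \<bar>fin_diff k w f (x + real j *\<^sub>R h)\<bar>)"
    using arg_cong[OF eq, of abs] cs[of "\<lambda>j. fin_diff k h f (x + real j *\<^sub>R w)"] cs[of "\<lambda>j. fin_diff k w f (x + real j *\<^sub>R h)"]
      c0[of "fin_diff k w f x"] c0[of "fin_diff k h f x"] by linarith
  then show ?thesis by (simp add: distrib_left sum.distrib)
qed

lemma sum_ennreal_binomial_le:
  assumes "\<And>j. j \<in> {1..k} \<Longrightarrow> p j \<le> ennreal B" "0 \<le> B"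
  shows "(\<Sum>j\<in>{1..k}. ennreal (real (k choose j)) * p j) \<le> ennreal (2 ^ k * B)"
proof -
  have "(\<Sum>j\<in>{1..k}. real (k choose j)) \<le> (\<Sum>j\<le>k. real (k choose j))"
    by (rule sum_mono2) auto
  also have "\<dots> = 2 ^ k" using choose_row_sum[of k] by (simp add: of_nat_sum[symmetric] del: of_nat_sum)
  finally have b: "(\<Sum>j\<in>{1..k}. real (k choose j)) \<le> 2 ^ k" .
  have "(\<Sum>j\<in>{1..k}. ennreal (real (k choose j)) * p j) \<le> (\<Sum>j\<in>{1..k}. ennreal (real (k choose j)) * ennreal B)"
    by (intro sum_mono mult_left_mono assms) auto
  also have "\<dots> = ennreal ((\<Sum>j\<in>{1..k}. real (k choose j)) * B)"
    using assms(2) by (simp add: sum_distrib_right[symmetric] sum_ennreal ennreal_mult[symmetric] sum_nonneg)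
  also have "\<dots> \<le> ennreal (2 ^ k * B)" using b assms(2) by (intro ennreal_leI mult_right_mono)
  finally show ?thesis .
qed

text \<open>\<open>G\<close> bounds a maximal function of \<open>g\<close> and \<open>F\<close> a sharp maximal function of \<open>f\<close> at the point \<open>x\<close>.
  The constants in the estimates may depend on \<open>k\<close>, \<open>K\<close>, \<open>r\<close> and the exponents, but not on \<open>f\<close>, \<open>g\<close>, \<open>x\<close>, \<open>F\<close>, \<open>G\<close>,
  which is why they are defined outside the locale.\<close>

locale pointwise_data =
  fixes f g :: "real^'n::finite \<Rightarrow> real" and k :: nat and K F G r :: real and x :: "real^'n"
  assumes f_measurable [measurable]: "f \<in> borel_measurable borel"
    and g_measurable [measurable]: "g \<in> borel_measurable borel" and g_nonneg: "\<And>y. 0 \<le> g y"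
    and k: "1 \<le> k" and K: "0 < K"
    and diff_le: "\<And>h. AE y in lborel. ennreal \<bar>fin_diff k h f y\<bar> \<le> ennreal (K * norm h ^ k) * segment_mean k g h y"
    and diff_le_x: "AE h in lborel. ennreal \<bar>fin_diff k h f x\<bar> \<le> ennreal (K * norm h ^ k) * segment_mean k g h x"
    and r: "1 \<le> r" and G: "0 < G" and F: "0 < F"
    and mean_g: "\<And>R. 0 < R \<Longrightarrow> (\<integral>\<^sup>+w. ennreal (g (x + R *\<^sub>R w) powr r) \<partial>unif_ball) \<le> ennreal (G powr r)"
    and mean_f: "\<And>R. 0 < R \<Longrightarrow> \<exists>c. (\<integral>\<^sup>+w. ennreal \<bar>f (x + R *\<^sub>R w) - c\<bar> \<partial>unif_ball) \<le> ennreal F"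
begin

section \<open>Means of differences and of the gradient\<close>

abbreviation d :: "real^'n \<Rightarrow> real^'n \<Rightarrow> ennreal" where "d h y \<equiv> ennreal \<bar>fin_diff k h f y\<bar>"

definition mean_diff :: "real^'n \<Rightarrow> real \<Rightarrow> ennreal" where
  "mean_diff y \<rho> = (\<integral>\<^sup>+w. d (\<rho> *\<^sub>R w) y \<partial>unif_ball)"

definition kern :: "real \<Rightarrow> ennreal" where
  "kern t = ennreal (indicator {0<..real k} t * t ^ (k - 1))"

text \<open>The average of \<open>segment_mean\<close> over steps of size \<rho> with the
  integrations exchanged, so that ball means of \<open>g\<close> around \<open>y\<close> become
  visible.\<close>

definition kernel_mean :: "real^'n \<Rightarrow> real \<Rightarrow> ennreal" where
  "kernel_mean y \<rho> = (\<integral>\<^sup>+t. kern t * (\<integral>\<^sup>+w. ennreal (g (y + (t * \<rho>) *\<^sub>R w)) \<partial>unif_ball) \<partial>lborel)"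

lemma measurable_kern [measurable]: "kern \<in> borel_measurable borel"
  unfolding kern_def[abs_def] by measurable

lemma measurable_mean_diff [measurable (raw)]:
  assumes [measurable]: "u \<in> borel_measurable M"
  shows "(\<lambda>z. mean_diff (u z) \<rho>) \<in> borel_measurable M"
  unfolding mean_diff_def by measurable

lemma measurable_kernel_mean [measurable (raw)]:
  assumes [measurable]: "u \<in> borel_measurable M"
  shows "(\<lambda>z. kernel_mean (u z) \<rho>) \<in> borel_measurable M"
  unfolding kernel_mean_def by measurable

lemma segment_mean_kern: "segment_mean k g h y = (\<integral>\<^sup>+t. kern t * ennreal (g (y + t *\<^sub>R h)) \<partial>lborel)"
  by (simp add: segment_mean_def kern_def)

lemma measurable_segment_mean [measurable (raw)]:
  assumes [measurable]: "u \<in> borel_measurable M" "v \<in> borel_measurable M"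
  shows "(\<lambda>z. segment_mean k g (u z) (v z)) \<in> borel_measurable M"
  unfolding segment_mean_kern by measurable

lemma k_pos: "0 < real k" using k by simp

lemma nn_integral_kern_le:
  assumes "\<And>t. t \<in> {0<..real k} \<Longrightarrow> p t \<le> ennreal c" "0 \<le> c"
  shows "(\<integral>\<^sup>+t. kern t * p t \<partial>lborel) \<le> ennreal (real k ^ k * c)"
proof -
  have "(\<integral>\<^sup>+t. kern t * p t \<partial>lborel) \<le> (\<integral>\<^sup>+t. ennreal (real k ^ (k - 1) * c) * indicator {0<..real k} t \<partial>lborel)"
  proof (intro nn_integral_mono)
    fix t
    show "kern t * p t \<le> ennreal (real k ^ (k - 1) * c) * indicator {0<..real k} t"
    proof (cases "t \<in> {0<..real k}")
      case True
      have "kern t * p t \<le> ennreal (real k ^ (k - 1)) * ennreal c"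
        using True by (intro mult_mono assms) (auto simp: kern_def intro!: ennreal_leI power_mono)
      then show ?thesis using True assms by (simp add: ennreal_mult)
    qed (simp add: kern_def)
  qed
  also have "\<dots> = ennreal (real k ^ (k - 1) * c) * ennreal (real k)"
    by (subst nn_integral_cmult_indicator) auto
  also have "\<dots> = ennreal (real k ^ k * c)"
  proof -
    have e: "real k ^ (k - 1) * real k = real k ^ k" using k by (cases k) auto
    have "real k ^ (k - 1) * c * real k = real k ^ k * c" unfolding e[symmetric] by (simp only: mult_ac)
    then show ?thesis using assms by (subst ennreal_mult[symmetric]) auto
  qed
  finally show ?thesis .
qed

text \<open>The linear inequality at level \<open>G\<close> replaces Jensen's inequality, and its
  two terms each contribute \<open>G\<close>.\<close>

lemma mean_g_1:
  assumes "0 < R"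
  shows "(\<integral>\<^sup>+w. ennreal (g (x + R *\<^sub>R w)) \<partial>unif_ball) \<le> ennreal (2 * G)"
proof -
  have "(\<integral>\<^sup>+w. ennreal (g (x + R *\<^sub>R w)) \<partial>unif_ball)
      \<le> (\<integral>\<^sup>+w. ennreal G + ennreal (G powr (1 - r)) * ennreal (g (x + R *\<^sub>R w) powr r) \<partial>unif_ball)"
  proof (intro nn_integral_mono)
    fix w
    show "ennreal (g (x + R *\<^sub>R w)) \<le> ennreal G + ennreal (G powr (1 - r)) * ennreal (g (x + R *\<^sub>R w) powr r)"
      using ennreal_le_const_powr[OF G r, of "ennreal (g (x + R *\<^sub>R w))"] g_nonneg by simp
  qed
  also have "\<dots> = ennreal G + ennreal (G powr (1 - r)) * (\<integral>\<^sup>+w. ennreal (g (x + R *\<^sub>R w) powr r) \<partial>unif_ball)"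
    by (simp add: nn_integral_add nn_integral_cmult)
  also have "\<dots> \<le> ennreal G + ennreal (G powr (1 - r)) * ennreal (G powr r)"
    by (intro add_left_mono mult_left_mono mean_g assms) simp
  also have "\<dots> = ennreal (2 * G)"
    using G by (simp add: ennreal_mult[symmetric] powr_add[symmetric] ennreal_plus[symmetric] del: ennreal_plus)
  finally show ?thesis .
qed

lemma nn_integral_segment_mean:
  "(\<integral>\<^sup>+w. segment_mean k g (\<rho> *\<^sub>R w) y \<partial>unif_ball) = kernel_mean y \<rho>"
proof -
  have "(\<integral>\<^sup>+w. segment_mean k g (\<rho> *\<^sub>R w) y \<partial>unif_ball)
      = (\<integral>\<^sup>+w. (\<integral>\<^sup>+t. kern t * ennreal (g (y + (t * \<rho>) *\<^sub>R w)) \<partial>lborel) \<partial>unif_ball)"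
    by (simp add: segment_mean_kern)
  also have "\<dots> = (\<integral>\<^sup>+t. (\<integral>\<^sup>+w. kern t * ennreal (g (y + (t * \<rho>) *\<^sub>R w)) \<partial>unif_ball) \<partial>lborel)"
    by (rule lborel_unif_ball.Fubini') measurable
  also have "\<dots> = kernel_mean y \<rho>"
    by (simp add: kernel_mean_def nn_integral_cmult)
  finally show ?thesis .
qed

lemma mean_diff_le_kernel_mean_aux:
  assumes \<rho>: "0 < \<rho>" and ae: "AE w in unif_ball. d (\<rho> *\<^sub>R w) y \<le> ennreal (K * norm (\<rho> *\<^sub>R w) ^ k) * segment_mean k g (\<rho> *\<^sub>R w) y"
  shows "mean_diff y \<rho> \<le> ennreal (K * \<rho> ^ k) * kernel_mean y \<rho>"
proof -
  have "mean_diff y \<rho> \<le> (\<integral>\<^sup>+w. ennreal (K * \<rho> ^ k) * segment_mean k g (\<rho> *\<^sub>R w) y \<partial>unif_ball)"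
    unfolding mean_diff_def
  proof (rule nn_integral_mono_AE)
    show "AE w in unif_ball. d (\<rho> *\<^sub>R w) y \<le> ennreal (K * \<rho> ^ k) * segment_mean k g (\<rho> *\<^sub>R w) y"
      using ae AE_unif_ball_norm
    proof eventually_elim
      case (elim w)
      have "norm (\<rho> *\<^sub>R w) ^ k \<le> \<rho> ^ k"
        using elim(2) \<rho> by (intro power_mono) (auto intro: mult_left_le)
      then have "ennreal (K * norm (\<rho> *\<^sub>R w) ^ k) * segment_mean k g (\<rho> *\<^sub>R w) y \<le> ennreal (K * \<rho> ^ k) * segment_mean k g (\<rho> *\<^sub>R w) y"
        using K by (intro mult_right_mono ennreal_leI mult_left_mono) auto
      then show ?case using elim(1) by (rule order_trans[rotated])
    qed
  qed
  also have "\<dots> = ennreal (K * \<rho> ^ k) * kernel_mean y \<rho>"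
    by (simp add: nn_integral_cmult nn_integral_segment_mean)
  finally show ?thesis .
qed

text \<open>A statement about almost every \<open>y\<close> says nothing about the fixed point
  \<open>x\<close>; this is the reason for the separate assumption \<open>diff_le_x\<close>.\<close>

lemma mean_diff_x_le:
  assumes \<rho>: "0 < \<rho>"
  shows "mean_diff x \<rho> \<le> ennreal (2 * K * real k ^ k * (\<rho> ^ k * G))"
proof -
  have "AE w in lborel. d (0 + \<rho> *\<^sub>R w) x \<le> ennreal (K * norm (0 + \<rho> *\<^sub>R w) ^ k) * segment_mean k g (0 + \<rho> *\<^sub>R w) x"
    using \<rho> by (intro AE_lborel_affine[OF diff_le_x]) auto
  then have "mean_diff x \<rho> \<le> ennreal (K * \<rho> ^ k) * kernel_mean x \<rho>"
    by (intro mean_diff_le_kernel_mean_aux[OF \<rho>] AE_unif_ballI) simp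
  also have "\<dots> \<le> ennreal (K * \<rho> ^ k) * ennreal (real k ^ k * (2 * G))"
    unfolding kernel_mean_def using \<rho> G by (intro mult_left_mono nn_integral_kern_le mean_g_1) auto
  finally show ?thesis
    using K \<rho> G by (simp add: ennreal_mult[symmetric] mult_ac)
qed

text \<open>\<open>diff_le\<close> has an exceptional set of points for each step. Fubini for null
  sets exchanges the quantifiers: almost every point is good for almost all steps.\<close>

lemma AE_mean_diff_le_kernel_mean:
  assumes \<rho>: "0 < \<rho>"
  shows "AE y in lborel. mean_diff y \<rho> \<le> ennreal (K * \<rho> ^ k) * kernel_mean y \<rho>"
proof -
  let ?P = "\<lambda>y w. d (\<rho> *\<^sub>R w) y \<le> ennreal (K * norm (\<rho> *\<^sub>R w) ^ k) * segment_mean k g (\<rho> *\<^sub>R w) y"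
  have "AE w in unif_ball. AE y in lborel. ?P y w" by (intro AE_I2 diff_le)
  moreover have "{p \<in> space (lborel \<Otimes>\<^sub>M unif_ball). ?P (fst p) (snd p)} \<in> sets (lborel \<Otimes>\<^sub>M (unif_ball :: (real^'n) measure))"
    by measurable
  ultimately have "AE y in lborel. AE w in unif_ball. ?P y w"
    by (rule iffD2[OF lborel_unif_ball.AE_commute, rotated])
  then show ?thesis
    by eventually_elim (rule mean_diff_le_kernel_mean_aux[OF \<rho>])
qed

text \<open>The segments start in the ball of radius \<open>k \<rho>\<close> around \<open>x\<close>
  and have length at most \<open>k \<rho>\<close>, so they stay in the ball of twice the radius.
  This gives \<open>2 ^ CARD('n)\<close>; the other 2 comes from \<open>mean_g_1\<close>.\<close>

lemma mean_diff_translate_le_G: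
  assumes \<rho>: "0 < \<rho>" and h: "norm h \<le> \<rho>"
  shows "(\<integral>\<^sup>+v. d h (x + (real k * \<rho>) *\<^sub>R v) \<partial>unif_ball) \<le> ennreal (2 * 2 ^ CARD('n) * K * real k ^ k * (\<rho> ^ k * G))"
proof -
  have "AE v in lborel. d h (x + (real k * \<rho>) *\<^sub>R v) \<le> ennreal (K * norm h ^ k) * segment_mean k g h (x + (real k * \<rho>) *\<^sub>R v)"
    using \<rho> k by (intro AE_lborel_affine[OF diff_le]) auto
  then have ae: "AE v in unif_ball. d h (x + (real k * \<rho>) *\<^sub>R v) \<le> ennreal (K * norm h ^ k) * segment_mean k g h (x + (real k * \<rho>) *\<^sub>R v)"
    by (rule AE_unif_ballI)
  have "(\<integral>\<^sup>+v. segment_mean k g h (x + (real k * \<rho>) *\<^sub>R v) \<partial>unif_ball)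
      = (\<integral>\<^sup>+t. (\<integral>\<^sup>+v. kern t * ennreal (g (x + (real k * \<rho>) *\<^sub>R v + t *\<^sub>R h)) \<partial>unif_ball) \<partial>lborel)"
    unfolding segment_mean_kern by (rule lborel_unif_ball.Fubini') measurable
  also have "\<dots> = (\<integral>\<^sup>+t. kern t * (\<integral>\<^sup>+v. ennreal (g (x + t *\<^sub>R h + (real k * \<rho>) *\<^sub>R v)) \<partial>unif_ball) \<partial>lborel)"
    by (simp add: nn_integral_cmult add_ac)
  also have "\<dots> \<le> ennreal (real k ^ k * (2 ^ CARD('n) * (2 * G)))"
  proof (intro nn_integral_kern_le)
    fix t assume t: "t \<in> {0<..real k}"
    have "t * norm h \<le> real k * \<rho>" using t h by (intro mult_mono) auto
    then have "norm (x + t *\<^sub>R h - x) + real k * \<rho> \<le> 2 * (real k * \<rho>)"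
      using t by (simp add: mult.commute)
    then have "(\<integral>\<^sup>+v. ennreal (g (x + t *\<^sub>R h + (real k * \<rho>) *\<^sub>R v)) \<partial>unif_ball)
        \<le> ennreal ((2 * (real k * \<rho>) / (real k * \<rho>)) ^ DIM(real^'n)) * (\<integral>\<^sup>+v. ennreal (g (x + (2 * (real k * \<rho>)) *\<^sub>R v)) \<partial>unif_ball)"
      using \<rho> k by (intro nn_integral_unif_ball_mono_ball) auto
    also have "\<dots> \<le> ennreal (2 ^ CARD('n)) * ennreal (2 * G)"
      using \<rho> k by (intro mult_mono mean_g_1) auto
    finally show "(\<integral>\<^sup>+v. ennreal (g (x + t *\<^sub>R h + (real k * \<rho>) *\<^sub>R v)) \<partial>unif_ball) \<le> ennreal (2 ^ CARD('n) * (2 * G))"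
      using G by (simp add: ennreal_mult)
  qed (use G in simp)
  finally have s: "(\<integral>\<^sup>+v. segment_mean k g h (x + (real k * \<rho>) *\<^sub>R v) \<partial>unif_ball) \<le> ennreal (real k ^ k * (2 ^ CARD('n) * (2 * G)))" .
  have "(\<integral>\<^sup>+v. d h (x + (real k * \<rho>) *\<^sub>R v) \<partial>unif_ball)
      \<le> ennreal (K * norm h ^ k) * (\<integral>\<^sup>+v. segment_mean k g h (x + (real k * \<rho>) *\<^sub>R v) \<partial>unif_ball)"
    using nn_integral_mono_AE[OF ae] by (simp add: nn_integral_cmult)
  also have "\<dots> \<le> ennreal (K * \<rho> ^ k) * ennreal (real k ^ k * (2 ^ CARD('n) * (2 * G)))"
    using K h by (intro mult_mono s ennreal_leI mult_left_mono power_mono) auto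
  finally show ?thesis using K \<rho> G by (simp add: ennreal_mult[symmetric] mult_ac)
qed

text \<open>The coefficients of a difference of order \<open>k \<ge> 1\<close> add up to 0, so
  \<open>f\<close> may be replaced by \<open>f - c\<close> with the constant that
  \<open>mean_f\<close> provides for the ball of radius \<open>2 k \<rho>\<close>.\<close>

lemma mean_diff_translate_le_F:
  assumes \<rho>: "0 < \<rho>" and h: "norm h \<le> \<rho>"
  shows "(\<integral>\<^sup>+v. d h (x + (real k * \<rho>) *\<^sub>R v) \<partial>unif_ball) \<le> ennreal (2 * 2 ^ k * 2 ^ CARD('n) * F)"
proof -
  obtain c where c: "(\<integral>\<^sup>+w. ennreal \<bar>f (x + (2 * (real k * \<rho>)) *\<^sub>R w) - c\<bar> \<partial>unif_ball) \<le> ennreal F"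
    using mean_f[of "2 * (real k * \<rho>)"] \<rho> k by auto
  have "d h y \<le> (\<Sum>j\<le>k. ennreal (real (k choose j)) * ennreal \<bar>f (y + real j *\<^sub>R h) - c\<bar>)" for y
  proof -
    have "(\<Sum>j\<le>k. (-1) ^ (k - j) * real (k choose j)) = (\<Sum>i\<le>k. (-1) ^ i * real (k choose i) * real i ^ 0)"
      by (rule sum.reindex_bij_witness[where i="\<lambda>i. k - i" and j="\<lambda>i. k - i"])
        (auto simp: binomial_symmetric[symmetric])
    also have "\<dots> = 0" using k by (intro alternating_binomial_power_sum) auto
    finally have "fin_diff k h f y = (\<Sum>j\<le>k. (-1) ^ (k - j) * real (k choose j) * (f (y + real j *\<^sub>R h) - c))"
      by (simp add: fin_diff_def right_diff_distrib sum_subtractf sum_distrib_right[symmetric])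
    then have "\<bar>fin_diff k h f y\<bar> \<le> (\<Sum>j\<le>k. real (k choose j) * \<bar>f (y + real j *\<^sub>R h) - c\<bar>)"
      by (auto simp: abs_mult power_abs intro: order_trans[OF sum_abs])
    then show ?thesis
      by (simp add: ennreal_mult[symmetric] sum_ennreal ennreal_leI)
  qed
  then have "(\<integral>\<^sup>+v. d h (x + (real k * \<rho>) *\<^sub>R v) \<partial>unif_ball)
      \<le> (\<integral>\<^sup>+v. (\<Sum>j\<le>k. ennreal (real (k choose j)) * ennreal \<bar>f (x + (real k * \<rho>) *\<^sub>R v + real j *\<^sub>R h) - c\<bar>) \<partial>unif_ball)"
    by (intro nn_integral_mono)
  also have "\<dots> = (\<Sum>j\<le>k. ennreal (real (k choose j)) * (\<integral>\<^sup>+v. ennreal \<bar>f (x + real j *\<^sub>R h + (real k * \<rho>) *\<^sub>R v) - c\<bar> \<partial>unif_ball))"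
    by (simp add: nn_integral_sum nn_integral_cmult add_ac)
  also have "\<dots> \<le> (\<Sum>j\<le>k. ennreal (real (k choose j)) * ennreal (2 ^ CARD('n) * F))"
  proof (intro sum_mono mult_left_mono)
    fix j assume j: "j \<in> {..k}"
    have "real j * norm h \<le> real k * \<rho>" using j h by (intro mult_mono) auto
    then have "norm (x + real j *\<^sub>R h - x) + real k * \<rho> \<le> 2 * (real k * \<rho>)"
      by (simp add: mult.commute)
    then have "(\<integral>\<^sup>+v. ennreal \<bar>f (x + real j *\<^sub>R h + (real k * \<rho>) *\<^sub>R v) - c\<bar> \<partial>unif_ball)
        \<le> ennreal ((2 * (real k * \<rho>) / (real k * \<rho>)) ^ DIM(real^'n)) * (\<integral>\<^sup>+v. ennreal \<bar>f (x + (2 * (real k * \<rho>)) *\<^sub>R v) - c\<bar> \<partial>unif_ball)"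
      using \<rho> k by (intro nn_integral_unif_ball_mono_ball[where \<phi>="\<lambda>y. ennreal \<bar>f y - c\<bar>"]) auto
    also have "\<dots> \<le> ennreal (2 ^ CARD('n)) * ennreal F"
      using \<rho> k by (intro mult_mono c) auto
    finally show "(\<integral>\<^sup>+v. ennreal \<bar>f (x + real j *\<^sub>R h + (real k * \<rho>) *\<^sub>R v) - c\<bar> \<partial>unif_ball) \<le> ennreal (2 ^ CARD('n) * F)"
      using F by (simp add: ennreal_mult)
  qed simp
  also have "\<dots> = ennreal ((\<Sum>j\<le>k. real (k choose j)) * (2 ^ CARD('n) * F))"
    using F by (simp add: sum_distrib_right[symmetric] sum_ennreal ennreal_mult[symmetric] sum_nonneg)
  also have "(\<Sum>j\<le>k. real (k choose j)) = 2 ^ k" using choose_row_sum[of k] by (simp add: of_nat_sum[symmetric] del: of_nat_sum)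
  also have "ennreal (2 ^ k * (2 ^ CARD('n) * F)) \<le> ennreal (2 * 2 ^ k * 2 ^ CARD('n) * F)"
    using F by (intro ennreal_leI) simp
  finally show ?thesis .
qed

lemma d_exchange:
  "d w y \<le> d h y + (\<Sum>j\<in>{1..k}. ennreal (real (k choose j)) * (d w (y + real j *\<^sub>R h) + d h (y + real j *\<^sub>R w)))"
  using ennreal_leI[OF abs_fin_diff_exchange[of k w f y h]]
  by (simp add: sum_nonneg sum_ennreal ennreal_mult[symmetric] ennreal_plus[symmetric] del: ennreal_plus)

end

text \<open>The summands account, in \<open>mean_powr_d_le\<close>, for the mean difference at
  \<open>x\<close> (through \<open>a\<close>), for the averages of \<open>d h\<close> at shifted
  points (through \<open>e\<close>), and for the \<open>q\<close>-th powers of shifted mean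
  differences (through \<open>e + c\<close>).\<close>

definition scale_const :: "nat \<Rightarrow> nat \<Rightarrow> real \<Rightarrow> real \<Rightarrow> real \<Rightarrow> real \<Rightarrow> real" where
  "scale_const n k q a e c = 2 powr q * a powr q + 4 powr q * (2 ^ k * (2 * real k) ^ n * e) powr q
     + 4 powr q * (2 ^ k) powr q * real k powr q * real k * (2 * real k) ^ n * (e + c)"

text \<open>The quotient is the mass of the weight \<open>t powr (k - 1 - \<delta>)\<close> on the
  interval from 0 to \<open>k\<close>, where \<delta> measures the loss in passing from the exponent
  \<open>r\<close> to \<open>p\<close>.\<close>

definition moment_const :: "nat \<Rightarrow> nat \<Rightarrow> real \<Rightarrow> real \<Rightarrow> real \<Rightarrow> real" where
  "moment_const n k K r p = (let \<delta> = real n * (1 / r - 1 / p) in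
     K powr p * (2 powr p * (real k powr (real k - \<delta>) / (real k - \<delta>)) powr p * (2 powr p * (2 * real k) powr (\<delta> * p) * 2 ^ n)))"

lemma moment_const_nonneg: "0 \<le> moment_const n k K r p"
  by (simp add: moment_const_def Let_def)

lemma scale_const_nonneg: "0 \<le> e \<Longrightarrow> 0 \<le> c \<Longrightarrow> 0 \<le> scale_const n k q a e c"
  by (simp add: scale_const_def)

section \<open>Averaged exchange of steps and fractional integration\<close>

context pointwise_data
begin

text \<open>The range of \<open>s\<close> covers the radii \<open>j \<rho> / 2\<close> and
  \<open>j \<rho>\<close> with \<open>1 \<le> j \<le> k\<close> that the shifts below
  produce.\<close>

lemma mean_ball_le:
  fixes \<phi> :: "real^'n \<Rightarrow> ennreal"
  assumes [measurable]: "\<phi> \<in> borel_measurable borel" and \<rho>: "0 < \<rho>" and s: "\<rho> / 2 \<le> s" "s \<le> real k * \<rho>"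
  shows "(\<integral>\<^sup>+u. \<phi> (x + s *\<^sub>R u) \<partial>unif_ball) \<le> ennreal ((2 * real k) ^ CARD('n)) * (\<integral>\<^sup>+u. \<phi> (x + (real k * \<rho>) *\<^sub>R u) \<partial>unif_ball)"
proof -
  have "(\<integral>\<^sup>+u. \<phi> (x + s *\<^sub>R u) \<partial>unif_ball) \<le> ennreal ((real k * \<rho> / s) ^ DIM(real^'n)) * (\<integral>\<^sup>+u. \<phi> (x + (real k * \<rho>) *\<^sub>R u) \<partial>unif_ball)"
    using s \<rho> by (intro nn_integral_unif_ball_mono_ball) auto
  also have "\<dots> \<le> ennreal ((2 * real k) ^ CARD('n)) * (\<integral>\<^sup>+u. \<phi> (x + (real k * \<rho>) *\<^sub>R u) \<partial>unif_ball)"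
  proof (intro mult_right_mono ennreal_leI)
    have "real k * \<rho> / s \<le> 2 * real k"
    proof -
      have "real k * \<rho> \<le> real k * (2 * s)" using s by (intro mult_left_mono) auto
      then show ?thesis using s \<rho> by (simp add: pos_divide_le_eq mult_ac)
    qed
    then show "(real k * \<rho> / s) ^ DIM(real^'n) \<le> (2 * real k) ^ CARD('n)"
      using power_mono[of "real k * \<rho> / s" "2 * real k" "CARD('n)"] s \<rho> by simp
  qed simp
  finally show ?thesis .
qed

text \<open>Averages of the exchange inequality. For \<open>mean_diff_halve\<close> both steps are
  averaged, one at radius \<rho> and one at radius \<open>\<rho> / 2\<close>, and the term left at
  \<open>x\<close> belongs to the smaller radius. For \<open>d_le_mean_diff\<close> only the
  auxiliary step is averaged; the terms at \<open>x + j h\<close> remain as functions of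
  \<open>h\<close>, to be averaged after taking powers.\<close>

lemma
  assumes \<rho>: "0 < \<rho>" and E0: "0 \<le> E" and E: "\<And>h. norm h \<le> \<rho> \<Longrightarrow> (\<integral>\<^sup>+v. d h (x + (real k * \<rho>) *\<^sub>R v) \<partial>unif_ball) \<le> ennreal E"
  shows mean_diff_halve: "mean_diff x \<rho> \<le> mean_diff x (\<rho> / 2) + ennreal (2 ^ k * (2 * (2 * real k) ^ CARD('n) * E))" (is ?halve)
    and nn_integral_mean_diff_le: "(\<integral>\<^sup>+v. mean_diff (x + (real k * \<rho>) *\<^sub>R v) \<rho> \<partial>unif_ball) \<le> ennreal E" (is ?avg)
    and d_le_mean_diff: "norm h \<le> \<rho> \<Longrightarrow> d h x \<le> mean_diff x \<rho> + (ennreal (2 ^ k * ((2 * real k) ^ CARD('n) * E))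
      + ennreal (2 ^ k) * (\<Sum>j\<in>{1..k}. mean_diff (x + real j *\<^sub>R h) \<rho>))" (is "_ \<Longrightarrow> ?d")
proof -
  let ?M = "(2 * real k) ^ CARD('n)"
  have small: "(\<integral>\<^sup>+u. d h (x + s *\<^sub>R u) \<partial>unif_ball) \<le> ennreal (?M * E)"
    if "norm h \<le> \<rho>" "\<rho> / 2 \<le> s" "s \<le> real k * \<rho>" for h s
  proof -
    have "(\<integral>\<^sup>+u. d h (x + s *\<^sub>R u) \<partial>unif_ball) \<le> ennreal ?M * (\<integral>\<^sup>+u. d h (x + (real k * \<rho>) *\<^sub>R u) \<partial>unif_ball)"
      using that \<rho> by (intro mean_ball_le) auto
    also have "\<dots> \<le> ennreal ?M * ennreal E" by (intro mult_left_mono E that) auto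
    finally show ?thesis using E0 by (simp add: ennreal_mult)
  qed
  have avg: "(\<integral>\<^sup>+u. mean_diff (x + s *\<^sub>R u) \<rho> \<partial>unif_ball) \<le> ennreal B"
    if "\<And>h. norm h \<le> \<rho> \<Longrightarrow> (\<integral>\<^sup>+u. d h (x + s *\<^sub>R u) \<partial>unif_ball) \<le> ennreal B" for s B
  proof -
    have "(\<integral>\<^sup>+u. mean_diff (x + s *\<^sub>R u) \<rho> \<partial>unif_ball) = (\<integral>\<^sup>+w. (\<integral>\<^sup>+u. d (\<rho> *\<^sub>R w) (x + s *\<^sub>R u) \<partial>unif_ball) \<partial>unif_ball)"
      unfolding mean_diff_def by (rule unif_ball_pair.Fubini') measurable
    also have "\<dots> \<le> (\<integral>\<^sup>+w. ennreal B \<partial>(unif_ball :: (real^'n) measure))"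
    proof (rule nn_integral_mono_AE)
      show "AE w in unif_ball. (\<integral>\<^sup>+u. d (\<rho> *\<^sub>R w) (x + s *\<^sub>R u) \<partial>unif_ball) \<le> ennreal B"
        using AE_unif_ball_norm
      proof eventually_elim
        case (elim w)
        then show ?case using \<rho> by (intro that) (auto intro: mult_left_le)
      qed
    qed
    finally show ?thesis by simp
  qed
  show ?avg by (rule avg[OF E])
  show ?d if h: "norm h \<le> \<rho>"
  proof -
    have "d h x = (\<integral>\<^sup>+w. d h x \<partial>(unif_ball :: (real^'n) measure))" by simp
    also have "\<dots> \<le> (\<integral>\<^sup>+w. d (\<rho> *\<^sub>R w) x + (\<Sum>j\<in>{1..k}. ennreal (real (k choose j)) * (d h (x + (real j * \<rho>) *\<^sub>R w) + d (\<rho> *\<^sub>R w) (x + real j *\<^sub>R h))) \<partial>unif_ball)"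
      using d_exchange[of h x "\<rho> *\<^sub>R w" for w] by (intro nn_integral_mono) simp
    also have "\<dots> = mean_diff x \<rho> + (\<Sum>j\<in>{1..k}. ennreal (real (k choose j)) * ((\<integral>\<^sup>+w. d h (x + (real j * \<rho>) *\<^sub>R w) \<partial>unif_ball) + mean_diff (x + real j *\<^sub>R h) \<rho>))"
      by (simp add: nn_integral_add nn_integral_sum nn_integral_cmult mean_diff_def)
    also have "\<dots> = mean_diff x \<rho> + ((\<Sum>j\<in>{1..k}. ennreal (real (k choose j)) * (\<integral>\<^sup>+w. d h (x + (real j * \<rho>) *\<^sub>R w) \<partial>unif_ball))
        + (\<Sum>j\<in>{1..k}. ennreal (real (k choose j)) * mean_diff (x + real j *\<^sub>R h) \<rho>))"
      by (simp add: distrib_left sum.distrib)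
    also have "\<dots> \<le> mean_diff x \<rho> + (ennreal (2 ^ k * (?M * E)) + ennreal (2 ^ k) * (\<Sum>j\<in>{1..k}. mean_diff (x + real j *\<^sub>R h) \<rho>))"
    proof (intro add_left_mono add_mono)
      show "(\<Sum>j\<in>{1..k}. ennreal (real (k choose j)) * (\<integral>\<^sup>+w. d h (x + (real j * \<rho>) *\<^sub>R w) \<partial>unif_ball)) \<le> ennreal (2 ^ k * (?M * E))"
      proof (rule sum_ennreal_binomial_le)
        fix j assume j: "j \<in> {1..k}"
        have "1 * \<rho> \<le> real j * \<rho>" "real j * \<rho> \<le> real k * \<rho>" using j \<rho> by (auto intro!: mult_right_mono)
        then show "(\<integral>\<^sup>+w. d h (x + (real j * \<rho>) *\<^sub>R w) \<partial>unif_ball) \<le> ennreal (?M * E)"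
          using \<rho> by (intro small h) auto
      qed (use E0 in simp)
      have "real (k choose j) \<le> 2 ^ k" for j
        using of_nat_le_iff[of "k choose j" "2 ^ k", where 'a=real] binomial_le_pow2[of k j] by (simp del: of_nat_le_iff)
      then show "(\<Sum>j\<in>{1..k}. ennreal (real (k choose j)) * mean_diff (x + real j *\<^sub>R h) \<rho>) \<le> ennreal (2 ^ k) * (\<Sum>j\<in>{1..k}. mean_diff (x + real j *\<^sub>R h) \<rho>)"
        unfolding sum_distrib_left by (intro sum_mono mult_right_mono ennreal_leI) auto
    qed
    finally show ?thesis .
  qed
  show ?halve
  proof -
    let ?h = "\<lambda>u. (\<rho> / 2) *\<^sub>R u"
    have "mean_diff x \<rho> = (\<integral>\<^sup>+u. mean_diff x \<rho> \<partial>(unif_ball :: (real^'n) measure))" by simp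
    also have "\<dots> \<le> (\<integral>\<^sup>+u. d (?h u) x + (\<Sum>j\<in>{1..k}. ennreal (real (k choose j)) * (mean_diff (x + (real j * (\<rho> / 2)) *\<^sub>R u) \<rho>
        + (\<integral>\<^sup>+w. d (?h u) (x + (real j * \<rho>) *\<^sub>R w) \<partial>unif_ball))) \<partial>unif_ball)"
    proof (intro nn_integral_mono)
      fix u :: "real^'n"
      have "mean_diff x \<rho> \<le> (\<integral>\<^sup>+w. d (?h u) x + (\<Sum>j\<in>{1..k}. ennreal (real (k choose j)) * (d (\<rho> *\<^sub>R w) (x + (real j * (\<rho> / 2)) *\<^sub>R u) + d (?h u) (x + (real j * \<rho>) *\<^sub>R w))) \<partial>unif_ball)"
        unfolding mean_diff_def
        using d_exchange[of "\<rho> *\<^sub>R w" x "?h u" for w] by (intro nn_integral_mono) simp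
      also have "\<dots> = d (?h u) x + (\<Sum>j\<in>{1..k}. ennreal (real (k choose j)) * (mean_diff (x + (real j * (\<rho> / 2)) *\<^sub>R u) \<rho>
          + (\<integral>\<^sup>+w. d (?h u) (x + (real j * \<rho>) *\<^sub>R w) \<partial>unif_ball)))"
        by (simp add: nn_integral_add nn_integral_sum nn_integral_cmult mean_diff_def)
      finally show "mean_diff x \<rho> \<le> \<dots>" .
    qed
    also have "\<dots> = mean_diff x (\<rho> / 2) + (\<Sum>j\<in>{1..k}. ennreal (real (k choose j)) * ((\<integral>\<^sup>+u. mean_diff (x + (real j * (\<rho> / 2)) *\<^sub>R u) \<rho> \<partial>unif_ball)
        + (\<integral>\<^sup>+u. (\<integral>\<^sup>+w. d (?h u) (x + (real j * \<rho>) *\<^sub>R w) \<partial>unif_ball) \<partial>unif_ball)))"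
      by (simp add: nn_integral_add nn_integral_sum nn_integral_cmult mean_diff_def[of x])
    also have "\<dots> \<le> mean_diff x (\<rho> / 2) + ennreal (2 ^ k * (?M * E + ?M * E))"
    proof (intro add_left_mono sum_ennreal_binomial_le)
      fix j assume j: "j \<in> {1..k}"
      have jj: "1 * \<rho> \<le> real j * \<rho>" "real j * \<rho> \<le> real k * \<rho>" using j \<rho> by (auto intro!: mult_right_mono)
      have 1: "(\<integral>\<^sup>+u. mean_diff (x + (real j * (\<rho> / 2)) *\<^sub>R u) \<rho> \<partial>unif_ball) \<le> ennreal (?M * E)"
        using jj \<rho> by (intro avg small) auto
      have "(\<integral>\<^sup>+u. (\<integral>\<^sup>+w. d (?h u) (x + (real j * \<rho>) *\<^sub>R w) \<partial>unif_ball) \<partial>unif_ball) \<le> (\<integral>\<^sup>+u. ennreal (?M * E) \<partial>(unif_ball :: (real^'n) measure))"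
      proof (rule nn_integral_mono_AE)
        show "AE u in unif_ball. (\<integral>\<^sup>+w. d (?h u) (x + (real j * \<rho>) *\<^sub>R w) \<partial>unif_ball) \<le> ennreal (?M * E)"
          using AE_unif_ball_norm
        proof eventually_elim
          case (elim u)
          have "\<rho> * norm u \<le> \<rho> * 1" using elim \<rho> by (intro mult_left_mono) auto
          then show ?case using \<rho> jj by (intro small) auto
        qed
      qed
      then have 2: "(\<integral>\<^sup>+u. (\<integral>\<^sup>+w. d (?h u) (x + (real j * \<rho>) *\<^sub>R w) \<partial>unif_ball) \<partial>unif_ball) \<le> ennreal (?M * E)" by simp
      show "(\<integral>\<^sup>+u. mean_diff (x + (real j * (\<rho> / 2)) *\<^sub>R u) \<rho> \<partial>unif_ball)
        + (\<integral>\<^sup>+u. (\<integral>\<^sup>+w. d (?h u) (x + (real j * \<rho>) *\<^sub>R w) \<partial>unif_ball) \<partial>unif_ball) \<le> ennreal (?M * E + ?M * E)"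
        using add_mono[OF 1 2] E0 by (simp add: ennreal_plus[symmetric] del: ennreal_plus)
    qed (use E0 in simp)
    finally show ?thesis by (simp add: mult_ac)
  qed
qed

text \<open>The hypothesis \<open>n (1 / r - 1 / p) < k\<close> makes the weight \<open>t powr e\<close> integrable at \<open>0\<close>.\<close>

lemma nn_integral_mean_diff_powr_le:
  assumes \<rho>: "0 < \<rho>" and p: "r \<le> p" and lt: "real CARD('n) * (1 / r - 1 / p) < real k"
  shows "(\<integral>\<^sup>+v. enn_powr (mean_diff (x + (real k * \<rho>) *\<^sub>R v) \<rho>) p \<partial>unif_ball)
    \<le> ennreal (moment_const CARD('n) k K r p * (\<rho> ^ k * G) powr p)"
proof -
  \<comment> \<open>The weight \<open>t ^ (k - 1)\<close> is split into
    \<open>t powr e * t powr \<delta>\<close>. The first factor becomes the finite measure \<mu>,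
    the second compensates the growth of means over small balls.\<close>
  define \<delta> where "\<delta> = real CARD('n) * (1 / r - 1 / p)"
  define e where "e = real k - 1 - \<delta>"
  have p1: "1 \<le> p" using p r by simp
  have \<delta>: "0 \<le> \<delta>" "\<delta> < real k" using p r lt by (auto simp: \<delta>_def frac_le intro!: mult_nonneg_nonneg)
  have e: "-1 < e" using \<delta> by (simp add: e_def)
  define m where "m = real k powr (real k - \<delta>) / (real k - \<delta>)"
  have m: "0 < m" using k_pos \<delta> by (simp add: m_def)
  define \<mu> where "\<mu> = density lborel (\<lambda>t. ennreal (indicator {0<..real k} t * t powr e))"
  have sets_\<mu> [measurable_cong, simp]: "sets \<mu> = sets borel" by (simp add: \<mu>_def)
  have \<mu>: "emeasure \<mu> (space \<mu>) \<le> ennreal m"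
  proof -
    have "emeasure \<mu> (space \<mu>) = (\<integral>\<^sup>+t. ennreal (indicator {0<..real k} t * t powr e) \<partial>lborel)"
      by (simp add: \<mu>_def emeasure_density)
    also have "\<dots> \<le> (\<integral>\<^sup>+t. ennreal (t powr e) * indicator {0..real k} t \<partial>lborel)"
      by (intro nn_integral_mono) (auto split: split_indicator)
    also have "\<dots> = ennreal (real k powr (e + 1) / (e + 1))"
      using e k_pos by (intro nn_integral_has_integral_lebesgue' has_integral_powr_from_0) auto
    also have "\<dots> = ennreal m" by (simp add: m_def e_def)
    finally show ?thesis .
  qed
  have kern_\<mu>: "(\<integral>\<^sup>+t. kern t * \<phi> t \<partial>lborel) = (\<integral>\<^sup>+t. ennreal (t powr \<delta>) * \<phi> t \<partial>\<mu>)" if [measurable]: "\<phi> \<in> borel_measurable borel" for \<phi>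
  proof -
    have "kern t * \<phi> t = ennreal (indicator {0<..real k} t * t powr e) * (ennreal (t powr \<delta>) * \<phi> t)" for t
    proof (cases "t \<in> {0<..real k}")
      case True
      then have "t ^ (k - 1) = t powr real (k - 1)" by (subst powr_realpow) auto
      also have "\<dots> = t powr e * t powr \<delta>" using k by (simp add: powr_add[symmetric] e_def of_nat_diff)
      finally show ?thesis using True by (simp add: kern_def ennreal_mult mult.assoc)
    qed (simp add: kern_def)
    then show ?thesis unfolding \<mu>_def by (subst nn_integral_density) auto
  qed
  define A where "A t y = (\<integral>\<^sup>+w. ennreal (g (y + (t * \<rho>) *\<^sub>R w)) \<partial>unif_ball)" for t y
  define P where "P t y = (\<integral>\<^sup>+w. ennreal (g (y + (t * \<rho>) *\<^sub>R w) powr r) \<partial>unif_ball)" for t y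
  have [measurable]: "(\<lambda>z. A (u z) (v z)) \<in> borel_measurable M" "(\<lambda>z. P (u z) (v z)) \<in> borel_measurable M"
    if [measurable]: "u \<in> borel_measurable M" "v \<in> borel_measurable M" for u v and M :: "'z measure"
    unfolding A_def P_def by measurable
  have A_meas [measurable]: "(\<lambda>t. A t y) \<in> borel_measurable borel" "(\<lambda>y. A t y) \<in> borel_measurable borel"
    "(\<lambda>y. P t y) \<in> borel_measurable borel" "case_prod A \<in> borel_measurable (borel \<Otimes>\<^sub>M borel)" for y t
    unfolding A_def P_def split_def by measurable
  let ?y = "\<lambda>v. x + (real k * \<rho>) *\<^sub>R v"
  define c where "c t = (2 * real k / t) powr (\<delta> * p) * G powr (p - r)" for t
  have c0: "0 \<le> c t" for t by (simp add: c_def)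
  \<comment> \<open>Only the power \<open>p / r - 1\<close> of the \<open>r\<close>-th power mean
    \<open>P\<close> is bounded pointwise, by comparison with the ball of radius
    \<open>2 k \<rho>\<close> around \<open>x\<close>. One factor \<open>P\<close> is kept, since
    its average over \<open>v\<close> is bounded without any negative power of
    \<open>t\<close>.\<close>
  have A_le: "enn_powr (A t (?y v)) p \<le> ennreal (2 powr p * c t) * P t (?y v)" if v: "norm v < 1" and t: "t \<in> {0<..real k}" for t v
  proof -
    have "enn_powr (A t (?y v)) r \<le> ennreal (2 powr r * 1 powr (r - 1)) * (\<integral>\<^sup>+w. enn_powr (ennreal (g (?y v + (t * \<rho>) *\<^sub>R w))) r \<partial>unif_ball)"
      unfolding A_def by (rule enn_powr_nn_integral_le) (use r in auto)
    also have "\<dots> = ennreal (2 powr r) * P t (?y v)" using g_nonneg by (simp add: P_def)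
    finally have 1: "enn_powr (A t (?y v)) r \<le> ennreal (2 powr r) * P t (?y v)" .
    have "norm (?y v - x) + t * \<rho> \<le> 2 * real k * \<rho>"
    proof -
      have "norm v * (real k * \<rho>) \<le> 1 * (real k * \<rho>)" "t * \<rho> \<le> real k * \<rho>"
        using v t \<rho> by (auto intro!: mult_right_mono)
      moreover have "norm (?y v - x) = norm v * (real k * \<rho>)" using \<rho> by (simp add: mult_ac)
      ultimately show ?thesis unfolding mult.assoc by linarith
    qed
    then have "P t (?y v) \<le> ennreal ((2 * real k * \<rho> / (t * \<rho>)) ^ DIM(real^'n)) * (\<integral>\<^sup>+w. ennreal (g (x + (2 * real k * \<rho>) *\<^sub>R w) powr r) \<partial>unif_ball)"
      unfolding P_def using t \<rho> by (intro nn_integral_unif_ball_mono_ball[where \<phi>="\<lambda>y. ennreal (g y powr r)"]) auto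
    also have "\<dots> \<le> ennreal ((2 * real k / t) ^ CARD('n)) * ennreal (G powr r)"
      using \<rho> k_pos by (intro mult_mono mean_g) auto
    finally have 2: "P t (?y v) \<le> ennreal ((2 * real k / t) ^ CARD('n) * G powr r)"
      using t by (simp add: ennreal_mult[symmetric])
    have pr: "0 \<le> p / r - 1" using p r by simp
    have "enn_powr (A t (?y v)) p = enn_powr (enn_powr (A t (?y v)) r) (p / r)"
      using r by (simp add: enn_powr_powr)
    also have "\<dots> \<le> enn_powr (ennreal (2 powr r) * P t (?y v)) (p / r)"
      using p r by (intro enn_powr_mono 1) auto
    also have "\<dots> = ennreal (2 powr p) * enn_powr (P t (?y v)) ((p / r - 1) + 1)"
      using r by (simp add: enn_powr_mult powr_powr)
    also have "\<dots> = ennreal (2 powr p) * (enn_powr (P t (?y v)) (p / r - 1) * P t (?y v))"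
      by (subst enn_powr_add) simp
    also have "\<dots> \<le> ennreal (2 powr p) * (enn_powr (ennreal ((2 * real k / t) ^ CARD('n) * G powr r)) (p / r - 1) * P t (?y v))"
      by (intro mult_left_mono mult_right_mono enn_powr_mono 2 pr) auto
    also have "enn_powr (ennreal ((2 * real k / t) ^ CARD('n) * G powr r)) (p / r - 1) = ennreal (c t)"
    proof -
      have "(2 * real k / t) ^ CARD('n) = (2 * real k / t) powr real CARD('n)" using t k_pos by (simp add: powr_realpow)
      moreover have "real CARD('n) * (p / r - 1) = \<delta> * p" using p1 r by (simp add: \<delta>_def field_simps)
      moreover have "r * (p / r - 1) = p - r" using r by (simp add: field_simps)
      ultimately have "((2 * real k / t) ^ CARD('n) * G powr r) powr (p / r - 1) = c t"
        by (simp add: c_def powr_mult powr_powr)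
      then show ?thesis using t by simp
    qed
    finally show ?thesis using c0 by (simp add: ennreal_mult mult.assoc)
  qed
  have P_le: "(\<integral>\<^sup>+v. P t (?y v) \<partial>unif_ball) \<le> ennreal (2 ^ CARD('n) * G powr r)" if t: "t \<in> {0<..real k}" for t
  proof -
    have "(\<integral>\<^sup>+v. P t (?y v) \<partial>unif_ball) = (\<integral>\<^sup>+w. (\<integral>\<^sup>+v. ennreal (g (x + (t * \<rho>) *\<^sub>R w + (real k * \<rho>) *\<^sub>R v) powr r) \<partial>unif_ball) \<partial>unif_ball)"
      unfolding P_def by (subst unif_ball_pair.Fubini') (measurable, simp add: add_ac)
    also have "\<dots> \<le> (\<integral>\<^sup>+w. ennreal (2 ^ CARD('n) * G powr r) \<partial>(unif_ball :: (real^'n) measure))"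
    proof (rule nn_integral_mono_AE)
      show "AE w in unif_ball. (\<integral>\<^sup>+v. ennreal (g (x + (t * \<rho>) *\<^sub>R w + (real k * \<rho>) *\<^sub>R v) powr r) \<partial>unif_ball) \<le> ennreal (2 ^ CARD('n) * G powr r)"
        using AE_unif_ball_norm
      proof eventually_elim
        case (elim w)
        have "norm w * (t * \<rho>) \<le> 1 * (t * \<rho>)" "t * \<rho> \<le> real k * \<rho>"
          using elim t \<rho> by (auto intro!: mult_right_mono)
        moreover have "norm (x + (t * \<rho>) *\<^sub>R w - x) = norm w * (t * \<rho>)"
          using t \<rho> by (simp add: abs_mult mult_ac)
        ultimately have "norm (x + (t * \<rho>) *\<^sub>R w - x) + real k * \<rho> \<le> 2 * (real k * \<rho>)"
          by linarith
        then have "(\<integral>\<^sup>+v. ennreal (g (x + (t * \<rho>) *\<^sub>R w + (real k * \<rho>) *\<^sub>R v) powr r) \<partial>unif_ball)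
            \<le> ennreal ((2 * (real k * \<rho>) / (real k * \<rho>)) ^ DIM(real^'n)) * (\<integral>\<^sup>+v. ennreal (g (x + (2 * (real k * \<rho>)) *\<^sub>R v) powr r) \<partial>unif_ball)"
          using \<rho> k_pos by (intro nn_integral_unif_ball_mono_ball[where \<phi>="\<lambda>y. ennreal (g y powr r)"]) auto
        also have "\<dots> \<le> ennreal (2 ^ CARD('n)) * ennreal (G powr r)"
          using \<rho> k_pos by (intro mult_mono mean_g) auto
        finally show ?case by (simp add: ennreal_mult)
      qed
    qed
    finally show ?thesis by simp
  qed
  define L where "L = 2 powr p * (2 * real k) powr (\<delta> * p) * 2 ^ CARD('n)"
  have inner: "(\<integral>\<^sup>+v. enn_powr (ennreal (t powr \<delta>) * A t (?y v)) p \<partial>unif_ball) \<le> ennreal (L * G powr p)" if t: "t \<in> {0<..real k}" for t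
  proof -
    have "(\<integral>\<^sup>+v. enn_powr (ennreal (t powr \<delta>) * A t (?y v)) p \<partial>unif_ball) = (\<integral>\<^sup>+v. ennreal (t powr (\<delta> * p)) * enn_powr (A t (?y v)) p \<partial>unif_ball)"
      by (simp add: enn_powr_mult powr_powr)
    also have "\<dots> \<le> (\<integral>\<^sup>+v. ennreal (t powr (\<delta> * p)) * (ennreal (2 powr p * c t) * P t (?y v)) \<partial>unif_ball)"
    proof (rule nn_integral_mono_AE)
      show "AE v in unif_ball. ennreal (t powr (\<delta> * p)) * enn_powr (A t (?y v)) p \<le> ennreal (t powr (\<delta> * p)) * (ennreal (2 powr p * c t) * P t (?y v))"
        using AE_unif_ball_norm by eventually_elim (intro mult_left_mono A_le t, auto)
    qed
    also have "\<dots> = ennreal (t powr (\<delta> * p)) * (ennreal (2 powr p * c t) * (\<integral>\<^sup>+v. P t (?y v) \<partial>unif_ball))"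
      by (simp add: nn_integral_cmult)
    also have "\<dots> \<le> ennreal (t powr (\<delta> * p)) * (ennreal (2 powr p * c t) * ennreal (2 ^ CARD('n) * G powr r))"
      by (intro mult_left_mono P_le t) auto
    also have "\<dots> = ennreal (t powr (\<delta> * p) * (2 powr p * c t * (2 ^ CARD('n) * G powr r)))"
      using c0 by (simp add: ennreal_mult)
    \<comment> \<open>The negative power of \<open>t\<close> in \<open>c t\<close> cancels exactly
      against \<open>t powr (\<delta> * p)\<close>, so the bound is uniform in
      \<open>t\<close>.\<close>
    also have "t powr (\<delta> * p) * (2 powr p * c t * (2 ^ CARD('n) * G powr r)) = L * G powr p"
    proof -
      have "(2 * real k / t) powr (\<delta> * p) * t powr (\<delta> * p) = (2 * real k) powr (\<delta> * p)"
        using t k_pos by (subst powr_mult[symmetric]) auto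
      moreover have "G powr (p - r) * G powr r = G powr p" using G by (simp add: powr_add[symmetric])
      moreover have "t powr (\<delta> * p) * (2 powr p * c t * (2 ^ CARD('n) * G powr r))
          = 2 powr p * ((2 * real k / t) powr (\<delta> * p) * t powr (\<delta> * p)) * 2 ^ CARD('n) * (G powr (p - r) * G powr r)"
        unfolding c_def by (simp only: mult_ac)
      ultimately show ?thesis by (simp only: L_def mult_ac)
    qed
    finally show ?thesis .
  qed
  have L0: "0 \<le> L" by (simp add: L_def)
  \<comment> \<open>Jensen's inequality for the finite measure \<mu>.\<close>
  have kmean: "enn_powr (kernel_mean y \<rho>) p \<le> ennreal (2 powr p * m powr (p - 1)) * (\<integral>\<^sup>+t. enn_powr (ennreal (t powr \<delta>) * A t y) p \<partial>\<mu>)" for y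
  proof -
    have "kernel_mean y \<rho> = (\<integral>\<^sup>+t. ennreal (t powr \<delta>) * A t y \<partial>\<mu>)"
      unfolding kernel_mean_def A_def[symmetric] by (rule kern_\<mu>) measurable
    then show ?thesis by (simp, intro enn_powr_nn_integral_le \<mu> m p1) measurable
  qed
  have "(\<integral>\<^sup>+v. enn_powr (kernel_mean (?y v) \<rho>) p \<partial>unif_ball)
      \<le> (\<integral>\<^sup>+v. ennreal (2 powr p * m powr (p - 1)) * (\<integral>\<^sup>+t. enn_powr (ennreal (t powr \<delta>) * A t (?y v)) p \<partial>\<mu>) \<partial>unif_ball)"
    by (intro nn_integral_mono kmean)
  also have "\<dots> = (\<integral>\<^sup>+v. ennreal (2 powr p * m powr (p - 1)) * (\<integral>\<^sup>+t. ennreal (indicator {0<..real k} t * t powr e) * enn_powr (ennreal (t powr \<delta>) * A t (?y v)) p \<partial>lborel) \<partial>unif_ball)"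
    unfolding \<mu>_def by (subst nn_integral_density) auto
  also have "\<dots> = ennreal (2 powr p * m powr (p - 1)) * (\<integral>\<^sup>+v. (\<integral>\<^sup>+t. ennreal (indicator {0<..real k} t * t powr e) * enn_powr (ennreal (t powr \<delta>) * A t (?y v)) p \<partial>lborel) \<partial>unif_ball)"
    unfolding A_def by (intro nn_integral_cmult) measurable
  also have "(\<integral>\<^sup>+v. (\<integral>\<^sup>+t. ennreal (indicator {0<..real k} t * t powr e) * enn_powr (ennreal (t powr \<delta>) * A t (?y v)) p \<partial>lborel) \<partial>unif_ball)
      = (\<integral>\<^sup>+t. (\<integral>\<^sup>+v. ennreal (indicator {0<..real k} t * t powr e) * enn_powr (ennreal (t powr \<delta>) * A t (?y v)) p \<partial>unif_ball) \<partial>lborel)"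
    unfolding A_def by (rule lborel_unif_ball.Fubini') measurable
  also have "\<dots> = (\<integral>\<^sup>+t. ennreal (indicator {0<..real k} t * t powr e) * (\<integral>\<^sup>+v. enn_powr (ennreal (t powr \<delta>) * A t (?y v)) p \<partial>unif_ball) \<partial>lborel)"
    by (intro nn_integral_cong nn_integral_cmult) measurable
  also have "\<dots> \<le> (\<integral>\<^sup>+t. ennreal (indicator {0<..real k} t * t powr e) * ennreal (L * G powr p) \<partial>lborel)"
  proof (intro nn_integral_mono)
    fix t
    show "ennreal (indicator {0<..real k} t * t powr e) * (\<integral>\<^sup>+v. enn_powr (ennreal (t powr \<delta>) * A t (?y v)) p \<partial>unif_ball)
        \<le> ennreal (indicator {0<..real k} t * t powr e) * ennreal (L * G powr p)"
      using inner[of t] by (cases "t \<in> {0<..real k}") (auto intro: mult_left_mono)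
  qed
  also have "\<dots> = emeasure \<mu> (space \<mu>) * ennreal (L * G powr p)"
    by (simp add: nn_integral_multc \<mu>_def emeasure_density)
  also have "\<dots> \<le> ennreal m * ennreal (L * G powr p)" by (intro mult_right_mono \<mu>) simp
  finally have "(\<integral>\<^sup>+v. enn_powr (kernel_mean (?y v) \<rho>) p \<partial>unif_ball) \<le> ennreal (2 powr p * m powr (p - 1)) * (ennreal m * ennreal (L * G powr p))"
    by (simp add: mult_left_mono)
  also have "\<dots> = ennreal (2 powr p * (m powr (p - 1) * m) * (L * G powr p))"
    using m L0 by (simp add: ennreal_mult mult_ac)
  also have "m powr (p - 1) * m = m powr p" using m by (simp add: powr_diff)
  finally have fin: "(\<integral>\<^sup>+v. enn_powr (kernel_mean (?y v) \<rho>) p \<partial>unif_ball) \<le> ennreal (2 powr p * m powr p * (L * G powr p))" .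
  have "AE v in lborel. mean_diff (?y v) \<rho> \<le> ennreal (K * \<rho> ^ k) * kernel_mean (?y v) \<rho>"
    using \<rho> k_pos by (intro AE_lborel_affine[OF AE_mean_diff_le_kernel_mean[OF \<rho>]]) auto
  then have ae: "AE v in unif_ball. mean_diff (?y v) \<rho> \<le> ennreal (K * \<rho> ^ k) * kernel_mean (?y v) \<rho>"
    by (rule AE_unif_ballI)
  have "(\<integral>\<^sup>+v. enn_powr (mean_diff (?y v) \<rho>) p \<partial>unif_ball) \<le> (\<integral>\<^sup>+v. ennreal ((K * \<rho> ^ k) powr p) * enn_powr (kernel_mean (?y v) \<rho>) p \<partial>unif_ball)"
  proof (rule nn_integral_mono_AE)
    show "AE v in unif_ball. enn_powr (mean_diff (?y v) \<rho>) p \<le> ennreal ((K * \<rho> ^ k) powr p) * enn_powr (kernel_mean (?y v) \<rho>) p"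
      using ae
    proof eventually_elim
      case (elim v)
      then have "enn_powr (mean_diff (?y v) \<rho>) p \<le> enn_powr (ennreal (K * \<rho> ^ k) * kernel_mean (?y v) \<rho>) p"
        using p1 by (intro enn_powr_mono) auto
      then show ?case using K \<rho> by (simp add: enn_powr_mult)
    qed
  qed
  also have "\<dots> = ennreal ((K * \<rho> ^ k) powr p) * (\<integral>\<^sup>+v. enn_powr (kernel_mean (?y v) \<rho>) p \<partial>unif_ball)"
    by (rule nn_integral_cmult) measurable
  also have "\<dots> \<le> ennreal ((K * \<rho> ^ k) powr p) * ennreal (2 powr p * m powr p * (L * G powr p))"
    by (intro mult_left_mono fin) simp
  also have "\<dots> = ennreal (moment_const CARD('n) k K r p * (\<rho> ^ k * G) powr p)"
    using K \<rho> G L0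
    by (simp add: ennreal_mult[symmetric] moment_const_def Let_def \<delta>_def[symmetric] m_def[symmetric] L_def powr_mult mult_ac)
  finally show ?thesis .
qed

end

text \<open>The numerator is the cost of one halving of the radius, the denominator sums the
  geometric series over all halvings. It degenerates as \<theta> tends to 0.\<close>

definition halving_const :: "nat \<Rightarrow> nat \<Rightarrow> real \<Rightarrow> real \<Rightarrow> real" where
  "halving_const n k K \<theta> = 2 ^ k * (2 * (2 * real k) ^ n * (2 * 2 ^ k * 2 ^ n * (1 + K * real k ^ k))) / (1 - ((1 / 2) ^ k) powr \<theta>)"

text \<open>The constants of the bounds by \<open>H \<rho>\<close> and by
  \<open>F powr (1 - \<theta>) * H \<rho> powr \<theta>\<close>, added so that a single constant
  serves both.\<close>

definition total_const :: "nat \<Rightarrow> nat \<Rightarrow> real \<Rightarrow> real \<Rightarrow> real \<Rightarrow> real \<Rightarrow> real \<Rightarrow> real" where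
  "total_const n k K q r p \<theta> =
     scale_const n k q (2 * K * real k ^ k) (2 * 2 ^ n * K * real k ^ k) (moment_const n k K r p)
   + scale_const n k q (halving_const n k K \<theta>) (2 * 2 ^ k * 2 ^ n) (moment_const n k K r p)"

lemma half_power_powr_less_1:
  assumes "1 \<le> k" "0 < \<theta>" shows "((1 / 2) ^ k) powr \<theta> < (1::real)"
proof -
  have "(1 / 2 :: real) ^ k \<le> (1 / 2) ^ 1" using assms by (intro power_decreasing) auto
  then have "((1 / 2 :: real) ^ k) powr \<theta> \<le> (1 / 2) powr \<theta>" using assms by (intro powr_mono2) auto
  also have "\<dots> < 1 powr \<theta>" using assms by (intro powr_less_mono2) auto
  finally show ?thesis by simp
qed

lemma halving_const_nonneg: "1 \<le> k \<Longrightarrow> 0 < K \<Longrightarrow> 0 < \<theta> \<Longrightarrow> 0 \<le> halving_const n k K \<theta>"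
  using half_power_powr_less_1[of k \<theta>] by (auto simp: halving_const_def intro!: divide_nonneg_pos mult_nonneg_nonneg)

section \<open>Power means of the differences at \<open>x\<close>\<close>

context pointwise_data
begin

abbreviation H :: "real \<Rightarrow> real" where "H \<rho> \<equiv> \<rho> ^ k * G"

text \<open>One estimate for both regimes. \<open>S\<close> bounds the first means at shifted
  points, \<open>T\<close> is the desired size and \<open>l\<close> the level of interpolation
  between the exponents 1 and \<open>p\<close>; \<open>l1\<close> and \<open>l2\<close> say that
  both ends of the interpolation stay below \<open>T powr q\<close>.\<close>

lemma mean_powr_d_le:
  assumes \<rho>: "0 < \<rho>" and q: "1 \<le> q" "q \<le> p" and p: "r \<le> p" and lt: "real CARD('n) * (1 / r - 1 / p) < real k"
    and e: "0 \<le> e" and S: "0 \<le> S" "S \<le> T" and a: "0 \<le> a" and l: "0 < l"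
    and E: "\<And>h. norm h \<le> \<rho> \<Longrightarrow> (\<integral>\<^sup>+v. d h (x + (real k * \<rho>) *\<^sub>R v) \<partial>unif_ball) \<le> ennreal (e * S)"
    and A: "mean_diff x \<rho> \<le> ennreal (a * T)"
    and l1: "l powr (q - 1) * S \<le> T powr q" and l2: "l powr (q - p) * H \<rho> powr p \<le> T powr q"
  shows "(\<integral>\<^sup>+v. enn_powr (d (\<rho> *\<^sub>R v) x) q \<partial>unif_ball)
    \<le> ennreal (scale_const CARD('n) k q a e (moment_const CARD('n) k K r p) * T powr q)"
proof -
  let ?M = "(2 * real k) ^ CARD('n)" and ?c = "moment_const CARD('n) k K r p"
  have T: "0 \<le> T" using S by simp
  have c: "0 \<le> ?c" by (rule moment_const_nonneg)
  have eS: "0 \<le> e * S" using e S by simp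
  define I where "I = (\<integral>\<^sup>+v. enn_powr (mean_diff (x + (real k * \<rho>) *\<^sub>R v) \<rho>) q \<partial>unif_ball)"
  have I: "I \<le> ennreal ((e + ?c) * T powr q)"
  proof -
    have "I \<le> (\<integral>\<^sup>+v. ennreal (l powr (q - 1)) * mean_diff (x + (real k * \<rho>) *\<^sub>R v) \<rho>
        + ennreal (l powr (q - p)) * enn_powr (mean_diff (x + (real k * \<rho>) *\<^sub>R v) \<rho>) p \<partial>unif_ball)"
      unfolding I_def using enn_powr_interpolate[OF l q] by (intro nn_integral_mono) simp
    also have "\<dots> = ennreal (l powr (q - 1)) * (\<integral>\<^sup>+v. mean_diff (x + (real k * \<rho>) *\<^sub>R v) \<rho> \<partial>unif_ball)
        + ennreal (l powr (q - p)) * (\<integral>\<^sup>+v. enn_powr (mean_diff (x + (real k * \<rho>) *\<^sub>R v) \<rho>) p \<partial>unif_ball)"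
      by (simp add: nn_integral_add nn_integral_cmult)
    also have "\<dots> \<le> ennreal (l powr (q - 1)) * ennreal (e * S) + ennreal (l powr (q - p)) * ennreal (?c * H \<rho> powr p)"
      by (intro add_mono mult_left_mono nn_integral_mean_diff_le[OF \<rho> eS E] nn_integral_mean_diff_powr_le[OF \<rho> p lt]) auto
    also have "\<dots> = ennreal (e * (l powr (q - 1) * S) + ?c * (l powr (q - p) * H \<rho> powr p))"
      using e S c by (simp add: ennreal_mult[symmetric] ennreal_plus[symmetric] mult_ac del: ennreal_plus)
    also have "\<dots> \<le> ennreal (e * T powr q + ?c * T powr q)"
      by (intro ennreal_leI add_mono mult_left_mono l1 l2 e c)
    finally show ?thesis by (simp add: distrib_right)
  qed
  have *: "(\<integral>\<^sup>+v. enn_powr (mean_diff (x + (real j * \<rho>) *\<^sub>R v) \<rho>) q \<partial>unif_ball) \<le> ennreal (?M * ((e + ?c) * T powr q))"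
    if j: "j \<in> {1..k}" for j
  proof -
    have jj: "1 * \<rho> \<le> real j * \<rho>" "real j * \<rho> \<le> real k * \<rho>" using j \<rho> by (auto intro!: mult_right_mono)
    have "(\<integral>\<^sup>+v. enn_powr (mean_diff (x + (real j * \<rho>) *\<^sub>R v) \<rho>) q \<partial>unif_ball) \<le> ennreal ?M * I"
      unfolding I_def using jj \<rho> by (intro mean_ball_le[where \<phi>="\<lambda>y. enn_powr (mean_diff y \<rho>) q"]) auto
    also have "\<dots> \<le> ennreal ?M * ennreal ((e + ?c) * T powr q)" by (intro mult_left_mono I) simp
    finally show ?thesis using e c by (simp add: ennreal_mult)
  qed
  let ?A = "ennreal (a powr q * T powr q)" and ?B = "ennreal ((2 ^ k * ?M * e) powr q * T powr q)"
  let ?s = "ennreal ((2 ^ k) powr q * real k powr q)"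
  \<comment> \<open>The three contributions are separated by two successive splittings, whence the
    factors \<open>2 powr q\<close> and \<open>4 powr q\<close> in
    \<open>scale_const\<close>.\<close>
  have pt: "enn_powr (d (\<rho> *\<^sub>R v) x) q \<le> ennreal (2 powr q) * (?A + ennreal (2 powr q) * (?B
      + ?s * (\<Sum>j\<in>{1..k}. enn_powr (mean_diff (x + (real j * \<rho>) *\<^sub>R v) \<rho>) q)))" if v: "norm v < 1" for v
  proof -
    have n: "norm (\<rho> *\<^sub>R v) \<le> \<rho>" using v \<rho> by (auto intro: mult_left_le)
    let ?\<Sigma> = "\<Sum>j\<in>{1..k}. mean_diff (x + (real j * \<rho>) *\<^sub>R v) \<rho>"
    have q0: "0 \<le> q" using q by simp
    have "d (\<rho> *\<^sub>R v) x \<le> mean_diff x \<rho> + (ennreal (2 ^ k * (?M * (e * S))) + ennreal (2 ^ k) * ?\<Sigma>)"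
      using d_le_mean_diff[OF \<rho> eS E n] by simp
    then have "enn_powr (d (\<rho> *\<^sub>R v) x) q \<le> enn_powr (mean_diff x \<rho> + (ennreal (2 ^ k * (?M * (e * S))) + ennreal (2 ^ k) * ?\<Sigma>)) q"
      by (intro enn_powr_mono q0)
    also have "\<dots> \<le> ennreal (2 powr q) * (enn_powr (mean_diff x \<rho>) q + ennreal (2 powr q) * (enn_powr (ennreal (2 ^ k * (?M * (e * S)))) q + enn_powr (ennreal (2 ^ k) * ?\<Sigma>) q))"
      by (intro order_trans[OF enn_powr_add_le[OF q0]] mult_left_mono add_left_mono enn_powr_add_le q0) auto
    also have "\<dots> \<le> ennreal (2 powr q) * (?A + ennreal (2 powr q) * (?B
      + ?s * (\<Sum>j\<in>{1..k}. enn_powr (mean_diff (x + (real j * \<rho>) *\<^sub>R v) \<rho>) q)))"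
    proof (intro mult_left_mono add_mono)
      have "enn_powr (mean_diff x \<rho>) q \<le> enn_powr (ennreal (a * T)) q" by (intro enn_powr_mono A q0)
      then show "enn_powr (mean_diff x \<rho>) q \<le> ?A" using a T by (simp add: powr_mult)
      have "enn_powr (ennreal (2 ^ k * (?M * (e * S)))) q \<le> enn_powr (ennreal (2 ^ k * ?M * e * T)) q"
      proof (intro enn_powr_mono q0 ennreal_leI)
        have "2 ^ k * ?M * (e * S) \<le> 2 ^ k * ?M * (e * T)" using e S by (intro mult_left_mono) auto
        then show "2 ^ k * (?M * (e * S)) \<le> 2 ^ k * ?M * e * T" by (simp only: mult.assoc)
      qed
      then show "enn_powr (ennreal (2 ^ k * (?M * (e * S)))) q \<le> ?B" using e S T by (simp add: powr_mult)
      have "enn_powr (ennreal (2 ^ k) * ?\<Sigma>) q = ennreal ((2 ^ k) powr q) * enn_powr ?\<Sigma> q" by (simp add: enn_powr_mult)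
      also have "\<dots> \<le> ennreal ((2 ^ k) powr q) * (ennreal (real k powr q) * (\<Sum>j\<in>{1..k}. enn_powr (mean_diff (x + (real j * \<rho>) *\<^sub>R v) \<rho>) q))"
        using enn_powr_sum_le[of "{1..k}" q "\<lambda>j. mean_diff (x + (real j * \<rho>) *\<^sub>R v) \<rho>"] q0 by (intro mult_left_mono) auto
      finally show "enn_powr (ennreal (2 ^ k) * ?\<Sigma>) q \<le> ?s * (\<Sum>j\<in>{1..k}. enn_powr (mean_diff (x + (real j * \<rho>) *\<^sub>R v) \<rho>) q)"
        by (simp add: ennreal_mult mult.assoc)
    qed auto
    finally show ?thesis .
  qed
  have "(\<integral>\<^sup>+v. enn_powr (d (\<rho> *\<^sub>R v) x) q \<partial>unif_ball) \<le> (\<integral>\<^sup>+v. ennreal (2 powr q) * (?A + ennreal (2 powr q) * (?B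
      + ?s * (\<Sum>j\<in>{1..k}. enn_powr (mean_diff (x + (real j * \<rho>) *\<^sub>R v) \<rho>) q))) \<partial>unif_ball)"
    by (rule nn_integral_mono_AE, rule AE_mp[OF AE_unif_ball_norm], rule AE_I2, rule impI, rule pt)
  also have "\<dots> = ennreal (2 powr q) * (?A + ennreal (2 powr q) * (?B
      + ?s * (\<Sum>j\<in>{1..k}. (\<integral>\<^sup>+v. enn_powr (mean_diff (x + (real j * \<rho>) *\<^sub>R v) \<rho>) q \<partial>unif_ball))))"
    by (simp add: nn_integral_add nn_integral_cmult nn_integral_sum)
  also have "\<dots> \<le> ennreal (2 powr q) * (?A + ennreal (2 powr q) * (?B
      + ?s * (\<Sum>j\<in>{1..k}. ennreal (?M * ((e + ?c) * T powr q)))))"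
    by (intro mult_left_mono add_left_mono sum_mono *) auto
  also have "\<dots> = ennreal (2 powr q * (a powr q * T powr q + 2 powr q * ((2 ^ k * ?M * e) powr q * T powr q
      + (2 ^ k) powr q * real k powr q * (real k * (?M * ((e + ?c) * T powr q))))))"
    using e c by (simp add: ennreal_mult[symmetric] ennreal_plus[symmetric] ennreal_of_nat_eq_real_of_nat del: ennreal_plus)
  also have "2 powr q * (a powr q * T powr q + 2 powr q * ((2 ^ k * ?M * e) powr q * T powr q
      + (2 ^ k) powr q * real k powr q * (real k * (?M * ((e + ?c) * T powr q)))))
      = scale_const CARD('n) k q a e ?c * T powr q"
  proof -
    have "4 powr q = 2 powr q * 2 powr q" by (simp add: powr_mult[symmetric])
    then show ?thesis by (simp add: scale_const_def algebra_simps)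
  qed
  finally show ?thesis .
qed

text \<open>Summing the differences between consecutive dyadic scales; the means tend to \<open>0\<close> with the radius.\<close>

lemma mean_diff_x_le_interpolated:
  assumes \<theta>: "0 < \<theta>" "\<theta> < 1" and \<rho>: "0 < \<rho>"
  shows "mean_diff x \<rho> \<le> ennreal (halving_const CARD('n) k K \<theta> * (F powr (1 - \<theta>) * H \<rho> powr \<theta>))"
proof -
  define B where "B \<rho> = F powr (1 - \<theta>) * H \<rho> powr \<theta>" for \<rho>
  define e where "e = 2 * 2 ^ k * 2 ^ CARD('n) * (1 + K * real k ^ k)"
  define c where "c = 2 ^ k * (2 * (2 * real k) ^ CARD('n) * e)"
  define \<beta> where "\<beta> = ((1 / 2) ^ k :: real) powr \<theta>"
  have \<beta>: "0 \<le> \<beta>" "\<beta> < 1" using half_power_powr_less_1[OF k \<theta>(1)] by (auto simp: \<beta>_def)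
  have hc: "halving_const CARD('n) k K \<theta> = c / (1 - \<beta>)" by (simp add: halving_const_def c_def e_def \<beta>_def)
  have e0: "0 \<le> e" "0 \<le> c" using K by (auto simp: e_def c_def)
  have B0: "0 \<le> B \<rho>" for \<rho> by (simp add: B_def)
  have Bhalf: "B (\<rho> / 2) = \<beta> * B \<rho>" if "0 < \<rho>" for \<rho>
  proof -
    have "H (\<rho> / 2) = (1 / 2) ^ k * H \<rho>" by (simp add: power_divide)
    then show ?thesis using that G by (simp add: B_def \<beta>_def powr_mult del: power_one_over)
  qed
  \<comment> \<open>The weighted geometric mean dominates the minimum, so it suffices to use
    whichever of the bounds by \<open>F\<close> and by \<open>H \<rho>\<close> is smaller.\<close>
  have minB: "min F (H \<rho>) \<le> B \<rho>" if "0 < \<rho>" for \<rho>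
  proof -
    define m where "m = min F (H \<rho>)"
    have m: "0 < m" "m \<le> F" "m \<le> H \<rho>" using F G that by (auto simp: m_def)
    have "m = m powr (1 - \<theta>) * m powr \<theta>" using m by (simp add: powr_add[symmetric])
    also have "\<dots> \<le> B \<rho>" unfolding B_def using m \<theta> by (intro mult_mono powr_mono2) auto
    finally show ?thesis by (simp add: m_def)
  qed
  have E: "(\<integral>\<^sup>+v. d h (x + (real k * \<rho>) *\<^sub>R v) \<partial>unif_ball) \<le> ennreal (e * B \<rho>)"
    if \<rho>: "0 < \<rho>" and h: "norm h \<le> \<rho>" for \<rho> h
  proof (cases "F \<le> H \<rho>")
    case True
    note mean_diff_translate_le_F[OF \<rho> h]
    also have "ennreal (2 * 2 ^ k * 2 ^ CARD('n) * F) \<le> ennreal (e * B \<rho>)"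
      using minB[OF \<rho>] True F K by (intro ennreal_leI mult_mono) (auto simp: e_def)
    finally show ?thesis .
  next
    case False
    note mean_diff_translate_le_G[OF \<rho> h]
    also have "ennreal (2 * 2 ^ CARD('n) * K * real k ^ k * H \<rho>) \<le> ennreal (e * B \<rho>)"
    proof (intro ennreal_leI mult_mono)
      have "2 * 2 ^ CARD('n) * (K * real k ^ k) \<le> 2 * 2 ^ CARD('n) * (1 + K * real k ^ k)" by simp
      also have "\<dots> \<le> 2 ^ k * (2 * 2 ^ CARD('n) * (1 + K * real k ^ k))"
        using mult_right_mono[OF one_le_power[of "2 :: real" k], of "2 * 2 ^ CARD('n) * (1 + K * real k ^ k)"] K by simp
      finally show "2 * 2 ^ CARD('n) * K * real k ^ k \<le> e" by (simp add: e_def mult_ac)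
      show "H \<rho> \<le> B \<rho>" using minB[OF \<rho>] False by simp
    qed (use G \<rho> e0 in auto)
    finally show ?thesis .
  qed
  have step: "mean_diff x \<rho> \<le> mean_diff x (\<rho> / 2) + ennreal (c * B \<rho>)" if "0 < \<rho>" for \<rho>
    using mean_diff_halve[OF that _ E[OF that]] e0 B0 by (simp add: c_def mult_ac)
  \<comment> \<open>\<open>B\<close> shrinks by the factor \<beta> at each halving, and
    \<open>c / (1 - \<beta>)\<close> is the fixed point of
    \<open>C \<mapsto> \<beta> * C + c\<close>, so the induction reproduces the constant.\<close>
  have iter: "mean_diff x \<rho> \<le> ennreal (c / (1 - \<beta>) * B \<rho>) + mean_diff x (\<rho> / 2 ^ m)" if "0 < \<rho>" for \<rho> m
    using that
  proof (induction m arbitrary: \<rho>)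
    case 0
    then show ?case by (simp add: add_increasing)
  next
    case (Suc m)
    have "mean_diff x \<rho> \<le> mean_diff x (\<rho> / 2) + ennreal (c * B \<rho>)" by (rule step[OF Suc.prems])
    also have "\<dots> \<le> (ennreal (c / (1 - \<beta>) * B (\<rho> / 2)) + mean_diff x (\<rho> / 2 / 2 ^ m)) + ennreal (c * B \<rho>)"
      using Suc.prems by (intro add_right_mono Suc.IH) auto
    also have "\<dots> = (ennreal (c / (1 - \<beta>) * B (\<rho> / 2)) + ennreal (c * B \<rho>)) + mean_diff x (\<rho> / 2 ^ Suc m)"
      by (simp add: add_ac)
    also have "ennreal (c / (1 - \<beta>) * B (\<rho> / 2)) + ennreal (c * B \<rho>) = ennreal (c / (1 - \<beta>) * B \<rho>)"
    proof -
      have "c / (1 - \<beta>) * (\<beta> * B \<rho>) + c * B \<rho> = c / (1 - \<beta>) * B \<rho>" using \<beta> by (simp add: field_simps)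
      then show ?thesis
        using Bhalf[OF Suc.prems] e0 \<beta> B0 by (simp add: ennreal_plus[symmetric] del: ennreal_plus)
    qed
    finally show ?case .
  qed
  show ?thesis unfolding hc B_def[symmetric]
  proof (rule ennreal_le_epsilon)
    fix \<epsilon> :: real assume \<epsilon>: "0 < \<epsilon>"
    define C where "C = 2 * K * real k ^ k * H \<rho>"
    have C: "0 < C" using K G \<rho> k_pos by (simp add: C_def)
    obtain m where m: "(1 / 2 :: real) ^ m < \<epsilon> / C" using real_arch_pow_inv[of "\<epsilon> / C" "1 / 2"] \<epsilon> C by auto
    have "mean_diff x (\<rho> / 2 ^ m) \<le> ennreal (2 * K * real k ^ k * H (\<rho> / 2 ^ m))"
      using \<rho> by (intro mean_diff_x_le) simp
    also have "\<dots> \<le> ennreal \<epsilon>"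
    proof (intro ennreal_leI)
      have "H (\<rho> / 2 ^ m) = ((1 / 2) ^ m) ^ k * H \<rho>" by (simp add: power_divide)
      then have "2 * K * real k ^ k * H (\<rho> / 2 ^ m) = C * ((1 / 2) ^ m) ^ k" by (simp only: C_def mult_ac)
      moreover have "((1 / 2 :: real) ^ m) ^ k \<le> (1 / 2) ^ m"
        using power_decreasing[of 1 k "(1 / 2 :: real) ^ m"] k by (simp add: power_le_one del: power_one_over)
      ultimately have "2 * K * real k ^ k * H (\<rho> / 2 ^ m) \<le> C * (1 / 2) ^ m"
        using C by (simp only: mult_left_mono less_imp_le)
      also have "\<dots> \<le> \<epsilon>" using m C by (simp add: pos_less_divide_eq mult.commute less_imp_le del: power_one_over)
      finally show "2 * K * real k ^ k * H (\<rho> / 2 ^ m) \<le> \<epsilon>" .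
    qed
    finally show "mean_diff x \<rho> \<le> ennreal (c / (1 - \<beta>) * B \<rho>) + ennreal \<epsilon>"
      using order_trans[OF iter[OF \<rho>, of m] add_left_mono] by blast
  qed
qed

text \<open>With \<open>S\<close>, \<open>T\<close> and \<open>l\<close> all equal to
  \<open>H \<rho>\<close>, both side conditions of \<open>mean_powr_d_le\<close> hold with equality.
  The exponent \<theta> enters only through the common constant.\<close>

lemma mean_powr_d_le_small:
  assumes \<rho>: "0 < \<rho>" and q: "1 \<le> q" "q < p" and p: "r \<le> p" and lt: "real CARD('n) * (1 / r - 1 / p) < real k"
    and \<theta>: "0 < \<theta>"
  shows "(\<integral>\<^sup>+v. enn_powr (d (\<rho> *\<^sub>R v) x) q \<partial>unif_ball) \<le> ennreal (total_const CARD('n) k K q r p \<theta> * H \<rho> powr q)"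
proof -
  have H: "0 < H \<rho>" using G \<rho> by simp
  have "(\<integral>\<^sup>+v. enn_powr (d (\<rho> *\<^sub>R v) x) q \<partial>unif_ball)
      \<le> ennreal (scale_const CARD('n) k q (2 * K * real k ^ k) (2 * 2 ^ CARD('n) * K * real k ^ k) (moment_const CARD('n) k K r p) * H \<rho> powr q)"
  proof (rule mean_powr_d_le[OF \<rho> q(1) _ p lt, where l="H \<rho>" and S="H \<rho>"])
    show "H \<rho> powr (q - 1) * H \<rho> \<le> H \<rho> powr q" using H by (simp add: powr_diff)
    show "H \<rho> powr (q - p) * H \<rho> powr p \<le> H \<rho> powr q" using H by (simp add: powr_add[symmetric])
  qed (use q K G \<rho> mean_diff_translate_le_G mean_diff_x_le in auto)
  also have "\<dots> \<le> ennreal (total_const CARD('n) k K q r p \<theta> * H \<rho> powr q)"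
    using K k \<theta> by (intro ennreal_leI mult_right_mono)
      (auto simp: total_const_def intro!: scale_const_nonneg moment_const_nonneg)
  finally show ?thesis .
qed

lemma mean_powr_d_le_large:
  assumes \<rho>: "0 < \<rho>" and q: "1 \<le> q" "q < p" and p: "r \<le> p" and lt: "real CARD('n) * (1 / r - 1 / p) < real k"
    and \<theta>: "0 < \<theta>" "\<theta> < 1" "p * (q - 1) \<le> \<theta> * q * (p - 1)" and FH: "F \<le> H \<rho>"
  shows "(\<integral>\<^sup>+v. enn_powr (d (\<rho> *\<^sub>R v) x) q \<partial>unif_ball)
    \<le> ennreal (total_const CARD('n) k K q r p \<theta> * (F powr (1 - \<theta>) * H \<rho> powr \<theta>) powr q)"
proof -
  have H: "0 < H \<rho>" using G \<rho> by simp
  define s where "s = H \<rho> / F"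
  have s: "1 \<le> s" and Hs: "H \<rho> = F * s" using FH F by (auto simp: s_def)
  \<comment> \<open>The level that balances the two ends: it solves
    \<open>l powr (q - 1) * F = l powr (q - p) * H \<rho> powr p\<close>.\<close>
  define l where "l = F * s powr (p / (p - 1))"
  have p1: "1 < p" using q by simp
  define T where "T = F powr (1 - \<theta>) * H \<rho> powr \<theta>"
  have T: "T = F * s powr \<theta>"
    using F s unfolding T_def Hs by (simp add: powr_mult mult.assoc[symmetric] powr_add[symmetric])
  have Tq: "T powr q = F powr q * s powr (\<theta> * q)" using F s by (simp add: T powr_mult powr_powr)
  \<comment> \<open>The lower bound on \<theta> enters here: as \<open>s \<ge> 1\<close>, comparing
    exponents of \<open>s\<close> is enough.\<close>
  have exp: "p / (p - 1) * (q - 1) \<le> \<theta> * q"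
    using \<theta>(3) p1 by (simp add: pos_divide_le_eq)
  have 1: "l powr (q - 1) * F = F powr q * s powr (p / (p - 1) * (q - 1))"
  proof -
    have "F powr (q - 1) * F = F powr q" using F by (simp add: powr_diff)
    moreover have "l powr (q - 1) * F = (F powr (q - 1) * F) * s powr (p / (p - 1) * (q - 1))"
      unfolding l_def using F s by (simp add: powr_mult powr_powr mult_ac)
    ultimately show ?thesis by simp
  qed
  have 2: "l powr (q - p) * H \<rho> powr p = F powr q * s powr (p / (p - 1) * (q - 1))"
  proof -
    have "p / (p - 1) * (q - p) + p = p / (p - 1) * (q - 1)" using p1 by (simp add: field_simps)
    then have "s powr (p / (p - 1) * (q - p)) * s powr p = s powr (p / (p - 1) * (q - 1))"
      using s by (simp add: powr_add[symmetric])
    moreover have "F powr (q - p) * F powr p = F powr q" using F by (simp add: powr_add[symmetric])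
    moreover have "l powr (q - p) * H \<rho> powr p = (F powr (q - p) * F powr p) * (s powr (p / (p - 1) * (q - p)) * s powr p)"
      unfolding l_def Hs using F s by (simp add: powr_mult powr_powr mult_ac)
    ultimately show ?thesis by simp
  qed
  have le: "F powr q * s powr (p / (p - 1) * (q - 1)) \<le> T powr q"
    unfolding Tq using s exp by (intro mult_left_mono powr_mono) auto
  have "(\<integral>\<^sup>+v. enn_powr (d (\<rho> *\<^sub>R v) x) q \<partial>unif_ball)
      \<le> ennreal (scale_const CARD('n) k q (halving_const CARD('n) k K \<theta>) (2 * 2 ^ k * 2 ^ CARD('n)) (moment_const CARD('n) k K r p) * T powr q)"
  proof (rule mean_powr_d_le[OF \<rho> q(1) _ p lt, where l=l and S=F])
    show "F \<le> T" unfolding T using F s \<theta> by (simp add: ge_one_powr_ge_zero)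
    show "0 < l" using F s by (simp add: l_def)
    show "mean_diff x \<rho> \<le> ennreal (halving_const CARD('n) k K \<theta> * T)"
      unfolding T_def by (rule mean_diff_x_le_interpolated[OF \<theta>(1,2) \<rho>])
    show "l powr (q - 1) * F \<le> T powr q" "l powr (q - p) * H \<rho> powr p \<le> T powr q"
      using 1 2 le by auto
  qed (use q F \<rho> mean_diff_translate_le_F halving_const_nonneg[OF k K \<theta>(1)] in auto)
  also have "\<dots> \<le> ennreal (total_const CARD('n) k K q r p \<theta> * T powr q)"
    using K k \<theta> by (intro ennreal_leI mult_right_mono)
      (auto simp: total_const_def intro!: scale_const_nonneg moment_const_nonneg)
  finally show ?thesis by (simp add: T_def)
qed

text \<open>The terms of the difference with \<open>j \<ge> 1\<close> are bounded directly by the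
  \<open>q\<close>-th power means of \<open>f\<close>, so no sum over dyadic scales occurs. Only the
  value \<open>f x\<close> needs an argument.\<close>

lemma mean_powr_d_le_of_mean_powr:
  assumes q: "1 \<le> q" and mq: "\<And>R. 0 < R \<Longrightarrow> (\<integral>\<^sup>+w. ennreal (\<bar>f (x + R *\<^sub>R w)\<bar> powr q) \<partial>unif_ball) \<le> ennreal (F powr q)"
    and \<rho>: "0 < \<rho>"
  shows "(\<integral>\<^sup>+v. enn_powr (d (\<rho> *\<^sub>R v) x) q \<partial>unif_ball)
    \<le> ennreal ((4 powr q * (2 ^ k) powr q + 2 powr q * ((2 ^ k) powr q * real k powr q * real k)) * F powr q)"
proof -
  have q0: "0 \<le> q" using q by simp
  have m1: "(\<integral>\<^sup>+w. ennreal \<bar>f (x + R *\<^sub>R w)\<bar> \<partial>unif_ball) \<le> ennreal (2 * F)" if "0 < R" for R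
  proof -
    have "(\<integral>\<^sup>+w. ennreal \<bar>f (x + R *\<^sub>R w)\<bar> \<partial>unif_ball)
        \<le> (\<integral>\<^sup>+w. ennreal F + ennreal (F powr (1 - q)) * ennreal (\<bar>f (x + R *\<^sub>R w)\<bar> powr q) \<partial>unif_ball)"
    proof (intro nn_integral_mono)
      fix w
      show "ennreal \<bar>f (x + R *\<^sub>R w)\<bar> \<le> ennreal F + ennreal (F powr (1 - q)) * ennreal (\<bar>f (x + R *\<^sub>R w)\<bar> powr q)"
        using ennreal_le_const_powr[OF F q, of "ennreal \<bar>f (x + R *\<^sub>R w)\<bar>"] by simp
    qed
    also have "\<dots> = ennreal F + ennreal (F powr (1 - q)) * (\<integral>\<^sup>+w. ennreal (\<bar>f (x + R *\<^sub>R w)\<bar> powr q) \<partial>unif_ball)"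
      by (simp add: nn_integral_add nn_integral_cmult)
    also have "\<dots> \<le> ennreal F + ennreal (F powr (1 - q)) * ennreal (F powr q)"
      by (intro add_left_mono mult_left_mono mq that) simp
    also have "\<dots> = ennreal (2 * F)"
      using F by (simp add: ennreal_mult[symmetric] powr_add[symmetric] ennreal_plus[symmetric] del: ennreal_plus)
    finally show ?thesis .
  qed
  have alt: "\<bar>fin_diff k h f x - (-1) ^ k * f x\<bar> \<le> (\<Sum>j\<in>{1..k}. real (k choose j) * \<bar>f (x + real j *\<^sub>R h)\<bar>)" for h
  proof -
    have "{..k} = insert 0 {1..k}" by auto
    then have "fin_diff k h f x - (-1) ^ k * f x = (\<Sum>j\<in>{1..k}. (-1) ^ (k - j) * real (k choose j) * f (x + real j *\<^sub>R h))"
      by (simp add: fin_diff_def)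
    then show ?thesis by (auto simp: abs_mult power_abs intro: order_trans[OF sum_abs])
  qed
  have abs_fx: "\<bar>(-1) ^ k * f x\<bar> = \<bar>f x\<bar>" by (simp add: abs_mult power_abs)
  have f_le: "ennreal \<bar>f x\<bar> \<le> d h x + (\<Sum>j\<in>{1..k}. ennreal (real (k choose j)) * ennreal \<bar>f (x + real j *\<^sub>R h)\<bar>)" for h
  proof -
    have "\<bar>f x\<bar> \<le> \<bar>fin_diff k h f x\<bar> + (\<Sum>j\<in>{1..k}. real (k choose j) * \<bar>f (x + real j *\<^sub>R h)\<bar>)"
      using alt[of h] abs_fx by linarith
    then show ?thesis
      by (simp add: ennreal_mult[symmetric] sum_ennreal sum_nonneg ennreal_plus[symmetric] ennreal_leI del: ennreal_plus)
  qed
  have d_le: "d h x \<le> ennreal \<bar>f x\<bar> + ennreal (2 ^ k) * (\<Sum>j\<in>{1..k}. ennreal \<bar>f (x + real j *\<^sub>R h)\<bar>)" for h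
  proof -
    have "\<bar>fin_diff k h f x\<bar> \<le> \<bar>f x\<bar> + (\<Sum>j\<in>{1..k}. real (k choose j) * \<bar>f (x + real j *\<^sub>R h)\<bar>)"
      using alt[of h] abs_fx by linarith
    also have "(\<Sum>j\<in>{1..k}. real (k choose j) * \<bar>f (x + real j *\<^sub>R h)\<bar>) \<le> (\<Sum>j\<in>{1..k}. 2 ^ k * \<bar>f (x + real j *\<^sub>R h)\<bar>)"
    proof (intro sum_mono mult_right_mono)
      show "real (k choose j) \<le> 2 ^ k" for j
        using of_nat_le_iff[of "k choose j" "2 ^ k", where 'a=real] binomial_le_pow2[of k j] by (simp del: of_nat_le_iff)
    qed simp
    finally show ?thesis
      by (simp add: sum_distrib_left[symmetric] ennreal_mult[symmetric] sum_ennreal sum_nonneg ennreal_plus[symmetric] ennreal_leI del: ennreal_plus)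
  qed
  \<comment> \<open>A substitute for Lebesgue differentiation: the mean difference at
    \<open>x\<close> tends to 0 with the radius, so up to \<epsilon> the value \<open>f x\<close> is
    bounded by means of \<open>f\<close> over small balls.\<close>
  have fx: "ennreal \<bar>f x\<bar> \<le> ennreal (2 ^ k * (2 * F))"
  proof (rule ennreal_le_epsilon)
    fix \<epsilon> :: real assume \<epsilon>: "0 < \<epsilon>"
    define C where "C = 2 * K * real k ^ k * G"
    have C: "0 < C" using K G k_pos by (simp add: C_def)
    \<comment> \<open>The cap 1 gives \<open>R ^ k \<le> R\<close>, and the other entry gives
      \<open>C * R \<le> \<epsilon>\<close>.\<close>
    define R where "R = min 1 (\<epsilon> / C)"
    have R: "0 < R" "R \<le> 1" "R \<le> \<epsilon> / C" using \<epsilon> C by (auto simp: R_def)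
    have "ennreal \<bar>f x\<bar> = (\<integral>\<^sup>+w. ennreal \<bar>f x\<bar> \<partial>(unif_ball :: (real^'n) measure))" by simp
    also have "\<dots> \<le> (\<integral>\<^sup>+w. d (R *\<^sub>R w) x + (\<Sum>j\<in>{1..k}. ennreal (real (k choose j)) * ennreal \<bar>f (x + (real j * R) *\<^sub>R w)\<bar>) \<partial>unif_ball)"
      using f_le[of "R *\<^sub>R w" for w] by (intro nn_integral_mono) simp
    also have "\<dots> = mean_diff x R + (\<Sum>j\<in>{1..k}. ennreal (real (k choose j)) * (\<integral>\<^sup>+w. ennreal \<bar>f (x + (real j * R) *\<^sub>R w)\<bar> \<partial>unif_ball))"
      by (simp add: nn_integral_add nn_integral_sum nn_integral_cmult mean_diff_def)
    also have "\<dots> \<le> ennreal \<epsilon> + ennreal (2 ^ k * (2 * F))"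
    proof (intro add_mono sum_ennreal_binomial_le m1)
      note mean_diff_x_le[OF R(1)]
      also have "ennreal (2 * K * real k ^ k * H R) \<le> ennreal \<epsilon>"
      proof (intro ennreal_leI)
        have "R ^ k \<le> R ^ 1" using R k by (intro power_decreasing) auto
        then have "C * R ^ k \<le> C * R" using C by simp
        also have "\<dots> \<le> \<epsilon>" using R(3) C by (simp add: pos_le_divide_eq mult.commute)
        finally show "2 * K * real k ^ k * H R \<le> \<epsilon>" by (simp add: C_def mult_ac)
      qed
      finally show "mean_diff x R \<le> ennreal \<epsilon>" .
    qed (use R F in auto)
    finally show "ennreal \<bar>f x\<bar> \<le> ennreal (2 ^ k * (2 * F)) + ennreal \<epsilon>" by (simp add: add.commute)
  qed
  let ?s = "ennreal ((2 ^ k) powr q * real k powr q)"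
  have pt: "enn_powr (d h x) q \<le> ennreal (2 powr q) * (ennreal ((2 ^ k * (2 * F)) powr q) + ?s * (\<Sum>j\<in>{1..k}. ennreal (\<bar>f (x + real j *\<^sub>R h)\<bar> powr q)))" for h
  proof -
    let ?\<Sigma> = "\<Sum>j\<in>{1..k}. ennreal \<bar>f (x + real j *\<^sub>R h)\<bar>"
    have "enn_powr (d h x) q \<le> enn_powr (ennreal \<bar>f x\<bar> + ennreal (2 ^ k) * ?\<Sigma>) q"
      by (intro enn_powr_mono q0 d_le)
    also have "\<dots> \<le> ennreal (2 powr q) * (enn_powr (ennreal \<bar>f x\<bar>) q + enn_powr (ennreal (2 ^ k) * ?\<Sigma>) q)"
      by (rule enn_powr_add_le[OF q0])
    also have "\<dots> \<le> ennreal (2 powr q) * (ennreal ((2 ^ k * (2 * F)) powr q) + ?s * (\<Sum>j\<in>{1..k}. ennreal (\<bar>f (x + real j *\<^sub>R h)\<bar> powr q)))"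
    proof (intro mult_left_mono add_mono)
      show "enn_powr (ennreal \<bar>f x\<bar>) q \<le> ennreal ((2 ^ k * (2 * F)) powr q)"
        using enn_powr_mono[OF q0 fx] F by simp
      have "enn_powr (ennreal (2 ^ k) * ?\<Sigma>) q = ennreal ((2 ^ k) powr q) * enn_powr ?\<Sigma> q" by (simp add: enn_powr_mult)
      also have "\<dots> \<le> ennreal ((2 ^ k) powr q) * (ennreal (real k powr q) * (\<Sum>j\<in>{1..k}. ennreal (\<bar>f (x + real j *\<^sub>R h)\<bar> powr q)))"
        using enn_powr_sum_le[of "{1..k}" q "\<lambda>j. ennreal \<bar>f (x + real j *\<^sub>R h)\<bar>"] q0 by (intro mult_left_mono) auto
      finally show "enn_powr (ennreal (2 ^ k) * ?\<Sigma>) q \<le> ?s * (\<Sum>j\<in>{1..k}. ennreal (\<bar>f (x + real j *\<^sub>R h)\<bar> powr q))"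
        by (simp add: ennreal_mult mult.assoc)
    qed auto
    finally show ?thesis .
  qed
  have "(\<integral>\<^sup>+v. enn_powr (d (\<rho> *\<^sub>R v) x) q \<partial>unif_ball)
      \<le> (\<integral>\<^sup>+v. ennreal (2 powr q) * (ennreal ((2 ^ k * (2 * F)) powr q) + ?s * (\<Sum>j\<in>{1..k}. ennreal (\<bar>f (x + (real j * \<rho>) *\<^sub>R v)\<bar> powr q))) \<partial>unif_ball)"
    using pt[of "\<rho> *\<^sub>R v" for v] by (intro nn_integral_mono) simp
  also have "\<dots> = ennreal (2 powr q) * (ennreal ((2 ^ k * (2 * F)) powr q) + ?s * (\<Sum>j\<in>{1..k}. (\<integral>\<^sup>+v. ennreal (\<bar>f (x + (real j * \<rho>) *\<^sub>R v)\<bar> powr q) \<partial>unif_ball)))"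
    by (simp add: nn_integral_add nn_integral_cmult nn_integral_sum del: sum_ennreal)
  also have "\<dots> \<le> ennreal (2 powr q) * (ennreal ((2 ^ k * (2 * F)) powr q) + ?s * (\<Sum>j\<in>{1..k}. ennreal (F powr q)))"
    using \<rho> by (intro mult_left_mono add_left_mono sum_mono mq) auto
  also have "\<dots> = ennreal (2 powr q * ((2 ^ k * (2 * F)) powr q + (2 ^ k) powr q * real k powr q * (real k * F powr q)))"
    by (simp add: ennreal_mult[symmetric] ennreal_plus[symmetric] ennreal_of_nat_eq_real_of_nat del: ennreal_plus)
  also have "2 powr q * ((2 ^ k * (2 * F)) powr q + (2 ^ k) powr q * real k powr q * (real k * F powr q))
      = (4 powr q * (2 ^ k) powr q + 2 powr q * ((2 ^ k) powr q * real k powr q * real k)) * F powr q"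
  proof -
    have "4 powr q = 2 powr q * 2 powr q" by (simp add: powr_mult[symmetric])
    then show ?thesis using F by (simp add: powr_mult algebra_simps)
  qed
  finally show ?thesis .
qed

end

section \<open>Integration over all scales\<close>

text \<open>The singular weight is a superposition of indicators of balls, which turns an integral
  over steps into one over radii. At \<open>h = 0\<close> the left-hand side would be 0 by
  convention and the right-hand side infinite.\<close>

lemma norm_powr_layer_cake:
  fixes h :: "'a::real_normed_vector"
  assumes "h \<noteq> 0" "0 < \<beta>"
  shows "ennreal (norm h powr - \<beta>) = (\<integral>\<^sup>+\<rho>. ennreal (\<beta> * \<rho> powr (- \<beta> - 1)) * indicator {norm h<..} \<rho> \<partial>lborel)"
proof -
  have h: "0 < norm h" using assms by simp
  have "((\<lambda>\<rho>. \<beta> * \<rho> powr (- \<beta> - 1)) has_integral \<beta> * (- (norm h powr (- \<beta> - 1 + 1)) / (- \<beta> - 1 + 1))) {norm h..}"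
    using assms h by (intro has_integral_mult_right has_integral_powr_to_inf) auto
  then have "(\<integral>\<^sup>+\<rho>. ennreal (\<beta> * \<rho> powr (- \<beta> - 1)) * indicator {norm h..} \<rho> \<partial>lborel)
      = ennreal (\<beta> * (- (norm h powr (- \<beta> - 1 + 1)) / (- \<beta> - 1 + 1)))"
    using assms by (intro nn_integral_has_integral_lebesgue') auto
  also have "\<beta> * (- (norm h powr (- \<beta> - 1 + 1)) / (- \<beta> - 1 + 1)) = norm h powr - \<beta>" using assms by simp
  finally have "ennreal (norm h powr - \<beta>) = (\<integral>\<^sup>+\<rho>. ennreal (\<beta> * \<rho> powr (- \<beta> - 1)) * indicator {norm h..} \<rho> \<partial>lborel)" ..
  also have "\<dots> = (\<integral>\<^sup>+\<rho>. ennreal (\<beta> * \<rho> powr (- \<beta> - 1)) * indicator {norm h<..} \<rho> \<partial>lborel)"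
  proof (rule nn_integral_cong_AE)
    show "AE \<rho> in lborel. ennreal (\<beta> * \<rho> powr (- \<beta> - 1)) * indicator {norm h..} \<rho> = ennreal (\<beta> * \<rho> powr (- \<beta> - 1)) * indicator {norm h<..} \<rho>"
      using AE_lborel_singleton[of "norm h"] by eventually_elim (auto simp: indicator_def)
  qed
  finally show ?thesis .
qed

text \<open>Up to the splitting radius the integral over radii converges because
  \<open>s < 1\<close> and contributes \<open>1 / (1 - s)\<close>; beyond it, convergence comes from
  \<open>s > \<theta>\<close> and the contribution is \<open>1 / (s - \<theta>)\<close>.\<close>

lemma nn_integral_scales_le:
  fixes D :: "real^'n::finite \<Rightarrow> ennreal"
  assumes [measurable]: "D \<in> borel_measurable borel"
    and s: "0 < s" "s < 1" and \<theta>: "0 \<le> \<theta>" "\<theta> < s" and q: "1 \<le> q" and k: "1 \<le> k" and C: "0 \<le> C" and F: "0 < F" and G: "0 < G"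
    and small: "\<And>\<rho>. 0 < \<rho> \<Longrightarrow> (\<integral>\<^sup>+v. D (\<rho> *\<^sub>R v) \<partial>unif_ball) \<le> ennreal (C * (\<rho> ^ k * G) powr q)"
    and large: "\<And>\<rho>. 0 < \<rho> \<Longrightarrow> F \<le> \<rho> ^ k * G \<Longrightarrow> (\<integral>\<^sup>+v. D (\<rho> *\<^sub>R v) \<partial>unif_ball) \<le> ennreal (C * (F powr (1 - \<theta>) * (\<rho> ^ k * G) powr \<theta>) powr q)"
  shows "(\<integral>\<^sup>+h. D h * ennreal (norm h powr - (real CARD('n) + s * real k * q)) \<partial>lborel)
    \<le> ennreal (C * unit_ball_vol (real CARD('n)) * (real CARD('n) + real k * q) / (real k * q) * inverse ((s - \<theta>) * (1 - s)) * (F powr (1 - s) * G powr s) powr q)"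
proof -
  let ?n = "real CARD('n)"
  define \<beta> where "\<beta> = ?n + s * real k * q"
  define V where "V = unit_ball_vol ?n"
  have V: "0 < V" by (simp add: V_def)
  have kq: "0 < real k * q" using k q by simp
  have \<beta>: "0 < \<beta>" using s kq by (simp add: \<beta>_def add_pos_pos mult.assoc)
  \<comment> \<open>A bound on \<beta> without \<open>s\<close>, so that the final constant can be
    independent of \<open>s\<close>.\<close>
  have \<beta>_le: "\<beta> \<le> ?n + real k * q" using s kq mult_right_mono[of s 1 "real k * q"] by (simp add: \<beta>_def mult.assoc)
  have kq0: "0 < q" "0 < real k" using q k by auto
  define R where "R = (F / G) powr (1 / real k)"
  have R: "0 < R" using F G by (simp add: R_def)
  have Rk: "R powr (real k * a) = (F / G) powr a" for a using kq0 F G by (simp add: R_def powr_powr)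
  have R_ge: "F \<le> \<rho> ^ k * G" if "R \<le> \<rho>" for \<rho>
  proof -
    have "F / G = R ^ k" using Rk[of 1] R F G by (simp add: powr_realpow)
    also have "\<dots> \<le> \<rho> ^ k" using R that by (intro power_mono) auto
    finally show ?thesis using G by (simp add: pos_divide_le_eq)
  qed
  let ?a = "real k * (q * (1 - s))" and ?b = "real k * (q * (s - \<theta>))"
  have ab: "0 < ?a" "0 < ?b" using kq0 s \<theta> by auto
  \<comment> \<open>Each branch is a pure power of \<rho>: the exponents of the layer-cake density,
    of the ball volume and of the assumed mean bound are added.\<close>
  define \<Psi> where "\<Psi> \<rho> = ennreal (\<beta> * V * C * G powr q) * (ennreal (\<rho> powr (?a - 1)) * indicator {0..R} \<rho>)
     + ennreal (\<beta> * V * C * (F powr (1 - \<theta>) * G powr \<theta>) powr q) * (ennreal (\<rho> powr (- ?b - 1)) * indicator {R..} \<rho>)" for \<rho>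
  have inner: "(\<integral>\<^sup>+h. D h * (ennreal (\<beta> * \<rho> powr (- \<beta> - 1)) * indicator {norm h<..} \<rho>) \<partial>lborel) \<le> \<Psi> \<rho>" for \<rho>
  proof (cases "0 < \<rho>")
    case True
    have [measurable]: "ball (0::real^'n) \<rho> \<in> sets borel" by simp
    have "(\<integral>\<^sup>+h. D h * (ennreal (\<beta> * \<rho> powr (- \<beta> - 1)) * indicator {norm h<..} \<rho>) \<partial>lborel)
        = (\<integral>\<^sup>+h. ennreal (\<beta> * \<rho> powr (- \<beta> - 1)) * (D h * indicator (ball 0 \<rho>) h) \<partial>lborel)"
      by (intro nn_integral_cong) (auto split: split_indicator simp: mult.commute)
    also have "\<dots> = ennreal (\<beta> * \<rho> powr (- \<beta> - 1)) * (\<integral>\<^sup>+h\<in>ball 0 \<rho>. D h \<partial>lborel)"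
      by (rule nn_integral_cmult) measurable
    also have "(\<integral>\<^sup>+h\<in>ball 0 \<rho>. D h \<partial>lborel) = ennreal (V * \<rho> ^ CARD('n)) * (\<integral>\<^sup>+v. D (\<rho> *\<^sub>R v) \<partial>unif_ball)"
    proof -
      have e: "emeasure lborel (ball (0::real^'n) \<rho>) = ennreal (V * \<rho> ^ CARD('n))"
        using True by (simp add: emeasure_ball V_def)
      have p: "0 < V * \<rho> ^ CARD('n)" using V True by simp
      have "(\<integral>\<^sup>+v. D (\<rho> *\<^sub>R v) \<partial>unif_ball) = (\<integral>\<^sup>+h\<in>ball 0 \<rho>. D h \<partial>lborel) / ennreal (V * \<rho> ^ CARD('n))"
        using nn_integral_unif_ball[of D \<rho> 0] True by (simp add: e)
      then have "ennreal (V * \<rho> ^ CARD('n)) * (\<integral>\<^sup>+v. D (\<rho> *\<^sub>R v) \<partial>unif_ball)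
          = (ennreal (V * \<rho> ^ CARD('n)) * inverse (ennreal (V * \<rho> ^ CARD('n)))) * (\<integral>\<^sup>+h\<in>ball 0 \<rho>. D h \<partial>lborel)"
        by (simp add: divide_ennreal_def mult_ac)
      also have "ennreal (V * \<rho> ^ CARD('n)) * inverse (ennreal (V * \<rho> ^ CARD('n))) = 1"
      proof -
        have "ennreal Q * inverse (ennreal Q) = 1" if "0 < Q" for Q
          using that by (simp add: inverse_ennreal ennreal_mult[symmetric])
        then show ?thesis using p by blast
      qed
      finally show ?thesis by simp
    qed
    finally have e0: "(\<integral>\<^sup>+h. D h * (ennreal (\<beta> * \<rho> powr (- \<beta> - 1)) * indicator {norm h<..} \<rho>) \<partial>lborel)
        = ennreal (\<beta> * \<rho> powr (- \<beta> - 1)) * (ennreal (V * \<rho> ^ CARD('n)) * (\<integral>\<^sup>+v. D (\<rho> *\<^sub>R v) \<partial>unif_ball))" .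
    have eq: "(\<integral>\<^sup>+h. D h * (ennreal (\<beta> * \<rho> powr (- \<beta> - 1)) * indicator {norm h<..} \<rho>) \<partial>lborel)
        = ennreal (\<beta> * V * \<rho> powr (- s * real k * q - 1)) * (\<integral>\<^sup>+v. D (\<rho> *\<^sub>R v) \<partial>unif_ball)"
    proof -
      have "\<rho> ^ CARD('n) = \<rho> powr ?n" using True by (simp add: powr_realpow)
      then have "\<beta> * \<rho> powr (- \<beta> - 1) * (V * \<rho> ^ CARD('n)) = \<beta> * V * (\<rho> powr (- \<beta> - 1) * \<rho> powr ?n)" by simp
      also have "\<rho> powr (- \<beta> - 1) * \<rho> powr ?n = \<rho> powr (- s * real k * q - 1)"
        unfolding powr_add[symmetric] by (rule arg_cong[where f="\<lambda>z. \<rho> powr z"]) (simp add: \<beta>_def)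
      finally have "ennreal (\<beta> * \<rho> powr (- \<beta> - 1)) * ennreal (V * \<rho> ^ CARD('n)) = ennreal (\<beta> * V * \<rho> powr (- s * real k * q - 1))"
        using \<beta> V True by (simp add: ennreal_mult[symmetric])
      then show ?thesis using e0 by (simp only: mult.assoc[symmetric])
    qed
    have rk: "\<rho> ^ k = \<rho> powr real k" using True by (simp add: powr_realpow)
    show ?thesis
    proof (cases "\<rho> \<le> R")
      case le: True
      have "ennreal (\<beta> * V * \<rho> powr (- s * real k * q - 1)) * (\<integral>\<^sup>+v. D (\<rho> *\<^sub>R v) \<partial>unif_ball)
          \<le> ennreal (\<beta> * V * \<rho> powr (- s * real k * q - 1)) * ennreal (C * (\<rho> ^ k * G) powr q)"
        by (intro mult_left_mono small True) simp
      also have "\<dots> = ennreal (\<beta> * V * C * G powr q) * ennreal (\<rho> powr (?a - 1))"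
      proof -
        have e1: "\<rho> powr (- s * real k * q - 1) * \<rho> powr (real k * q) = \<rho> powr (?a - 1)"
          unfolding powr_add[symmetric] by (rule arg_cong[where f="\<lambda>z. \<rho> powr z"]) (simp add: algebra_simps)
        have e2: "(\<rho> ^ k * G) powr q = \<rho> powr (real k * q) * G powr q"
          using True G by (simp add: rk powr_mult powr_powr)
        have "\<beta> * V * \<rho> powr (- s * real k * q - 1) * (C * (\<rho> ^ k * G) powr q) = \<beta> * V * C * G powr q * \<rho> powr (?a - 1)"
          unfolding e2 e1[symmetric] by (simp only: mult_ac)
        then show ?thesis using \<beta> V C by (simp add: ennreal_mult[symmetric])
      qed
      also have "\<dots> \<le> \<Psi> \<rho>" using le True by (simp add: \<Psi>_def)
      finally show ?thesis unfolding eq .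
    next
      case False
      have "ennreal (\<beta> * V * \<rho> powr (- s * real k * q - 1)) * (\<integral>\<^sup>+v. D (\<rho> *\<^sub>R v) \<partial>unif_ball)
          \<le> ennreal (\<beta> * V * \<rho> powr (- s * real k * q - 1)) * ennreal (C * (F powr (1 - \<theta>) * (\<rho> ^ k * G) powr \<theta>) powr q)"
        using False by (intro mult_left_mono large True R_ge) auto
      also have "\<dots> = ennreal (\<beta> * V * C * (F powr (1 - \<theta>) * G powr \<theta>) powr q) * ennreal (\<rho> powr (- ?b - 1))"
      proof -
        have e1: "\<rho> powr (- s * real k * q - 1) * \<rho> powr (real k * \<theta> * q) = \<rho> powr (- ?b - 1)"
          unfolding powr_add[symmetric] by (rule arg_cong[where f="\<lambda>z. \<rho> powr z"]) (simp add: algebra_simps)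
        have e2: "(F powr (1 - \<theta>) * (\<rho> ^ k * G) powr \<theta>) powr q = \<rho> powr (real k * \<theta> * q) * (F powr (1 - \<theta>) * G powr \<theta>) powr q"
          using True G F by (simp add: rk powr_mult powr_powr mult_ac)
        have "\<beta> * V * \<rho> powr (- s * real k * q - 1) * (C * (F powr (1 - \<theta>) * (\<rho> ^ k * G) powr \<theta>) powr q)
            = \<beta> * V * C * (F powr (1 - \<theta>) * G powr \<theta>) powr q * \<rho> powr (- ?b - 1)"
          unfolding e2 e1[symmetric] by (simp only: mult_ac)
        then show ?thesis using \<beta> V C by (simp add: ennreal_mult[symmetric])
      qed
      also have "\<dots> \<le> \<Psi> \<rho>" using False by (simp add: \<Psi>_def)
      finally show ?thesis unfolding eq .
    qed
  next
    case False
    then have "indicator {norm h<..} \<rho> = (0::ennreal)" for h :: "real^'n"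
      using norm_ge_zero[of h] by (auto simp: indicator_def simp del: norm_ge_zero)
    then show ?thesis by simp
  qed
  have i1: "(\<integral>\<^sup>+\<rho>. ennreal (\<rho> powr (?a - 1)) * indicator {0..R} \<rho> \<partial>lborel) = ennreal ((F / G) powr (q * (1 - s)) / ?a)"
  proof -
    have "((\<lambda>\<rho>. \<rho> powr (?a - 1)) has_integral R powr (?a - 1 + 1) / (?a - 1 + 1)) {0..R}"
      using ab R by (intro has_integral_powr_from_0) auto
    then show ?thesis using Rk[of "q * (1 - s)"] by (subst nn_integral_has_integral_lebesgue') auto
  qed
  have i2: "(\<integral>\<^sup>+\<rho>. ennreal (\<rho> powr (- ?b - 1)) * indicator {R..} \<rho> \<partial>lborel) = ennreal ((F / G) powr (- (q * (s - \<theta>))) / ?b)"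
  proof -
    have "((\<lambda>\<rho>. \<rho> powr (- ?b - 1)) has_integral - (R powr (- ?b - 1 + 1)) / (- ?b - 1 + 1)) {R..}"
      using ab R by (intro has_integral_powr_to_inf) auto
    moreover have "R powr (- ?b) = (F / G) powr (- (q * (s - \<theta>)))"
      using Rk[of "- (q * (s - \<theta>))"] by simp
    ultimately show ?thesis by (subst nn_integral_has_integral_lebesgue') auto
  qed
  have "(\<integral>\<^sup>+h. D h * ennreal (norm h powr - \<beta>) \<partial>lborel)
      = (\<integral>\<^sup>+h. D h * (\<integral>\<^sup>+\<rho>. ennreal (\<beta> * \<rho> powr (- \<beta> - 1)) * indicator {norm h<..} \<rho> \<partial>lborel) \<partial>lborel)"
  proof (rule nn_integral_cong_AE)
    show "AE h in lborel. D h * ennreal (norm h powr - \<beta>) = D h * (\<integral>\<^sup>+\<rho>. ennreal (\<beta> * \<rho> powr (- \<beta> - 1)) * indicator {norm h<..} \<rho> \<partial>lborel)"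
      using AE_lborel_singleton[of "0::real^'n"] by eventually_elim (subst norm_powr_layer_cake[OF _ \<beta>], assumption, rule refl)
  qed
  also have "\<dots> = (\<integral>\<^sup>+h. (\<integral>\<^sup>+\<rho>. D h * (ennreal (\<beta> * \<rho> powr (- \<beta> - 1)) * indicator {norm h<..} \<rho>) \<partial>lborel) \<partial>lborel)"
    by (intro nn_integral_cong nn_integral_cmult[symmetric]) measurable
  also have "\<dots> = (\<integral>\<^sup>+\<rho>. (\<integral>\<^sup>+h. D h * (ennreal (\<beta> * \<rho> powr (- \<beta> - 1)) * indicator {norm h<..} \<rho>) \<partial>lborel) \<partial>lborel)"
  proof (rule lborel_pair.Fubini')
    have [measurable]: "Measurable.pred (borel \<Otimes>\<^sub>M borel) (\<lambda>z::real \<times> (real^'n). fst z \<in> {norm (snd z)<..})"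
      by (simp only: greaterThan_iff) measurable
    show "(\<lambda>(\<rho>, h). D h * (ennreal (\<beta> * \<rho> powr (- \<beta> - 1)) * indicator {norm h<..} \<rho>)) \<in> borel_measurable (lborel \<Otimes>\<^sub>M lborel)"
      by measurable
  qed
  also have "\<dots> \<le> (\<integral>\<^sup>+\<rho>. \<Psi> \<rho> \<partial>lborel)" by (intro nn_integral_mono inner)
  also have "\<dots> = ennreal (\<beta> * V * C * G powr q) * ennreal ((F / G) powr (q * (1 - s)) / ?a)
      + ennreal (\<beta> * V * C * (F powr (1 - \<theta>) * G powr \<theta>) powr q) * ennreal ((F / G) powr (- (q * (s - \<theta>))) / ?b)"
    unfolding \<Psi>_def i1[symmetric] i2[symmetric]
    by (subst nn_integral_add, measurable, subst (1 2) nn_integral_cmult, measurable)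
  also have "\<dots> = ennreal (\<beta> * V * C * (G powr q * (F / G) powr (q * (1 - s)) / ?a + (F powr (1 - \<theta>) * G powr \<theta>) powr q * (F / G) powr (- (q * (s - \<theta>))) / ?b))"
    using \<beta> V C ab by (simp add: ennreal_mult[symmetric] ennreal_plus[symmetric] distrib_left mult.assoc del: ennreal_plus)
  also have "\<dots> \<le> ennreal (C * V * (?n + real k * q) / (real k * q) * inverse ((s - \<theta>) * (1 - s)) * (F powr (1 - s) * G powr s) powr q)"
  proof (rule ennreal_leI)
    \<comment> \<open>The two bounds agree at the splitting radius, which is why both integrals lead
      to the same product \<open>X\<close>.\<close>
    define X where "X = (F powr (1 - s) * G powr s) powr q"
    have X0: "0 \<le> X" by (simp add: X_def)
    have F': "F powr u / G powr u = (F / G) powr u" for u using F G by (simp add: powr_divide)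
    have 1: "G powr q * (F / G) powr (q * (1 - s)) = X"
    proof -
      have "G powr q * (F / G) powr (q * (1 - s)) = F powr (q * (1 - s)) * (G powr q * G powr (- (q * (1 - s))))"
        using F G by (simp add: powr_divide powr_minus_divide)
      also have "G powr q * G powr (- (q * (1 - s))) = G powr (q * s)"
        unfolding powr_add[symmetric] by (rule arg_cong[where f="\<lambda>z. G powr z"]) (simp add: algebra_simps)
      also have "F powr (q * (1 - s)) * G powr (q * s) = X"
        using F G by (simp add: X_def powr_mult powr_powr mult.commute)
      finally show ?thesis .
    qed
    have 2: "(F powr (1 - \<theta>) * G powr \<theta>) powr q * (F / G) powr (- (q * (s - \<theta>))) = X"
    proof -
      have "(F powr (1 - \<theta>) * G powr \<theta>) powr q * (F / G) powr (- (q * (s - \<theta>)))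
          = (F powr ((1 - \<theta>) * q) * F powr (- (q * (s - \<theta>)))) * (G powr (\<theta> * q) * G powr (q * (s - \<theta>)))"
        using F G by (simp add: powr_divide powr_mult powr_powr powr_minus_divide)
      also have "F powr ((1 - \<theta>) * q) * F powr (- (q * (s - \<theta>))) = F powr ((1 - s) * q)"
        unfolding powr_add[symmetric] by (rule arg_cong[where f="\<lambda>z. F powr z"]) (simp add: algebra_simps)
      also have "G powr (\<theta> * q) * G powr (q * (s - \<theta>)) = G powr (s * q)"
        unfolding powr_add[symmetric] by (rule arg_cong[where f="\<lambda>z. G powr z"]) (simp add: algebra_simps)
      also have "F powr ((1 - s) * q) * G powr (s * q) = X"
        using F G by (simp add: X_def powr_mult powr_powr)
      finally show ?thesis .
    qed
    \<comment> \<open>Partial fractions: the reciprocals of \<open>1 - s\<close> and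
      \<open>s - \<theta>\<close> add up to
      \<open>(1 - \<theta>) / ((s - \<theta>) * (1 - s))\<close>.\<close>
    have sum: "X / ?a + X / ?b \<le> X / (real k * q) * inverse ((s - \<theta>) * (1 - s))"
    proof -
      have "X / ?a + X / ?b = X / (real k * q) * (1 / (1 - s) + 1 / (s - \<theta>))"
        using kq0 s \<theta> by (simp add: divide_simps) (simp add: algebra_simps)
      also have "\<dots> \<le> X / (real k * q) * inverse ((s - \<theta>) * (1 - s))"
      proof (rule mult_left_mono)
        have "1 / (1 - s) + 1 / (s - \<theta>) = (1 - \<theta>) * inverse ((s - \<theta>) * (1 - s))"
          using s \<theta> by (simp add: divide_simps)
        also have "\<dots> \<le> 1 * inverse ((s - \<theta>) * (1 - s))"
          using s \<theta> by (intro mult_right_mono) auto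
        finally show "1 / (1 - s) + 1 / (s - \<theta>) \<le> inverse ((s - \<theta>) * (1 - s))" by simp
      qed (use X0 kq in simp)
      finally show ?thesis .
    qed
    have "\<beta> * V * C * (X / ?a + X / ?b) \<le> (?n + real k * q) * V * C * (X / (real k * q) * inverse ((s - \<theta>) * (1 - s)))"
      using sum \<beta> \<beta>_le V C X0 ab kq0 by (intro mult_mono mult_right_mono) auto
    then show "\<beta> * V * C * (G powr q * (F / G) powr (q * (1 - s)) / ?a + (F powr (1 - \<theta>) * G powr \<theta>) powr q * (F / G) powr (- (q * (s - \<theta>))) / ?b)
        \<le> C * V * (?n + real k * q) / (real k * q) * inverse ((s - \<theta>) * (1 - s)) * (F powr (1 - s) * G powr s) powr q"
      unfolding 1 2 X_def[symmetric] by (simp add: mult_ac)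
  qed
  finally show ?thesis by (simp add: \<beta>_def V_def)
qed

section \<open>From pointwise estimates to norms\<close>

text \<open>The Borel counterpart of \<open>frac_D\<close> before the \<open>q\<close>-th root is
  taken. Its measurability in \<open>x\<close> follows from that of parameter integrals, and
  \<open>frac_D\<close> inherits it almost everywhere.\<close>

definition frac_integral :: "real \<Rightarrow> real \<Rightarrow> nat \<Rightarrow> (real^'n::finite \<Rightarrow> real) \<Rightarrow> real^'n \<Rightarrow> ennreal" where
  "frac_integral q s k f x = (\<integral>\<^sup>+h. enn_powr (ennreal \<bar>fin_diff k h f x\<bar>) q
     * ennreal (norm h powr - (real CARD('n) + s * real k * q)) \<partial>lborel)"

lemma measurable_frac_integral [measurable]:
  assumes [measurable]: "f \<in> borel_measurable borel"
  shows "frac_integral q s k f \<in> borel_measurable borel"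
  unfolding frac_integral_def[abs_def] by measurable

text \<open>For \<open>j \<ge> 1\<close> the affine map sending \<open>h\<close> to
  \<open>x + j h\<close> pulls the exceptional null set back to a null set. For \<open>j = 0\<close>
  the point \<open>x\<close> itself has to be good, which holds almost everywhere.\<close>

lemma AE_frac_D_eq:
  fixes f f0 :: "real^'n::finite \<Rightarrow> real"
  assumes ae: "AE x in lborel. f x = f0 x"
  shows "AE x in lborel. frac_D q s k f x = enn_powr (frac_integral q s k f0 x) (1 / q)"
  using ae
proof eventually_elim
  case (elim x)
  have "AE h in lborel. \<forall>j. f (x + real j *\<^sub>R h) = f0 (x + real j *\<^sub>R h)"
  proof (subst AE_all_countable, intro allI)
    fix j
    show "AE h in lborel. f (x + real j *\<^sub>R h) = f0 (x + real j *\<^sub>R h)"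
    proof (cases "j = 0")
      case False
      then show ?thesis using AE_lborel_affine[OF ae, of "real j" x] by simp
    qed (use elim in simp)
  qed
  then have "AE h in lborel. ennreal (\<bar>fin_diff k h f x\<bar> powr q / norm h powr (real CARD('n) + s * real k * q))
      = enn_powr (ennreal \<bar>fin_diff k h f0 x\<bar>) q * ennreal (norm h powr - (real CARD('n) + s * real k * q))"
  proof eventually_elim
    case (elim h)
    then have "fin_diff k h f x = fin_diff k h f0 x" by (simp add: fin_diff_def)
    moreover have "a / norm h powr b = a * norm h powr - b" for a b
      by (simp add: powr_minus divide_inverse)
    ultimately show ?case by (simp only: ennreal_mult' powr_ge_zero enn_powr_ennreal abs_ge_zero)
  qed
  from nn_integral_cong_AE[OF this] show ?case
    by (simp add: frac_D_def nn_integral_completion frac_integral_def)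
qed

lemma measurable_lebesgue_AE_cong:
  fixes u v :: "'a::euclidean_space \<Rightarrow> ennreal"
  assumes v: "v \<in> borel_measurable borel" and ae: "AE x in lborel. u x = v x"
  shows "u \<in> borel_measurable lebesgue"
proof (rule measurableI)
  fix A :: "ennreal set" assume A: "A \<in> sets borel"
  have "v -` A \<inter> space lebesgue \<in> sets lebesgue"
    using v A by (intro measurable_sets[OF measurable_completion]) auto
  then show "u -` A \<inter> space lebesgue \<in> sets lebesgue"
  proof (rule completion.in_sets_AE[rotated])
    show "AE x in lebesgue. (x \<in> v -` A \<inter> space lebesgue) = (x \<in> u -` A \<inter> space lebesgue)"
      unfolding AE_lebesgue_iff using ae by eventually_elim auto
  qed auto
qed simp

lemma measurable_frac_D:
  assumes "f \<in> L0" shows "frac_D q s k f \<in> borel_measurable lebesgue"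
proof -
  obtain f0 where f0: "f0 \<in> borel_measurable borel" "AE x in lborel. f x = f0 x"
    using borel_representative[OF assms] .
  note [measurable] = f0(1)
  show ?thesis by (rule measurable_lebesgue_AE_cong[OF _ AE_frac_D_eq[OF f0(2)]]) measurable
qed

text \<open>The \<open>q\<close>-th root of the factor in \<open>nn_integral_scales_le\<close> that
  does not depend on \<open>s\<close>.\<close>

definition frac_const :: "nat \<Rightarrow> nat \<Rightarrow> real \<Rightarrow> real \<Rightarrow> real" where
  "frac_const n k q C = (C * unit_ball_vol (real n) * (real n + real k * q) / (real k * q)) powr (1 / q)"

lemma frac_integral_le:
  fixes f :: "real^'n::finite \<Rightarrow> real"
  assumes [measurable]: "f \<in> borel_measurable borel"
    and s: "0 < s" "s < 1" and \<theta>: "0 \<le> \<theta>" "\<theta> < s" and q: "1 \<le> q" and k: "1 \<le> k" and C: "0 \<le> C" and F: "0 < F" and G: "0 < G"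
    and small: "\<And>\<rho>. 0 < \<rho> \<Longrightarrow> (\<integral>\<^sup>+v. enn_powr (ennreal \<bar>fin_diff k (\<rho> *\<^sub>R v) f x\<bar>) q \<partial>unif_ball) \<le> ennreal (C * (\<rho> ^ k * G) powr q)"
    and large: "\<And>\<rho>. 0 < \<rho> \<Longrightarrow> F \<le> \<rho> ^ k * G \<Longrightarrow> (\<integral>\<^sup>+v. enn_powr (ennreal \<bar>fin_diff k (\<rho> *\<^sub>R v) f x\<bar>) q \<partial>unif_ball)
      \<le> ennreal (C * (F powr (1 - \<theta>) * (\<rho> ^ k * G) powr \<theta>) powr q)"
  shows "enn_powr (frac_integral q s k f x) (1 / q) \<le> ennreal (frac_const CARD('n) k q C * ((s - \<theta>) * (1 - s)) powr (- 1 / q) * (F powr (1 - s) * G powr s))"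
proof -
  let ?c = "C * unit_ball_vol (real CARD('n)) * (real CARD('n) + real k * q) / (real k * q)"
  have c: "0 \<le> ?c" using C q by simp
  have "frac_integral q s k f x \<le> ennreal (?c * inverse ((s - \<theta>) * (1 - s)) * (F powr (1 - s) * G powr s) powr q)"
    unfolding frac_integral_def by (rule nn_integral_scales_le[OF _ s \<theta> q k C F G small large]) measurable
  then have "enn_powr (frac_integral q s k f x) (1 / q) \<le> enn_powr (ennreal (?c * inverse ((s - \<theta>) * (1 - s)) * (F powr (1 - s) * G powr s) powr q)) (1 / q)"
    using q by (intro enn_powr_mono) auto
  also have "\<dots> = ennreal ((?c * inverse ((s - \<theta>) * (1 - s)) * (F powr (1 - s) * G powr s) powr q) powr (1 / q))"
    using c s \<theta> by (intro enn_powr_ennreal mult_nonneg_nonneg) auto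
  also have "(?c * inverse ((s - \<theta>) * (1 - s)) * (F powr (1 - s) * G powr s) powr q) powr (1 / q)
      = frac_const CARD('n) k q C * ((s - \<theta>) * (1 - s)) powr (- 1 / q) * (F powr (1 - s) * G powr s)"
  proof -
    have 1: "((F powr (1 - s) * G powr s) powr q) powr (1 / q) = F powr (1 - s) * G powr s"
      using q F G by (simp add: powr_powr)
    have p: "0 < (s - \<theta>) * (1 - s)" using s \<theta> by simp
    have 2: "inverse ((s - \<theta>) * (1 - s)) powr (1 / q) = ((s - \<theta>) * (1 - s)) powr (- 1 / q)"
      using p by (simp add: inverse_powr powr_minus[symmetric] del: inverse_mult_distrib)
    have 3: "(A * B * Z) powr u = A powr u * B powr u * Z powr u" if "0 \<le> A" "0 \<le> B" "0 \<le> Z" for A B Z u :: real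
      using that by (simp add: powr_mult)
    have 4: "0 \<le> inverse ((s - \<theta>) * (1 - s))" using p by (intro less_imp_le positive_imp_inverse_positive)
    show ?thesis
      unfolding frac_const_def by (subst 3[OF c 4]) (simp, simp only: 1 2)
  qed
  finally show ?thesis .
qed

section \<open>The fractional derivative at \<open>x\<close>\<close>

context pointwise_data
begin

lemma frac_integral_le_interpolated:
  assumes q: "1 \<le> q" "q < p" and p: "r \<le> p" and lt: "real CARD('n) * (1 / r - 1 / p) < real k"
    and \<theta>: "0 < \<theta>" "\<theta> < 1" "p * (q - 1) \<le> \<theta> * q * (p - 1)" and s: "\<theta> < s" "s < 1"
  shows "enn_powr (frac_integral q s k f x) (1 / q)
    \<le> ennreal (frac_const CARD('n) k q (total_const CARD('n) k K q r p \<theta>) * ((s - \<theta>) * (1 - s)) powr (- 1 / q) * (F powr (1 - s) * G powr s))"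
proof (rule frac_integral_le)
  show "0 \<le> total_const CARD('n) k K q r p \<theta>"
    using K k \<theta> by (auto simp: total_const_def intro!: add_nonneg_nonneg scale_const_nonneg moment_const_nonneg)
qed (use q p lt \<theta> s k F G mean_powr_d_le_small mean_powr_d_le_large in auto)

text \<open>The case of loss 0, possible because the bound for large radii is now by
  \<open>F\<close> alone. The value \<open>1 / 2\<close> inside \<open>total_const\<close> is
  arbitrary: the bound by \<open>H \<rho>\<close> holds with every positive \<theta> there.\<close>

lemma frac_integral_le_of_mean_powr:
  assumes q: "1 \<le> q" "q < p" and p: "r \<le> p" and lt: "real CARD('n) * (1 / r - 1 / p) < real k" and s: "0 < s" "s < 1"
    and mq: "\<And>R. 0 < R \<Longrightarrow> (\<integral>\<^sup>+w. ennreal (\<bar>f (x + R *\<^sub>R w)\<bar> powr q) \<partial>unif_ball) \<le> ennreal (F powr q)"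
  shows "enn_powr (frac_integral q s k f x) (1 / q)
    \<le> ennreal (frac_const CARD('n) k q (total_const CARD('n) k K q r p (1 / 2)
        + (4 powr q * (2 ^ k) powr q + 2 powr q * ((2 ^ k) powr q * real k powr q * real k))) * (s * (1 - s)) powr (- 1 / q) * (F powr (1 - s) * G powr s))"
proof -
  let ?C1 = "total_const CARD('n) k K q r p (1 / 2)"
  let ?C2 = "4 powr q * (2 ^ k) powr q + 2 powr q * ((2 ^ k) powr q * real k powr q * real k)"
  have C1: "0 \<le> ?C1"
    using K k by (auto simp: total_const_def intro!: add_nonneg_nonneg scale_const_nonneg moment_const_nonneg)
  have C2: "0 \<le> ?C2" by simp
  have "enn_powr (frac_integral q s k f x) (1 / q)
    \<le> ennreal (frac_const CARD('n) k q (?C1 + ?C2) * ((s - 0) * (1 - s)) powr (- 1 / q) * (F powr (1 - s) * G powr s))"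
  proof (rule frac_integral_le)
    fix \<rho> :: real assume \<rho>: "0 < \<rho>"
    note mean_powr_d_le_small[OF \<rho> q p lt, of "1 / 2"]
    also have "ennreal (?C1 * H \<rho> powr q) \<le> ennreal ((?C1 + ?C2) * H \<rho> powr q)"
      using C2 by (intro ennreal_leI mult_right_mono) auto
    finally show "(\<integral>\<^sup>+v. enn_powr (d (\<rho> *\<^sub>R v) x) q \<partial>unif_ball) \<le> ennreal ((?C1 + ?C2) * H \<rho> powr q)" by simp
    note mean_powr_d_le_of_mean_powr[OF q(1) mq \<rho>]
    also have "ennreal (?C2 * F powr q) \<le> ennreal ((?C1 + ?C2) * (F powr (1 - 0) * H \<rho> powr 0) powr q)"
      using C1 F G \<rho> by (intro ennreal_leI) (auto intro!: mult_right_mono)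
    finally show "(\<integral>\<^sup>+v. enn_powr (d (\<rho> *\<^sub>R v) x) q \<partial>unif_ball) \<le> ennreal ((?C1 + ?C2) * (F powr (1 - 0) * H \<rho> powr 0) powr q)" .
  qed (use q s k F G C1 C2 in auto)
  then show ?thesis by simp
qed

end

text \<open>The pointwise estimates ask for strictly positive \<open>F\<close> and \<open>G\<close>,
  while maximal functions may vanish. They are applied to values raised by \<epsilon>, and
  continuity of powers with positive exponents removes \<epsilon>.\<close>

lemma le_powr_product_limit:
  assumes s: "0 < s" "s < 1" and a: "0 \<le> a" "0 \<le> u" "0 \<le> v"
    and le: "\<And>\<epsilon>. 0 < \<epsilon> \<Longrightarrow> t \<le> ennreal (c * ((a * (u + \<epsilon>)) powr (1 - s) * (v + \<epsilon>) powr s))"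
  shows "t \<le> ennreal (c * ((a * u) powr (1 - s) * v powr s))"
proof (rule LIMSEQ_le_const)
  let ?e = "\<lambda>m. inverse (real (Suc m))"
  have "(\<lambda>m. c * ((a * (u + ?e m)) powr (1 - s) * (v + ?e m) powr s)) \<longlonglongrightarrow> c * ((a * (u + 0)) powr (1 - s) * (v + 0) powr s)"
    using s a by (intro tendsto_intros LIMSEQ_inverse_real_of_nat) (auto intro!: always_eventually)
  then show "(\<lambda>m. ennreal (c * ((a * (u + ?e m)) powr (1 - s) * (v + ?e m) powr s))) \<longlonglongrightarrow> ennreal (c * ((a * u) powr (1 - s) * v powr s))"
    by (intro tendsto_ennrealI) simp
  show "\<exists>N. \<forall>m\<ge>N. t \<le> ennreal (c * ((a * (u + ?e m)) powr (1 - s) * (v + ?e m) powr s))"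
    by (intro exI[of _ 0] allI impI le) simp
qed

lemma bf_space_scale: "BBF N \<Longrightarrow> f \<in> bf_space N \<Longrightarrow> (\<lambda>x. c * f x) \<in> bf_space N"
  using BBF_scale[of N f c] by (auto simp: bf_space_def L0_def ennreal_mult_less_top)

text \<open>Replacing \<open>C powr u\<close> by \<open>1 + C\<close> makes the constant uniform in
  the exponent, hence in \<open>s\<close>.\<close>

lemma enn_powr_le_const:
  assumes "0 \<le> C" "a \<le> ennreal C * b" "0 \<le> u" "u \<le> 1"
  shows "enn_powr a u \<le> ennreal (1 + C) * enn_powr b u"
proof -
  have "enn_powr a u \<le> enn_powr (ennreal C * b) u" using assms by (intro enn_powr_mono)
  also have "\<dots> = ennreal (C powr u) * enn_powr b u" using assms by (simp add: enn_powr_mult)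
  also have "\<dots> \<le> ennreal (1 + C) * enn_powr b u"
  proof (intro mult_right_mono ennreal_leI)
    have "C powr u \<le> (1 + C) powr u" using assms by (intro powr_mono2) auto
    also have "\<dots> \<le> (1 + C) powr 1" using assms by (intro powr_mono) auto
    finally show "C powr u \<le> 1 + C" using assms by simp
  qed simp
  finally show ?thesis .
qed

text \<open>Writing \<open>c\<close> as \<open>c powr (1 - s) * c powr s\<close> distributes it over
  both factors, so that \<open>c * P\<close> and \<open>c * Q\<close> form an admissible pair in the
  infimum.\<close>

lemma ext_norm_calderon_lozanovskii_le:
  assumes X: "BBF X" and Y: "BBF Y" and s: "0 < s" "s < 1" and c: "0 \<le> c"
    and P: "P \<in> bf_space X" "\<And>x. 0 \<le> P x" and Q: "Q \<in> bf_space Y" "\<And>x. 0 \<le> Q x"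
    and D: "D \<in> borel_measurable lebesgue" "AE x in lebesgue. D x \<le> ennreal (c * (P x powr (1 - s) * Q x powr s))"
  shows "ext_norm (calderon_lozanovskii s X Y) D \<le> ennreal c * enn_powr (X P) (1 - s) * enn_powr (Y Q) s"
proof -
  have fin: "AE x in lebesgue. D x < top" using D(2) by eventually_elim (auto intro: le_less_trans)
  have "AE x in lebesgue. \<bar>enn2real (D x)\<bar> \<le> \<bar>c * P x\<bar> powr (1 - s) * \<bar>c * Q x\<bar> powr s"
    using D(2)
  proof eventually_elim
    case (elim x)
    have "enn2real (D x) \<le> c * (P x powr (1 - s) * Q x powr s)"
      using enn2real_mono[OF elim] c by simp
    also have "\<dots> = (c powr (1 - s) * c powr s) * (P x powr (1 - s) * Q x powr s)"
      using c by (cases "c = 0") (auto simp: powr_add[symmetric])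
    also have "\<dots> = \<bar>c * P x\<bar> powr (1 - s) * \<bar>c * Q x\<bar> powr s"
      using c P(2)[of x] Q(2)[of x] by (simp add: abs_mult powr_mult)
    finally show ?case by simp
  qed
  then have "calderon_lozanovskii s X Y (\<lambda>x. enn2real (D x)) \<le> enn_powr (X (\<lambda>x. c * P x)) (1 - s) * enn_powr (Y (\<lambda>x. c * Q x)) s"
    unfolding calderon_lozanovskii_def using bf_space_scale[OF X P(1), of c] bf_space_scale[OF Y Q(1), of c]
    by (intro Inf_lower) blast
  also have "\<dots> = ennreal (c powr (1 - s) * c powr s) * enn_powr (X P) (1 - s) * enn_powr (Y Q) s"
    using BBF_scale[OF X, of P c] BBF_scale[OF Y, of Q c] P Q c
    by (simp add: bf_space_def enn_powr_mult ennreal_mult mult_ac)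
  also have "c powr (1 - s) * c powr s = c" using c by (cases "c = 0") (auto simp: powr_add[symmetric])
  finally show ?thesis using D(1) fin by (simp add: ext_norm_def)
qed

lemma ext_norm_convexification_le:
  assumes Y: "BBF Y" and s: "0 < s" "s < 1" and c: "0 \<le> c" and Q: "Q \<in> bf_space Y" "\<And>x. 0 \<le> Q x"
    and D: "D \<in> borel_measurable lebesgue" "AE x in lebesgue. D x \<le> ennreal (c * Q x powr s)"
  shows "ext_norm (convexification (1 / s) Y) D \<le> ennreal c * enn_powr (Y Q) s"
proof -
  have fin: "AE x in lebesgue. D x < top" using D(2) by eventually_elim (auto intro: le_less_trans)
  have "AE x in lebesgue. \<bar>\<bar>enn2real (D x)\<bar> powr (1 / s)\<bar> \<le> \<bar>c powr (1 / s) * Q x\<bar>"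
    using D(2)
  proof eventually_elim
    case (elim x)
    have "enn2real (D x) \<le> c * Q x powr s" using enn2real_mono[OF elim] c by simp
    then have "enn2real (D x) powr (1 / s) \<le> (c * Q x powr s) powr (1 / s)" using s by (intro powr_mono2) auto
    also have "\<dots> = c powr (1 / s) * Q x" using c Q(2)[of x] s by (simp add: powr_mult powr_powr)
    finally show ?case using Q(2)[of x] by simp
  qed
  then have "Y (\<lambda>x. \<bar>enn2real (D x)\<bar> powr (1 / s)) \<le> Y (\<lambda>x. c powr (1 / s) * Q x)"
    using bf_space_scale[OF Y Q(1)] D(1) by (intro BBF_mono[OF Y]) (auto simp: bf_space_def L0_def)
  also have "\<dots> = ennreal (c powr (1 / s)) * Y Q" using BBF_scale[OF Y, of Q] Q by (simp add: bf_space_def)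
  finally have "enn_powr (Y (\<lambda>x. \<bar>enn2real (D x)\<bar> powr (1 / s))) s \<le> enn_powr (ennreal (c powr (1 / s)) * Y Q) s"
    using s by (intro enn_powr_mono) auto
  also have "\<dots> = ennreal c * enn_powr (Y Q) s" using s c by (simp add: enn_powr_mult powr_powr)
  finally show ?thesis using D(1) fin by (simp add: ext_norm_def convexification_def)
qed

text \<open>Measurability and a.e. finiteness of the maximal function come for free: otherwise its
  extended norm would be infinite.\<close>

lemma lower_boyd_maximal:
  fixes N :: "(real^'n::finite \<Rightarrow> real) \<Rightarrow> ennreal"
  assumes N: "BBF N" and c: "1 \<le> c" "ereal c < lower_boyd N"
  obtains p C where "c < p" "0 < C"
    "\<And>f. f \<in> bf_space N \<Longrightarrow> \<exists>M\<in>bf_space N. (\<forall>x. 0 \<le> M x) \<and> N M \<le> ennreal C * N f \<and>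
       (AE x in lborel. \<forall>R>0. (\<integral>\<^sup>+y\<in>ball x R. ennreal (\<bar>f y\<bar> powr p) \<partial>lebesgue) \<le> ennreal (M x powr p) * emeasure lebesgue (ball x R))"
proof -
  \<comment> \<open>The extra element 1 of the supremum cannot exceed \<open>c \<ge> 1\<close>, so
    an exponent with a bounded maximal operator lies above \<open>c\<close>.\<close>
  obtain p where p: "c < p" "1 < p" "BBF (convexification (1 / p) N)" "HL_maximal_bounded_on (convexification (1 / p) N)"
    using c unfolding lower_boyd_def less_Sup_iff by auto
  let ?N = "convexification (1 / p) N"
  obtain C where C: "0 < C" "\<And>f. f \<in> bf_space ?N \<Longrightarrow> ext_norm ?N (HL_maximal f) \<le> ennreal C * ?N f"
    using p(4) unfolding HL_maximal_bounded_on_def by auto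
  show ?thesis
  proof (rule that[OF p(1), of "C powr (1 / p)"])
    show "0 < C powr (1 / p)" using C by simp
    fix f assume f: "f \<in> bf_space N"
    \<comment> \<open>In the rescaled space \<open>?N\<close> the function \<open>u\<close> has norm
      \<open>N f\<close> to the power \<open>p\<close>; the \<open>p\<close>-th root of its maximal
      function therefore belongs to the original space.\<close>
    define u where "u y = \<bar>f y\<bar> powr p" for y
    have uN: "?N u = enn_powr (N (\<lambda>x. \<bar>f x\<bar>)) p"
      using p by (simp add: convexification_def u_def powr_powr)
    have Nabs: "N (\<lambda>x. \<bar>f x\<bar>) = N f"
    proof (rule antisym)
      show "N (\<lambda>x. \<bar>f x\<bar>) \<le> N f" "N f \<le> N (\<lambda>x. \<bar>f x\<bar>)"
        using f by (auto intro!: BBF_mono[OF N] simp: bf_space_def L0_def)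
    qed
    have "u \<in> L0" using f by (auto simp: bf_space_def L0_def u_def[abs_def])
    then have "u \<in> bf_space ?N" using f by (simp add: bf_space_def uN Nabs)
    then have le: "ext_norm ?N (HL_maximal u) \<le> ennreal C * enn_powr (N f) p"
      using C(2)[of u] by (simp add: uN Nabs)
    also have "\<dots> < top" using f by (simp add: bf_space_def ennreal_mult_less_top)
    finally have "HL_maximal u \<in> borel_measurable lebesgue \<and> (AE x in lebesgue. HL_maximal u x < top)"
      by (auto simp: ext_norm_def split: if_splits)
    then have m: "HL_maximal u \<in> borel_measurable lebesgue" and fin: "AE x in lborel. HL_maximal u x < top"
      by (simp_all add: AE_lebesgue_iff)
    define M where "M x = enn2real (HL_maximal u x) powr (1 / p)" for x
    have M_L0: "M \<in> L0" using m unfolding L0_def M_def[abs_def] by measurable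
    have "enn_powr (N M) p \<le> ennreal C * enn_powr (N f) p"
      using le m fin by (simp add: ext_norm_def AE_lebesgue_iff convexification_def M_def[abs_def])
    then have "enn_powr (enn_powr (N M) p) (1 / p) \<le> enn_powr (ennreal C * enn_powr (N f) p) (1 / p)"
      using p by (intro enn_powr_mono) auto
    then have NM: "N M \<le> ennreal (C powr (1 / p)) * N f"
      using p C(1) by (simp add: enn_powr_powr enn_powr_mult)
    have "AE x in lborel. \<forall>R>0. (\<integral>\<^sup>+y\<in>ball x R. ennreal (\<bar>f y\<bar> powr p) \<partial>lebesgue) \<le> ennreal (M x powr p) * emeasure lebesgue (ball x R)"
      using fin
    proof eventually_elim
      case (elim x)
      show ?case
      proof (intro allI impI)
        fix R :: real assume R: "0 < R"
        let ?I = "\<integral>\<^sup>+y\<in>ball x R. ennreal \<bar>u y\<bar> \<partial>lebesgue" and ?E = "emeasure lebesgue (ball x R)"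
        have E: "?E \<noteq> 0" "?E < top"
          using emeasure_ball_pos_finite[OF R, of x] by (auto simp: less_top)
        have "?I / ?E \<le> HL_maximal u x"
          unfolding HL_maximal_def using R by (intro SUP_upper2[of "(x, R)"]) auto
        also have "\<dots> = ennreal (M x powr p)" using elim p by (simp add: M_def powr_powr)
        finally have "?I / ?E * ?E \<le> ennreal (M x powr p) * ?E" by (rule mult_right_mono) simp
        then show "(\<integral>\<^sup>+y\<in>ball x R. ennreal (\<bar>f y\<bar> powr p) \<partial>lebesgue) \<le> ennreal (M x powr p) * ?E"
          using E by (simp add: ennreal_divide_times u_def)
      qed
    qed
    moreover have "M \<in> bf_space N"
      using NM M_L0 f by (auto simp: bf_space_def ennreal_mult_less_top intro: le_less_trans)
    moreover have "0 \<le> M x" for x by (simp add: M_def)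
    moreover note NM
    ultimately
    show "\<exists>M\<in>bf_space N. (\<forall>x. 0 \<le> M x) \<and> N M \<le> ennreal (C powr (1 / p)) * N f \<and>
       (AE x in lborel. \<forall>R>0. (\<integral>\<^sup>+y\<in>ball x R. ennreal (\<bar>f y\<bar> powr p) \<partial>lebesgue) \<le> ennreal (M x powr p) * emeasure lebesgue (ball x R))"
      by blast
  qed
qed

section \<open>Pointwise data from maximal functions and mean oscillation\<close>

lemma mean_le_of_ball_integral:
  fixes \<phi> u :: "'a::euclidean_space \<Rightarrow> ennreal"
  assumes \<phi>: "\<phi> \<in> borel_measurable borel" "AE y in lborel. u y = \<phi> y" and R: "0 < R"
    and le: "(\<integral>\<^sup>+y\<in>ball x R. u y \<partial>lebesgue) \<le> a * emeasure lebesgue (ball x R)"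
  shows "(\<integral>\<^sup>+w. \<phi> (x + R *\<^sub>R w) \<partial>unif_ball) \<le> a"
proof -
  let ?E = "emeasure lborel (ball x R)"
  have "(\<integral>\<^sup>+y\<in>ball x R. u y \<partial>lebesgue) = (\<integral>\<^sup>+y\<in>ball x R. \<phi> y \<partial>lborel)"
    unfolding nn_integral_completion
  proof (rule nn_integral_cong_AE)
    show "AE y in lborel. u y * indicator (ball x R) y = \<phi> y * indicator (ball x R) y"
      using \<phi>(2) by eventually_elim simp
  qed
  then have "(\<integral>\<^sup>+y\<in>ball x R. \<phi> y \<partial>lborel) \<le> a * ?E" using le by simp
  then have "(\<integral>\<^sup>+y\<in>ball x R. \<phi> y \<partial>lborel) / ?E \<le> a * ?E / ?E" by (rule divide_right_mono_ennreal)
  also have "\<dots> = a" using emeasure_ball_pos_finite[OF R, of x] by (intro ennreal_mult_divide_eq) auto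
  finally show ?thesis using nn_integral_unif_ball[OF \<phi>(1) R, of x] by simp
qed

text \<open>Interpolation between the exponents 0 and \<open>p\<close> at level \<open>l\<close>,
  where both ends contribute \<open>l powr q\<close>.\<close>

lemma mean_powr_le_lower_exponent:
  fixes v :: "'a::euclidean_space \<Rightarrow> real"
  assumes [measurable]: "v \<in> borel_measurable borel" and l: "0 < l" and q: "0 \<le> q" "q \<le> p"
    and le: "(\<integral>\<^sup>+w. ennreal (\<bar>v w\<bar> powr p) \<partial>unif_ball) \<le> ennreal (l powr p)"
  shows "(\<integral>\<^sup>+w. ennreal (\<bar>v w\<bar> powr q) \<partial>unif_ball) \<le> ennreal (2 * l powr q)"
proof -
  have "(\<integral>\<^sup>+w. ennreal (\<bar>v w\<bar> powr q) \<partial>unif_ball) \<le> (\<integral>\<^sup>+w. ennreal (l powr q) + ennreal (l powr (q - p)) * ennreal (\<bar>v w\<bar> powr p) \<partial>unif_ball)"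
  proof (intro nn_integral_mono)
    fix w
    have "ennreal (\<bar>v w\<bar> powr q) \<le> ennreal (l powr q) * ennreal (\<bar>v w\<bar> powr 0) + ennreal (l powr (q - p)) * ennreal (\<bar>v w\<bar> powr p)"
      using enn_powr_interpolate[OF l q, of "ennreal \<bar>v w\<bar>"] by (simp del: powr_zero_eq_one)
    \<comment> \<open>The zeroth power is only bounded by 1, because
      \<open>0 powr 0 = 0\<close>.\<close>
    also have "\<dots> \<le> ennreal (l powr q) * 1 + ennreal (l powr (q - p)) * ennreal (\<bar>v w\<bar> powr p)"
      by (intro add_right_mono mult_left_mono) (auto simp: powr_def)
    finally show "ennreal (\<bar>v w\<bar> powr q) \<le> ennreal (l powr q) + ennreal (l powr (q - p)) * ennreal (\<bar>v w\<bar> powr p)" by simp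
  qed
  also have "\<dots> = ennreal (l powr q) + ennreal (l powr (q - p)) * (\<integral>\<^sup>+w. ennreal (\<bar>v w\<bar> powr p) \<partial>unif_ball)"
    by (simp add: nn_integral_add nn_integral_cmult)
  also have "\<dots> \<le> ennreal (l powr q) + ennreal (l powr (q - p)) * ennreal (l powr p)"
    by (intro add_left_mono mult_left_mono le) simp
  also have "\<dots> = ennreal (2 * l powr q)"
    using l by (simp add: ennreal_mult[symmetric] powr_add[symmetric] ennreal_plus[symmetric] del: ennreal_plus)
  finally show ?thesis .
qed

text \<open>The order of quantifiers matters: \<open>r\<close> and \<open>C\<close> depend on the
  space only, while \<open>g\<close>, \<open>Q\<close> and the exceptional null set precede
  \<epsilon> and \<open>F\<close>. At a good point these two can thus be chosen freely, and
  \<epsilon> can be sent to 0.\<close>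

lemma sobolev_pointwise_data:
  fixes Y :: "(real^'n::finite \<Rightarrow> real) \<Rightarrow> ennreal"
  assumes Y: "BBF Y" and k: "1 \<le> k" and c: "1 \<le> c" "ereal c < lower_boyd Y"
  obtains r C where "c < r" "0 < C"
    "\<And>f f0. f \<in> hom_sobolev k Y \<Longrightarrow> f0 \<in> borel_measurable borel \<Longrightarrow> AE x in lborel. f x = f0 x \<Longrightarrow>
      \<exists>g. \<exists>Q\<in>bf_space Y. (\<forall>x. 0 \<le> Q x) \<and> Y Q \<le> ennreal C * Y (grad_norm k f) \<and>
        (AE x in lborel. \<forall>\<epsilon>>0. \<forall>F>0. (\<forall>R>0. \<exists>c. (\<integral>\<^sup>+w. ennreal \<bar>f0 (x + R *\<^sub>R w) - c\<bar> \<partial>unif_ball) \<le> ennreal F)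
          \<longrightarrow> pointwise_data f0 g k ((2 * real CARD('n)) ^ k) F (Q x + \<epsilon>) r x)"
proof -
  obtain r C where r: "c < r" and C: "0 < C" and max: "\<And>u. u \<in> bf_space Y \<Longrightarrow> \<exists>Q\<in>bf_space Y. (\<forall>x. 0 \<le> Q x) \<and> Y Q \<le> ennreal C * Y u \<and>
       (AE x in lborel. \<forall>R>0. (\<integral>\<^sup>+y\<in>ball x R. ennreal (\<bar>u y\<bar> powr r) \<partial>lebesgue) \<le> ennreal (Q x powr r) * emeasure lebesgue (ball x R))"
    by (rule lower_boyd_maximal[OF Y c]) (rule that; blast)
  show ?thesis
  proof (rule that[OF r C])
    fix f f0 :: "real^'n \<Rightarrow> real"
    assume f: "f \<in> hom_sobolev k Y" and f0: "f0 \<in> borel_measurable borel" "AE x in lborel. f x = f0 x"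
    let ?K = "(2 * real CARD('n)) ^ k"
    obtain g where g: "g \<in> borel_measurable borel" "\<And>x. 0 \<le> g x" "AE x in lborel. grad_norm k f x = g x"
      and dl: "\<And>h. AE y in lborel. ennreal \<bar>fin_diff k h f0 y\<bar> \<le> ennreal (?K * norm h ^ k) * segment_mean k g h y"
      by (rule hom_sobolev_fin_diff_le[OF Y k f f0]) (rule that; blast)
    note [measurable] = f0(1) g(1)
    obtain Q where Q: "Q \<in> bf_space Y" "\<And>x. 0 \<le> Q x" "Y Q \<le> ennreal C * Y (grad_norm k f)"
      and Qm: "AE x in lborel. \<forall>R>0. (\<integral>\<^sup>+y\<in>ball x R. ennreal (\<bar>grad_norm k f y\<bar> powr r) \<partial>lebesgue) \<le> ennreal (Q x powr r) * emeasure lebesgue (ball x R)"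
      using max[OF grad_norm_bf_space[OF Y f]] by blast
    \<comment> \<open>Exchanging the quantifiers in \<open>dl\<close> provides the assumption
      \<open>diff_le_x\<close> at almost every point.\<close>
    have "AE x in lborel. AE h in lborel. ennreal \<bar>fin_diff k h f0 x\<bar> \<le> ennreal (?K * norm h ^ k) * segment_mean k g h x"
    proof (rule iffD2[OF lborel_pair.AE_commute])
      show "{z \<in> space (lborel \<Otimes>\<^sub>M lborel). ennreal \<bar>fin_diff k (snd z) f0 (fst z)\<bar> \<le> ennreal (?K * norm (snd z) ^ k) * segment_mean k g (snd z) (fst z)}
          \<in> sets (lborel \<Otimes>\<^sub>M lborel)"
        unfolding segment_mean_def by measurable
    qed (intro AE_I2 dl)
    with Qm have "AE x in lborel. \<forall>\<epsilon>>0. \<forall>F>0. (\<forall>R>0. \<exists>c. (\<integral>\<^sup>+w. ennreal \<bar>f0 (x + R *\<^sub>R w) - c\<bar> \<partial>unif_ball) \<le> ennreal F)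
          \<longrightarrow> pointwise_data f0 g k ?K F (Q x + \<epsilon>) r x"
    proof eventually_elim
      case (elim x)
      show ?case
      proof (intro allI impI)
        fix \<epsilon> F :: real
        assume \<epsilon>: "0 < \<epsilon>" and F: "0 < F" and mf: "\<forall>R>0. \<exists>c. (\<integral>\<^sup>+w. ennreal \<bar>f0 (x + R *\<^sub>R w) - c\<bar> \<partial>unif_ball) \<le> ennreal F"
        show "pointwise_data f0 g k ?K F (Q x + \<epsilon>) r x"
        proof
          fix R :: real assume R: "0 < R"
          have "(\<integral>\<^sup>+w. ennreal (g (x + R *\<^sub>R w) powr r) \<partial>unif_ball) \<le> ennreal (Q x powr r)"
          proof (rule mean_le_of_ball_integral[OF _ _ R])
            show "AE y in lborel. ennreal (\<bar>grad_norm k f y\<bar> powr r) = ennreal (g y powr r)"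
              using g(3) by eventually_elim (use g(2) in simp)
            show "(\<integral>\<^sup>+y\<in>ball x R. ennreal (\<bar>grad_norm k f y\<bar> powr r) \<partial>lebesgue) \<le> ennreal (Q x powr r) * emeasure lebesgue (ball x R)"
              using elim(1) R by blast
          qed measurable
          also have "\<dots> \<le> ennreal ((Q x + \<epsilon>) powr r)"
            using Q(2)[of x] \<epsilon> r c by (intro ennreal_leI powr_mono2) auto
          finally show "(\<integral>\<^sup>+w. ennreal (g (x + R *\<^sub>R w) powr r) \<partial>unif_ball) \<le> ennreal ((Q x + \<epsilon>) powr r)" .
          show "\<exists>c. (\<integral>\<^sup>+w. ennreal \<bar>f0 (x + R *\<^sub>R w) - c\<bar> \<partial>unif_ball) \<le> ennreal F" using mf R by blast
        qed (use f0 g k dl elim(2) r c Q(2)[of x] \<epsilon> F in auto)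
      qed
    qed
    with Q show "\<exists>g. \<exists>Q\<in>bf_space Y. (\<forall>x. 0 \<le> Q x) \<and> Y Q \<le> ennreal C * Y (grad_norm k f) \<and>
        (AE x in lborel. \<forall>\<epsilon>>0. \<forall>F>0. (\<forall>R>0. \<exists>c. (\<integral>\<^sup>+w. ennreal \<bar>f0 (x + R *\<^sub>R w) - c\<bar> \<partial>unif_ball) \<le> ennreal F)
          \<longrightarrow> pointwise_data f0 g k ?K F (Q x + \<epsilon>) r x)"
      by blast
  qed
qed

text \<open>A ball of radius \<open>R\<close> sits in the concentric cube of side
  \<open>2 * R\<close>, and the factor is the ratio of their volumes. The \<epsilon> leaves room to
  pick a constant close to the infimum.\<close>

lemma BMO_mean_oscillation:
  fixes f f0 :: "real^'n::finite \<Rightarrow> real"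
  assumes f: "f \<in> BMO" and f0: "f0 \<in> borel_measurable borel" "AE x in lborel. f x = f0 x" and R: "0 < R" and \<epsilon>: "0 < \<epsilon>"
  shows "\<exists>c. (\<integral>\<^sup>+w. ennreal \<bar>f0 (x + R *\<^sub>R w) - c\<bar> \<partial>unif_ball)
    \<le> ennreal (2 ^ CARD('n) / unit_ball_vol (real CARD('n)) * (enn2real (BMO_norm f) + \<epsilon>))"
proof -
  define b where "b = enn2real (BMO_norm f)"
  define V where "V = unit_ball_vol (real CARD('n))"
  have V: "0 < V" by (simp add: V_def)
  have b: "BMO_norm f = ennreal b" "0 \<le> b" using f by (auto simp: BMO_def b_def)
  define a :: "real^'n" where "a = (\<chi> i. x $ i - R)"
  let ?Q = "cube a (2 * R)"
  have "(INF c. (\<integral>\<^sup>+x\<in>?Q. ennreal \<bar>f x - c\<bar> \<partial>lebesgue) / emeasure lebesgue ?Q) \<le> BMO_norm f"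
    unfolding BMO_norm_def using R by (intro SUP_upper2[of "(a, 2 * R)"]) auto
  also have "\<dots> < ennreal (b + \<epsilon>)" using b \<epsilon> by (simp add: ennreal_less_iff)
  finally obtain c where c: "(\<integral>\<^sup>+x\<in>?Q. ennreal \<bar>f x - c\<bar> \<partial>lebesgue) / emeasure lebesgue ?Q < ennreal (b + \<epsilon>)"
    unfolding INF_less_iff by auto
  have ne: "cbox a (\<chi> i. a $ i + 2 * R) \<noteq> {}" using R by (auto simp: interval_ne_empty_cart)
  have Q: "emeasure lebesgue ?Q = ennreal ((2 * R) ^ CARD('n))"
  proof -
    have "emeasure lebesgue ?Q = ennreal (measure lborel ?Q)"
      by (simp add: cube_def emeasure_eq_measure2 emeasure_eq_ennreal_measure emeasure_lborel_cbox_finite less_top[symmetric])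
    then show ?thesis using content_cbox_cart[OF ne] by (simp add: cube_def)
  qed
  have "(\<integral>\<^sup>+x\<in>?Q. ennreal \<bar>f x - c\<bar> \<partial>lebesgue) / emeasure lebesgue ?Q * emeasure lebesgue ?Q \<le> ennreal (b + \<epsilon>) * emeasure lebesgue ?Q"
    using c by (intro mult_right_mono) auto
  then have cQ: "(\<integral>\<^sup>+x\<in>?Q. ennreal \<bar>f x - c\<bar> \<partial>lebesgue) \<le> ennreal (b + \<epsilon>) * ennreal ((2 * R) ^ CARD('n))"
    using R unfolding Q by (simp add: ennreal_divide_times)
  have sub: "ball x R \<subseteq> ?Q"
  proof
    fix y assume y: "y \<in> ball x R"
    have "\<bar>y $ i - x $ i\<bar> < R" for i
      using y component_le_norm_cart[of "y - x" i] by (simp add: dist_norm norm_minus_commute)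
    then show "y \<in> ?Q" by (auto simp: cube_def mem_box_cart a_def abs_less_iff; smt (verit, best))
  qed
  have "(\<integral>\<^sup>+y\<in>ball x R. ennreal \<bar>f y - c\<bar> \<partial>lebesgue) \<le> (\<integral>\<^sup>+y\<in>?Q. ennreal \<bar>f y - c\<bar> \<partial>lebesgue)"
    using sub by (intro nn_integral_mono mult_left_mono) (auto simp: indicator_def)
  also note cQ
  also have "ennreal (b + \<epsilon>) * ennreal ((2 * R) ^ CARD('n)) = ennreal (2 ^ CARD('n) / V * (b + \<epsilon>)) * emeasure lebesgue (ball x R)"
  proof -
    have "emeasure lebesgue (ball x R) = ennreal (V * R ^ CARD('n))" using R by (simp add: emeasure_ball V_def)
    moreover have "(b + \<epsilon>) * (2 * R) ^ CARD('n) = 2 ^ CARD('n) / V * (b + \<epsilon>) * (V * R ^ CARD('n))"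
      using V by (simp add: power_mult_distrib)
    moreover have "ennreal (b + \<epsilon>) * ennreal ((2 * R) ^ CARD('n)) = ennreal ((b + \<epsilon>) * (2 * R) ^ CARD('n))"
      using b \<epsilon> R by (intro ennreal_mult[symmetric]) auto
    moreover have "ennreal (2 ^ CARD('n) / V * (b + \<epsilon>)) * ennreal (V * R ^ CARD('n)) = ennreal (2 ^ CARD('n) / V * (b + \<epsilon>) * (V * R ^ CARD('n)))"
      using b \<epsilon> V R by (intro ennreal_mult[symmetric]) auto
    ultimately show ?thesis by simp
  qed
  finally have le: "(\<integral>\<^sup>+y\<in>ball x R. ennreal \<bar>f y - c\<bar> \<partial>lebesgue) \<le> ennreal (2 ^ CARD('n) / V * (b + \<epsilon>)) * emeasure lebesgue (ball x R)" .
  have "(\<integral>\<^sup>+w. ennreal \<bar>f0 (x + R *\<^sub>R w) - c\<bar> \<partial>unif_ball) \<le> ennreal (2 ^ CARD('n) / V * (b + \<epsilon>))"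
  proof (rule mean_le_of_ball_integral[where \<phi>="\<lambda>y. ennreal \<bar>f0 y - c\<bar>", OF _ _ R le])
    show "AE y in lborel. ennreal \<bar>f y - c\<bar> = ennreal \<bar>f0 y - c\<bar>" using f0(2) by eventually_elim simp
  qed (use f0(1) in measurable)
  then show ?thesis unfolding V_def b_def by blast
qed

text \<open>Written as \<open>1 / r - k / n < 1 / p\<close>, the condition on \<open>p\<close> is
  open. It holds at \<open>max q r\<close>, hence also for some larger \<open>p\<close>.\<close>

lemma interpolation_exponents:
  fixes n k q r :: real
  assumes n: "0 < n" and q: "1 \<le> q" and r: "1 \<le> r" and lt: "n * (1 / r - 1 / q) < k" and k: "0 < k"
  obtains p \<theta> where "q < p" "r \<le> p" "n * (1 / r - 1 / p) < k" "0 < \<theta>" "\<theta> < 1" "p * (q - 1) \<le> \<theta> * q * (p - 1)"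
proof -
  define \<gamma> where "\<gamma> = 1 / r - k / n"
  define m where "m = max q r"
  have m: "1 \<le> m" using q by (simp add: m_def)
  have "\<gamma> < 1 / r" using n k by (simp add: \<gamma>_def)
  moreover have "\<gamma> < 1 / q"
  proof -
    have "(1 / r - 1 / q) < k / n" using lt n by (simp add: pos_less_divide_eq mult.commute)
    then show ?thesis by (simp add: \<gamma>_def)
  qed
  ultimately have "\<gamma> < 1 / m" by (auto simp: m_def max_def)
  have "\<exists>p>m. \<gamma> < 1 / p"
  proof (cases "\<gamma> \<le> 0")
    case True
    have "0 < 1 / (m + 1)" using m by simp
    then show ?thesis using True by (intro exI[of _ "m + 1"]) linarith
  next
    case False
    then have "m < 1 / \<gamma>" using \<open>\<gamma> < 1 / m\<close> m by (simp add: field_simps)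
    then obtain p where p: "m < p" "p < 1 / \<gamma>" using dense by blast
    then have "\<gamma> < 1 / p" using False m by (simp add: field_simps)
    then show ?thesis using p by blast
  qed
  then obtain p where p: "m < p" "\<gamma> < 1 / p" by auto
  have qp: "q < p" and rp: "r \<le> p" using p by (auto simp: m_def)
  have p1: "1 < p" using p m by simp
  have "1 / r - 1 / p < k / n" using p by (simp add: \<gamma>_def)
  then have np: "n * (1 / r - 1 / p) < k" using n by (simp add: pos_less_divide_eq mult.commute)
  \<comment> \<open>The second entry is the smallest admissible value, below 1 because
    \<open>q < p\<close>; the entry \<open>1 / 2\<close> keeps \<theta> positive when
    \<open>q = 1\<close>.\<close>
  define \<theta> where "\<theta> = max (1 / 2) (p * (q - 1) / (q * (p - 1)))"
  have pos: "0 < q * (p - 1)" using q p1 by simp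
  have "p * (q - 1) < 1 * (q * (p - 1))" using qp by (simp add: algebra_simps)
  then have "\<theta> < 1" using pos by (simp add: \<theta>_def pos_divide_less_eq)
  moreover have "0 < \<theta>" by (simp add: \<theta>_def less_max_iff_disj)
  moreover have "p * (q - 1) \<le> \<theta> * (q * (p - 1))"
    using pos by (subst pos_divide_le_eq[symmetric]) (auto simp: \<theta>_def)
  ultimately show ?thesis using that[OF qp rp np] by (simp add: mult.assoc)
qed

theorem theorem1p3:
  fixes X Y :: "(real^'n::finite \<Rightarrow> real) \<Rightarrow> ennreal"
    and k :: nat and q :: real
  assumes "BBF X" and "BBF Y"
    and "1 \<le> k" and "1 \<le> q"
    and "1 < lower_boyd Y"
    and "ereal (real CARD('n)) * (1 / lower_boyd Y - ereal (1 / q)) < ereal (real k)"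
  shows
    "(1 < lower_boyd X \<longrightarrow>
       (\<exists>s0\<in>{0<..<1}. \<exists>C>0. \<forall>s\<in>{s0<..<1}. \<forall>f\<in>bf_space X \<inter> hom_sobolev k Y.
          ext_norm (calderon_lozanovskii s X Y) (frac_D q s k f)
            \<le> ennreal (C * ((s - s0) * (1 - s)) powr (- 1 / q))
               * enn_powr (X f) (1 - s) * enn_powr (Y (grad_norm k f)) s) \<and>
       (ereal q < lower_boyd X \<longrightarrow>
         (\<exists>C>0. \<forall>s\<in>{0<..<1}. \<forall>f\<in>bf_space X \<inter> hom_sobolev k Y.
            ext_norm (calderon_lozanovskii s X Y) (frac_D q s k f)
              \<le> ennreal (C * (s * (1 - s)) powr (- 1 / q))
                 * enn_powr (X f) (1 - s) * enn_powr (Y (grad_norm k f)) s)))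
     \<and>
     (\<exists>s0\<in>{0<..<1}. \<exists>C>0. \<forall>s\<in>{s0<..<1}. \<forall>f\<in>BMO \<inter> hom_sobolev k Y.
        ext_norm (convexification (1 / s) Y) (frac_D q s k f)
          \<le> ennreal (C * ((s - s0) * (1 - s)) powr (- 1 / q))
             * enn_powr (BMO_norm f) (1 - s) * enn_powr (Y (grad_norm k f)) s)"
proof -
  let ?n = "real CARD('n)" and ?K = "(2 * real CARD('n)) ^ k"
  have X: "BBF X" and Y: "BBF Y" and k: "1 \<le> k" and q: "1 \<le> q" using assms by auto
  \<comment> \<open>The dimension condition amounts to \<open>1 / \<beta> < lower_boyd Y\<close>,
    with an infinite index included. An exponent \<open>r\<close> above
    \<open>max 1 (1 / \<beta>)\<close> is then available and satisfies the same condition in place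
    of the index.\<close>
  define \<beta> where "\<beta> = 1 / q + real k / ?n"
  have \<beta>: "0 < \<beta>" using q by (simp add: \<beta>_def add_pos_nonneg)
  have "ereal (1 / \<beta>) < lower_boyd Y"
  proof (cases "lower_boyd Y")
    case (real l)
    then have l: "1 < l" using assms(5) by (simp add: one_ereal_def)
    then have "?n * (1 / l - 1 / q) < real k" using assms(6) real by (simp add: one_ereal_def)
    then have "1 / l - 1 / q < real k / ?n" by (simp add: pos_less_divide_eq mult.commute)
    then have "1 / l < \<beta>" by (simp add: \<beta>_def)
    then show ?thesis using l \<beta> real by (simp add: field_simps)
  qed (use assms(5) in auto)
  then have c: "1 \<le> max 1 (1 / \<beta>)" "ereal (max 1 (1 / \<beta>)) < lower_boyd Y"
    using assms(5) by (auto simp: max_def one_ereal_def)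
  obtain r CY where r0: "max 1 (1 / \<beta>) < r" and CY: "0 < CY"
    and data: "\<And>f f0. f \<in> hom_sobolev k Y \<Longrightarrow> f0 \<in> borel_measurable borel \<Longrightarrow> AE x in lborel. f x = f0 x \<Longrightarrow>
      \<exists>g. \<exists>Q\<in>bf_space Y. (\<forall>x. 0 \<le> Q x) \<and> Y Q \<le> ennreal CY * Y (grad_norm k f) \<and>
        (AE x in lborel. \<forall>\<epsilon>>0. \<forall>F>0. (\<forall>R>0. \<exists>c. (\<integral>\<^sup>+w. ennreal \<bar>f0 (x + R *\<^sub>R w) - c\<bar> \<partial>unif_ball) \<le> ennreal F)
          \<longrightarrow> pointwise_data f0 g k ?K F (Q x + \<epsilon>) r x)"
    by (rule sobolev_pointwise_data[OF Y k c]) (rule that; blast)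
  have r: "1 \<le> r" using r0 by simp
  have "1 / \<beta> < r" using r0 by simp
  then have "1 / r < \<beta>" using \<beta> r by (simp add: field_simps)
  then have "1 / r - 1 / q < real k / ?n" by (simp add: \<beta>_def)
  then have rq: "?n * (1 / r - 1 / q) < real k" by (simp add: pos_less_divide_eq mult.commute)
  obtain p \<theta> where qp: "q < p" and rp: "r \<le> p" and np: "?n * (1 / r - 1 / p) < real k"
    and \<theta>: "0 < \<theta>" "\<theta> < 1" "p * (q - 1) \<le> \<theta> * q * (p - 1)"
    using interpolation_exponents[OF _ q r rq] k by auto
  define A where "A = frac_const CARD('n) k q (total_const CARD('n) k ?K q r p \<theta>)"
  define B where "B = frac_const CARD('n) k q (total_const CARD('n) k ?K q r p (1 / 2)
        + (4 powr q * (2 ^ k) powr q + 2 powr q * ((2 ^ k) powr q * real k powr q * real k)))"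
  have A: "0 \<le> A" and B: "0 \<le> B" by (simp_all add: A_def B_def frac_const_def)

  \<comment> \<open>The common core of both claims of (i), with the pointwise estimate as premise
    \<open>pw\<close>: it is used with \<open>E = A\<close> and loss \<theta>, and with
    \<open>E = B\<close> and loss 0. The choice \<open>F = 2 * l\<close> bounds the first means of
    \<open>f0\<close>, and in the second use also its \<open>q\<close>-th power means, by
    \<open>F powr q\<close>.\<close>
  have part_i: "ext_norm (calderon_lozanovskii s X Y) (frac_D q s k f)
      \<le> ennreal ((E + 1) * (1 + 2 * CX) * (1 + CY) * ((s - \<theta>') * (1 - s)) powr (- 1 / q)) * enn_powr (X f) (1 - s) * enn_powr (Y (grad_norm k f)) s"
    if s: "0 < s" "\<theta>' < s" "s < 1" and E: "0 \<le> E" and CX: "0 < CX" and p': "1 \<le> p'"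
      and f: "f \<in> bf_space X" "f \<in> hom_sobolev k Y"
      and P: "P \<in> bf_space X" "\<And>x. 0 \<le> P x" "X P \<le> ennreal CX * X f"
      and Pm: "AE x in lborel. \<forall>R>0. (\<integral>\<^sup>+y\<in>ball x R. ennreal (\<bar>f y\<bar> powr p') \<partial>lebesgue) \<le> ennreal (P x powr p') * emeasure lebesgue (ball x R)"
      and pw: "\<And>(f0 :: real^'n \<Rightarrow> real) g F G x l. pointwise_data f0 g k ?K F G r x \<Longrightarrow> F = 2 * l \<Longrightarrow> f0 \<in> borel_measurable borel \<Longrightarrow>
          (\<And>R. 0 < R \<Longrightarrow> (\<integral>\<^sup>+w. ennreal (\<bar>f0 (x + R *\<^sub>R w)\<bar> powr p') \<partial>unif_ball) \<le> ennreal (l powr p')) \<Longrightarrow>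
          enn_powr (frac_integral q s k f0 x) (1 / q) \<le> ennreal (E * ((s - \<theta>') * (1 - s)) powr (- 1 / q) * (F powr (1 - s) * G powr s))"
    for s \<theta>' E CX p' f P
  proof -
    let ?w = "((s - \<theta>') * (1 - s)) powr (- 1 / q)"
    have fL: "f \<in> L0" using f by (simp add: bf_space_def)
    obtain f0 where f0: "f0 \<in> borel_measurable borel" "AE x in lborel. f x = f0 x"
      using borel_representative[OF fL] .
    note [measurable] = f0(1)
    obtain g Q where Q: "Q \<in> bf_space Y" "\<And>x. 0 \<le> Q x" "Y Q \<le> ennreal CY * Y (grad_norm k f)"
      and pd: "AE x in lborel. \<forall>\<epsilon>>0. \<forall>F>0. (\<forall>R>0. \<exists>c. (\<integral>\<^sup>+w. ennreal \<bar>f0 (x + R *\<^sub>R w) - c\<bar> \<partial>unif_ball) \<le> ennreal F)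
          \<longrightarrow> pointwise_data f0 g k ?K F (Q x + \<epsilon>) r x"
      using data[OF f(2) f0] by blast
    have "AE x in lborel. frac_D q s k f x \<le> ennreal (E * ?w * ((2 * P x) powr (1 - s) * Q x powr s))"
      using pd Pm AE_frac_D_eq[OF f0(2), of q s k]
    proof eventually_elim
      case (elim x)
      have "enn_powr (frac_integral q s k f0 x) (1 / q) \<le> ennreal (E * ?w * ((2 * P x) powr (1 - s) * Q x powr s))"
      proof (rule le_powr_product_limit)
        fix \<epsilon> :: real assume \<epsilon>: "0 < \<epsilon>"
        let ?l = "P x + \<epsilon>"
        have l: "0 < ?l" using P(2)[of x] \<epsilon> by simp
        have mp: "(\<integral>\<^sup>+w. ennreal (\<bar>f0 (x + R *\<^sub>R w)\<bar> powr p') \<partial>unif_ball) \<le> ennreal (?l powr p')" if R: "0 < R" for R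
        proof -
          have "(\<integral>\<^sup>+w. ennreal (\<bar>f0 (x + R *\<^sub>R w)\<bar> powr p') \<partial>unif_ball) \<le> ennreal (P x powr p')"
          proof (rule mean_le_of_ball_integral[where \<phi>="\<lambda>y. ennreal (\<bar>f0 y\<bar> powr p')", OF _ _ R])
            show "AE y in lborel. ennreal (\<bar>f y\<bar> powr p') = ennreal (\<bar>f0 y\<bar> powr p')"
              using f0(2) by eventually_elim simp
            show "(\<integral>\<^sup>+y\<in>ball x R. ennreal (\<bar>f y\<bar> powr p') \<partial>lebesgue) \<le> ennreal (P x powr p') * emeasure lebesgue (ball x R)"
              using elim(2) R by blast
          qed measurable
          also have "\<dots> \<le> ennreal (?l powr p')"
            using P(2)[of x] \<epsilon> p' by (intro ennreal_leI powr_mono2) auto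
          finally show ?thesis .
        qed
        \<comment> \<open>The constant 0 will do, as the mean of the absolute value of
          \<open>f0\<close> is itself at most \<open>2 * l\<close>.\<close>
        have "\<exists>c. (\<integral>\<^sup>+w. ennreal \<bar>f0 (x + R *\<^sub>R w) - c\<bar> \<partial>unif_ball) \<le> ennreal (2 * ?l)" if R: "0 < R" for R
          using mean_powr_le_lower_exponent[of "\<lambda>w. f0 (x + R *\<^sub>R w)", OF _ l _ p' mp[OF R]] l
          by (intro exI[of _ 0]) simp
        then have pdx: "pointwise_data f0 g k ?K (2 * ?l) (Q x + \<epsilon>) r x"
          using elim(1) \<epsilon> l by simp
        show "enn_powr (frac_integral q s k f0 x) (1 / q) \<le> ennreal (E * ?w * ((2 * ?l) powr (1 - s) * (Q x + \<epsilon>) powr s))"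
          by (rule pw[where l="?l", OF pdx refl f0(1)]) (rule mp)
      qed (use s P(2) Q(2) in auto)
      then show ?case using elim(3) by simp
    qed
    then have "ext_norm (calderon_lozanovskii s X Y) (frac_D q s k f)
        \<le> ennreal (E * ?w) * enn_powr (X (\<lambda>x. 2 * P x)) (1 - s) * enn_powr (Y Q) s"
      using s E P Q by (intro ext_norm_calderon_lozanovskii_le[OF X Y] bf_space_scale[OF X] measurable_frac_D fL) (auto simp: AE_lebesgue_iff)
    also have "\<dots> \<le> ennreal (E * ?w) * (ennreal (1 + 2 * CX) * enn_powr (X f) (1 - s)) * (ennreal (1 + CY) * enn_powr (Y (grad_norm k f)) s)"
    proof (intro mult_mono mult_left_mono enn_powr_le_const)
      have "X (\<lambda>x. 2 * P x) = ennreal 2 * X P" using BBF_scale[OF X, of P 2] P by (simp add: bf_space_def)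
      also have "\<dots> \<le> ennreal 2 * (ennreal CX * X f)" by (intro mult_left_mono P) simp
      also have "\<dots> = ennreal (2 * CX) * X f" using CX by (simp add: ennreal_mult mult.assoc)
      finally show "X (\<lambda>x. 2 * P x) \<le> ennreal (2 * CX) * X f" .
    qed (use s CX CY Q in auto)
    also have "\<dots> = ennreal (E * (1 + 2 * CX) * (1 + CY) * ?w) * enn_powr (X f) (1 - s) * enn_powr (Y (grad_norm k f)) s"
      using E CX CY by (simp add: ennreal_mult mult_ac del: ennreal_plus)
    \<comment> \<open>Passing from \<open>E\<close> to \<open>E + 1\<close> makes the constant
      positive.\<close>
    also have "\<dots> \<le> ennreal ((E + 1) * (1 + 2 * CX) * (1 + CY) * ?w) * enn_powr (X f) (1 - s) * enn_powr (Y (grad_norm k f)) s"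
      using E CX CY by (intro mult_right_mono ennreal_leI) auto
    finally show ?thesis .
  qed

  have i_a: "\<exists>s0\<in>{0<..<1}. \<exists>C>0. \<forall>s\<in>{s0<..<1}. \<forall>f\<in>bf_space X \<inter> hom_sobolev k Y.
          ext_norm (calderon_lozanovskii s X Y) (frac_D q s k f)
            \<le> ennreal (C * ((s - s0) * (1 - s)) powr (- 1 / q)) * enn_powr (X f) (1 - s) * enn_powr (Y (grad_norm k f)) s"
    if bX: "1 < lower_boyd X"
  proof -
    have bX1: "ereal 1 < lower_boyd X" using bX by (simp add: one_ereal_def)
    obtain p' CX where p': "1 < p'" and CX: "0 < CX" and max: "\<And>f. f \<in> bf_space X \<Longrightarrow> \<exists>P\<in>bf_space X. (\<forall>x. 0 \<le> P x) \<and> X P \<le> ennreal CX * X f \<and>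
       (AE x in lborel. \<forall>R>0. (\<integral>\<^sup>+y\<in>ball x R. ennreal (\<bar>f y\<bar> powr p') \<partial>lebesgue) \<le> ennreal (P x powr p') * emeasure lebesgue (ball x R))"
      by (rule lower_boyd_maximal[OF X order_refl bX1]) (rule that; blast)
    show ?thesis
    proof (intro bexI[of _ \<theta>] exI[of _ "(A + 1) * (1 + 2 * CX) * (1 + CY)"] conjI ballI)
      fix s f assume s: "s \<in> {\<theta><..<1}" and f: "f \<in> bf_space X \<inter> hom_sobolev k Y"
      obtain P where P: "P \<in> bf_space X" "\<And>x. 0 \<le> P x" "X P \<le> ennreal CX * X f"
        "AE x in lborel. \<forall>R>0. (\<integral>\<^sup>+y\<in>ball x R. ennreal (\<bar>f y\<bar> powr p') \<partial>lebesgue) \<le> ennreal (P x powr p') * emeasure lebesgue (ball x R)"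
        using max f by blast
      show "ext_norm (calderon_lozanovskii s X Y) (frac_D q s k f)
            \<le> ennreal ((A + 1) * (1 + 2 * CX) * (1 + CY) * ((s - \<theta>) * (1 - s)) powr (- 1 / q)) * enn_powr (X f) (1 - s) * enn_powr (Y (grad_norm k f)) s"
      proof (rule part_i[OF _ _ _ A CX _ _ _ P])
        fix f0 g :: "real^'n \<Rightarrow> real" and F G :: real and x assume "pointwise_data f0 g k ?K F G r x"
        then interpret pointwise_data f0 g k ?K F G r x .
        show "enn_powr (frac_integral q s k f0 x) (1 / q) \<le> ennreal (A * ((s - \<theta>) * (1 - s)) powr (- 1 / q) * (F powr (1 - s) * G powr s))"
          unfolding A_def using s by (intro frac_integral_le_interpolated[OF q qp rp np \<theta>]) auto
      qed (use s \<theta> f p' in auto)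
    qed (use A CX CY \<theta> in auto)
  qed

  have i_b: "\<exists>C>0. \<forall>s\<in>{0<..<1}. \<forall>f\<in>bf_space X \<inter> hom_sobolev k Y.
            ext_norm (calderon_lozanovskii s X Y) (frac_D q s k f)
              \<le> ennreal (C * (s * (1 - s)) powr (- 1 / q)) * enn_powr (X f) (1 - s) * enn_powr (Y (grad_norm k f)) s"
    if bX: "ereal q < lower_boyd X"
  proof -
    obtain p' CX where p': "q < p'" and CX: "0 < CX" and max: "\<And>f. f \<in> bf_space X \<Longrightarrow> \<exists>P\<in>bf_space X. (\<forall>x. 0 \<le> P x) \<and> X P \<le> ennreal CX * X f \<and>
       (AE x in lborel. \<forall>R>0. (\<integral>\<^sup>+y\<in>ball x R. ennreal (\<bar>f y\<bar> powr p') \<partial>lebesgue) \<le> ennreal (P x powr p') * emeasure lebesgue (ball x R))"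
      by (rule lower_boyd_maximal[OF X q bX]) (rule that; blast)
    show ?thesis
    proof (intro exI[of _ "(B + 1) * (1 + 2 * CX) * (1 + CY)"] conjI ballI)
      fix s f assume s: "s \<in> {0<..<1::real}" and f: "f \<in> bf_space X \<inter> hom_sobolev k Y"
      obtain P where P: "P \<in> bf_space X" "\<And>x. 0 \<le> P x" "X P \<le> ennreal CX * X f"
        "AE x in lborel. \<forall>R>0. (\<integral>\<^sup>+y\<in>ball x R. ennreal (\<bar>f y\<bar> powr p') \<partial>lebesgue) \<le> ennreal (P x powr p') * emeasure lebesgue (ball x R)"
        using max f by blast
      have "ext_norm (calderon_lozanovskii s X Y) (frac_D q s k f)
            \<le> ennreal ((B + 1) * (1 + 2 * CX) * (1 + CY) * ((s - 0) * (1 - s)) powr (- 1 / q)) * enn_powr (X f) (1 - s) * enn_powr (Y (grad_norm k f)) s"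
      proof (rule part_i[OF _ _ _ B CX _ _ _ P])
        fix f0 g :: "real^'n \<Rightarrow> real" and F G l :: real and x
        assume pd: "pointwise_data f0 g k ?K F G r x" and F2: "F = 2 * l" and [measurable]: "f0 \<in> borel_measurable borel"
          and mp: "\<And>R. 0 < R \<Longrightarrow> (\<integral>\<^sup>+w. ennreal (\<bar>f0 (x + R *\<^sub>R w)\<bar> powr p') \<partial>unif_ball) \<le> ennreal (l powr p')"
        interpret pointwise_data f0 g k ?K F G r x by (rule pd)
        have l: "0 < l" using F F2 by simp
        have mq: "(\<integral>\<^sup>+w. ennreal (\<bar>f0 (x + R *\<^sub>R w)\<bar> powr q) \<partial>unif_ball) \<le> ennreal (F powr q)" if R: "0 < R" for R
        proof -
          have "(\<integral>\<^sup>+w. ennreal (\<bar>f0 (x + R *\<^sub>R w)\<bar> powr q) \<partial>unif_ball) \<le> ennreal (2 * l powr q)"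
            using q p' by (intro mean_powr_le_lower_exponent[OF _ l _ _ mp[OF R]]) auto
          also have "\<dots> \<le> ennreal (F powr q)"
          proof (rule ennreal_leI)
            have "2 powr 1 * l powr q \<le> 2 powr q * l powr q" using q by (intro mult_right_mono powr_mono) auto
            then show "2 * l powr q \<le> F powr q" using l by (simp add: F2 powr_mult)
          qed
          finally show ?thesis .
        qed
        show "enn_powr (frac_integral q s k f0 x) (1 / q) \<le> ennreal (B * ((s - 0) * (1 - s)) powr (- 1 / q) * (F powr (1 - s) * G powr s))"
          using frac_integral_le_of_mean_powr[OF q qp rp np _ _ mq, of s] s by (simp add: B_def)
      qed (use s f p' q in auto)
      then show "ext_norm (calderon_lozanovskii s X Y) (frac_D q s k f)
            \<le> ennreal ((B + 1) * (1 + 2 * CX) * (1 + CY) * (s * (1 - s)) powr (- 1 / q)) * enn_powr (X f) (1 - s) * enn_powr (Y (grad_norm k f)) s"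
        by simp
    qed (use B CX CY in auto)
  qed

  have ii: "\<exists>s0\<in>{0<..<1}. \<exists>C>0. \<forall>s\<in>{s0<..<1}. \<forall>f\<in>BMO \<inter> hom_sobolev k Y.
        ext_norm (convexification (1 / s) Y) (frac_D q s k f)
          \<le> ennreal (C * ((s - s0) * (1 - s)) powr (- 1 / q)) * enn_powr (BMO_norm f) (1 - s) * enn_powr (Y (grad_norm k f)) s"
  proof -
    \<comment> \<open>The ratio of the volumes of a cube of side 2 and of the unit ball.\<close>
    define v where "v = 2 ^ CARD('n) / unit_ball_vol ?n"
    have v: "0 < v" by (simp add: v_def)
    show ?thesis
    proof (intro bexI[of _ \<theta>] exI[of _ "(A + 1) * (1 + v) * (1 + CY)"] conjI ballI)
      fix s f assume s: "s \<in> {\<theta><..<1}" and f: "f \<in> BMO \<inter> hom_sobolev k Y"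
      let ?w = "((s - \<theta>) * (1 - s)) powr (- 1 / q)"
      have s01: "0 < s" "s < 1" using s \<theta> by auto
      have fL: "f \<in> L0" using f by (simp add: BMO_def L1_loc_def)
      obtain f0 where f0: "f0 \<in> borel_measurable borel" "AE x in lborel. f x = f0 x"
        using borel_representative[OF fL] .
      obtain g Q where Q: "Q \<in> bf_space Y" "\<And>x. 0 \<le> Q x" "Y Q \<le> ennreal CY * Y (grad_norm k f)"
        and pd: "AE x in lborel. \<forall>\<epsilon>>0. \<forall>F>0. (\<forall>R>0. \<exists>c. (\<integral>\<^sup>+w. ennreal \<bar>f0 (x + R *\<^sub>R w) - c\<bar> \<partial>unif_ball) \<le> ennreal F)
          \<longrightarrow> pointwise_data f0 g k ?K F (Q x + \<epsilon>) r x"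
        using data[OF _ f0] f by blast
      define b where "b = enn2real (BMO_norm f)"
      have b: "BMO_norm f = ennreal b" "0 \<le> b" using f by (auto simp: BMO_def b_def)
      \<comment> \<open>Here \<open>F\<close> is the same number at all points. Its power leaves the
        norm as a scalar, and what remains is the power \<open>s\<close> of a single function in
        \<open>Y\<close>, measured by \<open>convexification (1 / s) Y\<close>.\<close>
      have "AE x in lborel. frac_D q s k f x \<le> ennreal (A * ?w * (v * b) powr (1 - s) * Q x powr s)"
        using pd AE_frac_D_eq[OF f0(2), of q s k]
      proof eventually_elim
        case (elim x)
        have "enn_powr (frac_integral q s k f0 x) (1 / q) \<le> ennreal (A * ?w * ((v * b) powr (1 - s) * Q x powr s))"
        proof (rule le_powr_product_limit)
          fix \<epsilon> :: real assume \<epsilon>: "0 < \<epsilon>"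
          have F: "0 < v * (b + \<epsilon>)" using v b \<epsilon> by simp
          have "\<exists>c. (\<integral>\<^sup>+w. ennreal \<bar>f0 (x + R *\<^sub>R w) - c\<bar> \<partial>unif_ball) \<le> ennreal (v * (b + \<epsilon>))" if "0 < R" for R
            using BMO_mean_oscillation[OF _ f0 that \<epsilon>, of x] f by (simp add: v_def b_def)
          then have "pointwise_data f0 g k ?K (v * (b + \<epsilon>)) (Q x + \<epsilon>) r x"
            using elim(1) \<epsilon> F by blast
          then interpret pointwise_data f0 g k ?K "v * (b + \<epsilon>)" "Q x + \<epsilon>" r x .
          show "enn_powr (frac_integral q s k f0 x) (1 / q) \<le> ennreal (A * ?w * ((v * (b + \<epsilon>)) powr (1 - s) * (Q x + \<epsilon>) powr s))"
            unfolding A_def using s by (intro frac_integral_le_interpolated[OF q qp rp np \<theta>]) auto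
        qed (use s01 v b Q(2) in auto)
        then show ?case using elim(2) by (simp add: mult.assoc)
      qed
      then have "ext_norm (convexification (1 / s) Y) (frac_D q s k f) \<le> ennreal (A * ?w * (v * b) powr (1 - s)) * enn_powr (Y Q) s"
        using s01 A Q by (intro ext_norm_convexification_le[OF Y] measurable_frac_D fL) (auto simp: AE_lebesgue_iff)
      also have "\<dots> \<le> ennreal ((A + 1) * ?w * ((1 + v) * b powr (1 - s))) * (ennreal (1 + CY) * enn_powr (Y (grad_norm k f)) s)"
      proof (intro mult_mono ennreal_leI enn_powr_le_const)
        have "v powr (1 - s) \<le> (1 + v) powr (1 - s)" using v s01 by (intro powr_mono2) auto
        also have "\<dots> \<le> (1 + v) powr 1" using v s01 by (intro powr_mono) auto
        finally have "v powr (1 - s) * b powr (1 - s) \<le> (1 + v) * b powr (1 - s)" using v by (intro mult_right_mono) auto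
        then show "(v * b) powr (1 - s) \<le> (1 + v) * b powr (1 - s)" using v b by (simp add: powr_mult)
      qed (use s01 A CY Q v in auto)
      also have "\<dots> = ennreal ((A + 1) * (1 + v) * (1 + CY) * ?w) * enn_powr (BMO_norm f) (1 - s) * enn_powr (Y (grad_norm k f)) s"
        using A v CY b by (simp add: ennreal_mult mult_ac del: ennreal_plus)
      finally show "ext_norm (convexification (1 / s) Y) (frac_D q s k f)
          \<le> ennreal ((A + 1) * (1 + v) * (1 + CY) * ?w) * enn_powr (BMO_norm f) (1 - s) * enn_powr (Y (grad_norm k f)) s" .
    qed (use A v CY \<theta> in auto)
  qed
  show ?thesis using i_a i_b ii by blast
qed

end
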